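(* Let $\omega$ be a set of primes in $\mathbb{Q}[x]$. Every $\omega$-restricted nilpotent $\mathbb{Q}[x]$-powered group $G$ has property $\mathcal{G}_{\omega}$ for its family of normal $\mathbb{Q}[x]$-subgroups; that is, every $\omega'$-isolated normal $\mathbb{Q}[x]$-subgroup of $G$ is $\mathcal{FT}_{\omega}$-separable in $G$.
   Context: Nilpotent $\mathbb{Q}[x]$-powered groups. For $\alpha\in\mathbb{Q}[x]$ and $k\ge 1$ put $\binom{\alpha}{k}=\alpha(\alpha-1)\cdots(\alpha-k+1)/k!\in\mathbb{Q}[x]$. A nilpotent $\mathbb{Q}[x]$-powered group is a nilpotent group $G$ with a map $G\times\mathbb{Q}[x]\to G$, $(g,\alpha)\mapsto g^{\alpha}$, such that (1) $g^1=g$, $g^{\alpha}g^{\beta}=g^{\alpha+\beta}$, $(g^{\alpha})^{\beta}=g^{\alpha\beta}$; (2) $(h^{-1}gh)^{\alpha}=h^{-1}g^{\alpha}h$; (3) for $g_1,\dots,g_n\in G$ and $\alpha \in \mathbb{Q}[x]$, $g_1^{\alpha}\cdots g_n^{\alpha}=\tau_1(\bar g)^{\alpha}\tau_2(\bar g)^{\binom{\alpha}{2}}\cdots\tau_k(\bar g)^{\binom{\alpha}{k}}$, where $\bar g=(g_1,\dots,g_n)$, $k$ is the nilpotency class of the group generated by $g_1,\dots,g_n$, and $\tau_i$ is the $i$th Hall–Petresco word (the words in the free group on $x_1,\dots,x_n$ defined recursively by $x_1^{m}\cdots x_n^{m}=\tau_1^{m}\tau_2^{\binom m2}\cdots\tau_{m}^{\binom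 mm}$ for all positive integers $m$). A $\mathbb{Q}[x]$-subgroup is a subgroup closed under the action; a $\mathbb{Q}[x]$-homomorphism is a group homomorphism commuting with the action; if $N$ is a normal $\mathbb{Q}[x]$-subgroup, the $\mathbb{Q}[x]$-quotient $G/N$ has the action $(gN)^{\alpha}=g^{\alpha}N$. $G$ is finitely $\mathbb{Q}[x]$-generated if it is the smallest $\mathbb{Q}[x]$-subgroup containing some finite subset. An abelian $\mathbb{Q}[x]$-group is a nilpotent $\mathbb{Q}[x]$-powered group that is abelian, equivalently a $\mathbb{Q}[x]$-module written multiplicatively with scalars as exponents. Primes. Let $\mathbb{M}$ be the set of monic irreducible polynomials in $\mathbb{Q}[x]$. A set of primes $\omega$ is a non-empty subset of $\mathbb{M}$, and $\omega'=\mathbb{M}\setminus\omega$. An $\omega$-member is a monic non-constant polynomial all of whose monic irreducible divisors lie in $\omega$ (similarly for $\omega'$). An element $g$ is $\omega$-torsion if $g^{\alpha}=1$ for some $\omega$-member $\alpha$; a group is $\omega$-torsion if all its elements are. For $\pi \in \mathbb{M}$, $\tau_{\pi}(A)$ is the set of $a\in A$ with $a^{\pi^k}=1$ for some $k\ge1$. An abelian $\mathbb{Q}[x]$-group $A$ is $\omega$-restricted if for every $\mathbb{Q}[x]$-quotient $A/N$ and every $\pi\in\omega$, $\tau_{\pi}(A/N)$ is finitely $\mathbb{Q}[x]$-generated. A nilpotent $\mathbb{Q}[x]$-powered group is $\omega$-restricted if it has a finite central series consisting of $\mathbb{Q}[x]$-subgroups whose factors are $\omega$-restricted abelian $\mathbb{Q}[x]$-groups.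 $\mathcal{FT}_{\omega}$ is the class of finitely $\mathbb{Q}[x]$-generated $\omega$-torsion nilpotent $\mathbb{Q}[x]$-powered groups. A $\mathbb{Q}[x]$-subgroup $H$ of $G$ is $\mathcal{FT}_{\omega}$-separable in $G$ if for every $g\in G\setminus H$ there is a $\mathbb{Q}[x]$-homomorphism $\varphi$ of $G$ onto some $K\in\mathcal{FT}_{\omega}$ with $\varphi(g)\notin\varphi(H)$. $H$ is $\omega'$-isolated in $G$ if $g\in G$ and $g^{\lambda}\in H$ for some $\omega'$-member $\lambda$ imply $g\in H$. *)

theory Defs
  imports
    "HOL-Algebra.Coset"
    "HOL-Algebra.Generated_Groups"
    "HOL-Computational_Algebra.Polynomial"
begin

section \<open>Nilpotent groups\<close>

definition commutator :: "('a, 'b) monoid_scheme \<Rightarrow> 'a \<Rightarrow> 'a \<Rightarrow> 'a" where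
  "commutator G a b = inv\<^bsub>G\<^esub> a \<otimes>\<^bsub>G\<^esub> inv\<^bsub>G\<^esub> b \<otimes>\<^bsub>G\<^esub> a \<otimes>\<^bsub>G\<^esub> b"

text \<open>The numbering starts at 0, so that a nilpotent group has class \<open>c\<close> iff \<open>c\<close> is the least
  index at which the lower central series is trivial.\<close>

primrec lower_central :: "('a, 'b) monoid_scheme \<Rightarrow> nat \<Rightarrow> 'a set" where
  "lower_central G 0 = carrier G"
| "lower_central G (Suc n) =
     generate G {commutator G a b | a b. a \<in> lower_central G n \<and> b \<in> carrier G}"

definition nilpotent_group :: "('a, 'b) monoid_scheme \<Rightarrow> bool" where
  "nilpotent_group G \<longleftrightarrow> group G \<and> (\<exists>c. lower_central G c = {\<one>\<^bsub>G\<^esub>})"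

definition nilpotency_class :: "('a, 'b) monoid_scheme \<Rightarrow> nat" where
  "nilpotency_class G = (LEAST c. lower_central G c = {\<one>\<^bsub>G\<^esub>})"

section \<open>Hall--Petresco words\<close>

text \<open>Elements of the free group on \<open>n\<close> generators are represented by (not necessarily reduced)
  words in the letters \<open>(i, True)\<close> and \<open>(i, False)\<close>, \<open>i < n\<close>, standing for the generator with
  index \<open>i\<close> (counted from 0) and for its inverse.\<close>

type_synonym word = "(nat \<times> bool) list"

definition word_inv :: "word \<Rightarrow> word" where
  "word_inv w = rev (map (\<lambda>(i, b). (i, \<not> b)) w)"

definition word_pow :: "word \<Rightarrow> nat \<Rightarrow> word" where
  "word_pow w m = concat (replicate m w)"

text \<open>Solving \<open>x\<^sub>1\<^sup>m \<dots> x\<^sub>n\<^sup>m = \<tau>\<^sub>1\<^sup>m \<tau>\<^sub>2\<^bsup>m choose 2\<^esup> \<dots> \<tau>\<^sub>m\<close>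
  for the last factor \<open>\<tau>\<^sub>m\<close>, whose exponent is \<open>m choose m = 1\<close>.
  The value at \<open>m = 0\<close> is irrelevant.\<close>

fun hall_petresco :: "nat \<Rightarrow> nat \<Rightarrow> word" where
  "hall_petresco n m =
     word_inv (concat (map (\<lambda>i. word_pow (hall_petresco n i) (m choose i)) [1..<m]))
     @ concat (map (\<lambda>i. word_pow [(i, True)] m) [0..<n])"

declare hall_petresco.simps [simp del]

definition list_prod :: "('a, 'b) monoid_scheme \<Rightarrow> 'a list \<Rightarrow> 'a" where
  "list_prod G xs = foldr (\<lambda>x y. x \<otimes>\<^bsub>G\<^esub> y) xs \<one>\<^bsub>G\<^esub>"

definition eval_word :: "('a, 'b) monoid_scheme \<Rightarrow> 'a list \<Rightarrow> word \<Rightarrow> 'a" where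
  "eval_word G gs w = list_prod G (map (\<lambda>(i, b). if b then gs ! i else inv\<^bsub>G\<^esub> (gs ! i)) w)"

text \<open>The defining relations of the words hold in every group.\<close>

context group
begin

lemma list_prod_closed [simp]: "set xs \<subseteq> carrier G \<Longrightarrow> list_prod G xs \<in> carrier G"
  by (induction xs) (auto simp: list_prod_def)

lemma list_prod_append:
  "set xs \<subseteq> carrier G \<Longrightarrow> set ys \<subseteq> carrier G \<Longrightarrow>
     list_prod G (xs @ ys) = list_prod G xs \<otimes> list_prod G ys"
proof (induction xs)
  case Nil
  then show ?case using list_prod_closed by (simp add: list_prod_def)
next
  case (Cons x xs)
  then show ?case using list_prod_closed by (simp add: list_prod_def m_assoc)
qed

definition valid_word :: "'a list \<Rightarrow> word \<Rightarrow> bool" where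
  "valid_word gs w \<longleftrightarrow> set gs \<subseteq> carrier G \<and> fst ` set w \<subseteq> {..<length gs}"

lemma eval_letters:
  assumes "valid_word gs w"
  shows "set (map (\<lambda>(i, b). if b then gs ! i else inv (gs ! i)) w) \<subseteq> carrier G"
proof -
  have "gs ! i \<in> carrier G" if "(i, b) \<in> set w" for i b
    using assms that unfolding valid_word_def by (force intro: nth_mem)
  then show ?thesis by auto
qed

lemma eval_word_closed: "valid_word gs w \<Longrightarrow> eval_word G gs w \<in> carrier G"
  using eval_letters[of gs w] by (simp add: eval_word_def)

lemma eval_word_append:
  assumes "valid_word gs v" "valid_word gs w"
  shows "eval_word G gs (v @ w) = eval_word G gs v \<otimes> eval_word G gs w"
  using list_prod_append[OF eval_letters[OF assms(1)] eval_letters[OF assms(2)]]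
  by (simp add: eval_word_def)

lemma eval_word_inv:
  assumes "valid_word gs w"
  shows "eval_word G gs (word_inv w) = inv (eval_word G gs w)"
  using assms
proof (induction w)
  case Nil
  then show ?case by (simp add: word_inv_def eval_word_def list_prod_def)
next
  case (Cons x w)
  obtain i b where x: "x = (i, b)" by fastforce
  have w: "valid_word gs w" and v: "valid_word gs (word_inv w)"
    and xv: "valid_word gs [(i, b)]" "valid_word gs [(i, \<not> b)]"
    using Cons.prems x by (auto simp: valid_word_def word_inv_def)
  have i: "gs ! i \<in> carrier G"
    using Cons.prems x by (auto simp: valid_word_def)
  have "eval_word G gs (word_inv (x # w)) = eval_word G gs (word_inv w @ [(i, \<not> b)])"
    by (simp add: word_inv_def x)
  also have "\<dots> = inv (eval_word G gs w) \<otimes> eval_word G gs [(i, \<not> b)]"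
    using eval_word_append[OF v xv(2)] Cons.IH[OF w] by simp
  also have "eval_word G gs [(i, \<not> b)] = inv (eval_word G gs [(i, b)])"
    using i by (simp add: eval_word_def list_prod_def)
  also have "inv (eval_word G gs w) \<otimes> \<dots> = inv (eval_word G gs ([(i, b)] @ w))"
    using eval_word_append[OF xv(1) w] eval_word_closed[OF xv(1)] eval_word_closed[OF w]
    by (simp add: inv_mult_group)
  finally show ?case by (simp add: x)
qed

lemma valid_word_concat:
  "set gs \<subseteq> carrier G \<Longrightarrow> (\<And>w. w \<in> set ws \<Longrightarrow> valid_word gs w) \<Longrightarrow> valid_word gs (concat ws)"
  unfolding valid_word_def by fastforce

lemma eval_word_concat:
  "set gs \<subseteq> carrier G \<Longrightarrow> (\<And>w. w \<in> set ws \<Longrightarrow> valid_word gs w) \<Longrightarrow>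
     eval_word G gs (concat ws) = list_prod G (map (eval_word G gs) ws)"
proof (induction ws)
  case Nil
  then show ?case by (simp add: eval_word_def list_prod_def)
next
  case (Cons w ws)
  then show ?case
    using eval_word_append[of gs w "concat ws"] valid_word_concat[of gs ws]
    by (simp add: list_prod_def)
qed

lemma valid_word_pow: "valid_word gs w \<Longrightarrow> valid_word gs (word_pow w m)"
  unfolding word_pow_def using valid_word_concat[of gs "replicate m w"]
  by (auto simp: valid_word_def)

lemma eval_word_pow:
  assumes "valid_word gs w"
  shows "eval_word G gs (word_pow w m) = eval_word G gs w [^] m"
proof (induction m)
  case 0
  then show ?case by (simp add: word_pow_def eval_word_def list_prod_def)
next
  case (Suc m)
  have "eval_word G gs (word_pow w (Suc m)) = eval_word G gs (w @ word_pow w m)"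
    by (simp add: word_pow_def)
  also have "\<dots> = eval_word G gs w \<otimes> eval_word G gs w [^] m"
    using eval_word_append[OF assms valid_word_pow[OF assms]] Suc by simp
  finally show ?case
    using eval_word_closed[OF assms] by (metis nat_pow_Suc2)
qed

lemma valid_hall_petresco:
  "set gs \<subseteq> carrier G \<Longrightarrow> valid_word gs (hall_petresco (length gs) m)"
proof (induction m rule: less_induct)
  case (less m)
  have "valid_word gs (concat (map (\<lambda>i. word_pow (hall_petresco (length gs) i) (m choose i)) [1..<m]))"
    using less by (intro valid_word_concat) (auto intro: valid_word_pow)
  moreover have "valid_word gs (concat (map (\<lambda>i. word_pow [(i, True)] m) [0..<length gs]))"
  proof (rule valid_word_concat[OF less.prems])
    fix w assume "w \<in> set (map (\<lambda>i. word_pow [(i, True)] m) [0..<length gs])"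
    then obtain i where "i < length gs" "w = word_pow [(i, True)] m" by auto
    moreover from this have "valid_word gs [(i, True)]"
      using less.prems by (simp add: valid_word_def)
    ultimately show "valid_word gs w" using valid_word_pow by simp
  qed
  ultimately show ?case
    by (subst hall_petresco.simps) (force simp: valid_word_def word_inv_def)
qed

lemma hall_petresco_identity:
  assumes gs: "set gs \<subseteq> carrier G" and m: "m \<ge> 1"
  shows "list_prod G (map (\<lambda>g. g [^] m) gs) =
         list_prod G (map (\<lambda>i. eval_word G gs (hall_petresco (length gs) i) [^] (m choose i))
           [1..<Suc m])"
proof -
  let ?t = "hall_petresco (length gs)"
  let ?u = "concat (map (\<lambda>i. word_pow (?t i) (m choose i)) [1..<m])"
  let ?x = "concat (map (\<lambda>i. word_pow [(i, True)] m) [0..<length gs])"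
  have ws: "\<And>w. w \<in> set (map (\<lambda>i. word_pow (?t i) (m choose i)) [1..<m]) \<Longrightarrow> valid_word gs w"
    and xs: "\<And>w. w \<in> set (map (\<lambda>i. word_pow [(i, True)] m) [0..<length gs]) \<Longrightarrow> valid_word gs w"
    using gs valid_hall_petresco[OF gs]
    by (auto intro!: valid_word_pow simp: valid_word_def[of _ "[_]"])
  have u: "valid_word gs ?u" and x: "valid_word gs ?x"
    by (rule valid_word_concat[OF gs ws], assumption, rule valid_word_concat[OF gs xs])
  have u': "valid_word gs (word_inv ?u)"
    using u by (force simp: valid_word_def word_inv_def)
  have t: "?t m = word_inv ?u @ ?x"
    by (subst hall_petresco.simps) simp
  have "eval_word G gs ?u \<otimes> eval_word G gs (?t m) = eval_word G gs ?x"
    unfolding t eval_word_append[OF u' x] eval_word_inv[OF u]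
    using eval_word_closed[OF u] eval_word_closed[OF x] by (simp flip: m_assoc)
  moreover have "eval_word G gs ?x = list_prod G (map (\<lambda>i. (gs ! i) [^] m) [0..<length gs])"
  proof -
    have letter: "eval_word G gs (word_pow [(i, True)] m) = (gs ! i) [^] m" if "i < length gs" for i
      using that gs eval_word_pow[of gs "[(i, True)]" m]
      by (auto simp: valid_word_def eval_word_def list_prod_def dest: nth_mem)
    show ?thesis
      by (subst eval_word_concat[OF gs xs], assumption)
        (intro arg_cong[where f = "list_prod G"], auto simp: letter)
  qed
  moreover have "map (\<lambda>i. (gs ! i) [^] m) [0..<length gs] = map (\<lambda>g. g [^] m) gs"
    by (rule nth_equalityI) auto
  moreover have "eval_word G gs ?u =
      list_prod G (map (\<lambda>i. eval_word G gs (?t i) [^] (m choose i)) [1..<m])"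
    by (subst eval_word_concat[OF gs ws], assumption)
      (intro arg_cong[where f = "list_prod G"], auto simp: eval_word_pow valid_hall_petresco[OF gs])
  moreover have "list_prod G (map (\<lambda>i. eval_word G gs (?t i) [^] (m choose i)) [1..<Suc m]) =
      list_prod G (map (\<lambda>i. eval_word G gs (?t i) [^] (m choose i)) [1..<m]) \<otimes> eval_word G gs (?t m)"
  proof -
    have c: "eval_word G gs (?t i) \<in> carrier G" for i
      using eval_word_closed[OF valid_hall_petresco[OF gs]] .
    show ?thesis
      using m c list_prod_append[of "map (\<lambda>i. eval_word G gs (?t i) [^] (m choose i)) [1..<m]"
          "[eval_word G gs (?t m)]"]
      by (auto simp: list_prod_def)
  qed
  ultimately show ?thesis by simp
qed

end

section \<open>Nilpotent \<open>\<rat>[x]\<close>-powered groups\<close>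

record 'a powered_group = "'a monoid" +
  qpow :: "'a \<Rightarrow> rat poly \<Rightarrow> 'a"  (infixl \<open>\<up>\<index>\<close> 80)

definition poly_choose :: "rat poly \<Rightarrow> nat \<Rightarrow> rat poly" where
  "poly_choose \<alpha> k = smult (1 / fact k) (\<Prod>i<k. \<alpha> - of_nat i)"

locale nilpotent_powered_group = group G for G :: "('a, 'b) powered_group_scheme" (structure) +
  assumes nilpotent: "nilpotent_group G"
    and qpow_closed: "g \<in> carrier G \<Longrightarrow> g \<up> \<alpha> \<in> carrier G"
    and qpow_one: "g \<in> carrier G \<Longrightarrow> g \<up> 1 = g"
    and qpow_add: "g \<in> carrier G \<Longrightarrow> g \<up> \<alpha> \<otimes> g \<up> \<beta> = g \<up> (\<alpha> + \<beta>)"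
    and qpow_mult: "g \<in> carrier G \<Longrightarrow> (g \<up> \<alpha>) \<up> \<beta> = g \<up> (\<alpha> * \<beta>)"
    and qpow_conj: "\<lbrakk>g \<in> carrier G; h \<in> carrier G\<rbrakk> \<Longrightarrow>
          (inv h \<otimes> g \<otimes> h) \<up> \<alpha> = inv h \<otimes> g \<up> \<alpha> \<otimes> h"
    and qpow_hall_petresco: "set gs \<subseteq> carrier G \<Longrightarrow>
          list_prod G (map (\<lambda>g. g \<up> \<alpha>) gs) =
          list_prod G (map (\<lambda>i. eval_word G gs (hall_petresco (length gs) i) \<up> poly_choose \<alpha> i)
            [1..<Suc (nilpotency_class (G\<lparr>carrier := generate G (set gs)\<rparr>))])"

definition powered_subgroup :: "'a set \<Rightarrow> ('a, 'b) powered_group_scheme \<Rightarrow> bool" where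
  "powered_subgroup H G \<longleftrightarrow> subgroup H G \<and> (\<forall>h\<in>H. \<forall>\<alpha>. h \<up>\<^bsub>G\<^esub> \<alpha> \<in> H)"

definition normal_powered_subgroup :: "'a set \<Rightarrow> ('a, 'b) powered_group_scheme \<Rightarrow> bool" where
  "normal_powered_subgroup N G \<longleftrightarrow> powered_subgroup N G \<and> N \<lhd> G"

definition powered_hom ::
  "('a, 'c) powered_group_scheme \<Rightarrow> ('b, 'd) powered_group_scheme \<Rightarrow> ('a \<Rightarrow> 'b) set" where
  "powered_hom G K =
     {\<phi> \<in> hom G K. \<forall>g\<in>carrier G. \<forall>\<alpha>. \<phi> (g \<up>\<^bsub>G\<^esub> \<alpha>) = \<phi> g \<up>\<^bsub>K\<^esub> \<alpha>}"

text \<open>The action on the quotient is \<open>(N g)\<^sup>\<alpha> = N g\<^sup>\<alpha>\<close>. The union below runs over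
  all representatives \<open>g\<close> of the coset; for a normal \<open>\<rat>[x]\<close>-subgroup \<open>N\<close> they all give the same
  coset \<open>N g\<^sup>\<alpha>\<close>.\<close>

definition powered_quotient :: "('a, 'b) powered_group_scheme \<Rightarrow> 'a set \<Rightarrow> 'a set powered_group" where
  "powered_quotient G N =
     \<lparr>carrier = carrier (G Mod N), monoid.mult = (\<otimes>\<^bsub>G Mod N\<^esub>), one = \<one>\<^bsub>G Mod N\<^esub>,
      qpow = (\<lambda>C \<alpha>. \<Union>g\<in>C. N #>\<^bsub>G\<^esub> (g \<up>\<^bsub>G\<^esub> \<alpha>))\<rparr>"

definition powered_generate :: "('a, 'b) powered_group_scheme \<Rightarrow> 'a set \<Rightarrow> 'a set" where
  "powered_generate G S = \<Inter>{H. powered_subgroup H G \<and> S \<subseteq> H}"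

definition finitely_powered_generated :: "('a, 'b) powered_group_scheme \<Rightarrow> bool" where
  "finitely_powered_generated G \<longleftrightarrow>
     (\<exists>S. finite S \<and> S \<subseteq> carrier G \<and> powered_generate G S = carrier G)"

definition abelian_powered_group :: "('a, 'b) powered_group_scheme \<Rightarrow> bool" where
  "abelian_powered_group A \<longleftrightarrow> nilpotent_powered_group A \<and> comm_group A"

section \<open>Primes, torsion, restricted groups and separability\<close>

definition monic_irreducibles :: "rat poly set" where
  "monic_irreducibles = {\<pi>. lead_coeff \<pi> = 1 \<and> irreducible \<pi>}"

definition set_of_primes :: "rat poly set \<Rightarrow> bool" where
  "set_of_primes \<omega> \<longleftrightarrow> \<omega> \<noteq> {} \<and> \<omega> \<subseteq> monic_irreducibles"

definition prime_member :: "rat poly set \<Rightarrow> rat poly \<Rightarrow> bool" where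
  "prime_member \<omega> \<alpha> \<longleftrightarrow> lead_coeff \<alpha> = 1 \<and> degree \<alpha> > 0 \<and>
     (\<forall>\<pi>\<in>monic_irreducibles. \<pi> dvd \<alpha> \<longrightarrow> \<pi> \<in> \<omega>)"

definition torsion_group :: "rat poly set \<Rightarrow> ('a, 'b) powered_group_scheme \<Rightarrow> bool" where
  "torsion_group \<omega> G \<longleftrightarrow>
     (\<forall>g\<in>carrier G. \<exists>\<alpha>. prime_member \<omega> \<alpha> \<and> g \<up>\<^bsub>G\<^esub> \<alpha> = \<one>\<^bsub>G\<^esub>)"

definition primary_part :: "rat poly \<Rightarrow> ('a, 'b) powered_group_scheme \<Rightarrow> 'a set" where
  "primary_part \<pi> A = {a \<in> carrier A. \<exists>k\<ge>1. a \<up>\<^bsub>A\<^esub> (\<pi> ^ k) = \<one>\<^bsub>A\<^esub>}"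

definition restricted_abelian :: "rat poly set \<Rightarrow> ('a, 'b) powered_group_scheme \<Rightarrow> bool" where
  "restricted_abelian \<omega> A \<longleftrightarrow> abelian_powered_group A \<and>
     (\<forall>N \<pi>. normal_powered_subgroup N A \<and> \<pi> \<in> \<omega> \<longrightarrow>
        finitely_powered_generated
          ((powered_quotient A N)\<lparr>carrier := primary_part \<pi> (powered_quotient A N)\<rparr>))"

text \<open>The commutator condition says that \<open>H (Suc i) / H i\<close> is central in \<open>G / H i\<close>.\<close>

definition central_powered_series ::
  "('a, 'b) powered_group_scheme \<Rightarrow> (nat \<Rightarrow> 'a set) \<Rightarrow> nat \<Rightarrow> bool" where
  "central_powered_series G H r \<longleftrightarrow>
     H 0 = {\<one>\<^bsub>G\<^esub>} \<and> H r = carrier G \<and>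
     (\<forall>i\<le>r. normal_powered_subgroup (H i) G) \<and>
     (\<forall>i<r. H i \<subseteq> H (Suc i) \<and>
        (\<forall>a\<in>H (Suc i). \<forall>g\<in>carrier G. commutator G a g \<in> H i))"

definition prime_restricted :: "rat poly set \<Rightarrow> ('a, 'b) powered_group_scheme \<Rightarrow> bool" where
  "prime_restricted \<omega> G \<longleftrightarrow> nilpotent_powered_group G \<and>
     (\<exists>H r. central_powered_series G H r \<and>
        (\<forall>i<r. restricted_abelian \<omega> (powered_quotient (G\<lparr>carrier := H (Suc i)\<rparr>) (H i))))"

definition FT :: "rat poly set \<Rightarrow> ('a, 'b) powered_group_scheme \<Rightarrow> bool" where
  "FT \<omega> K \<longleftrightarrow> nilpotent_powered_group K \<and> finitely_powered_generated K \<and> torsion_group \<omega> K"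

text \<open>HOL cannot quantify existentially over the carrier type of \<open>K\<close>. Taking subsets of \<open>G\<close> as
  elements of \<open>K\<close> loses nothing, since any homomorphic image of \<open>G\<close> is isomorphic to the quotient
  by the kernel, whose elements are cosets.\<close>

definition FT_separable :: "rat poly set \<Rightarrow> 'a set \<Rightarrow> ('a, 'b) powered_group_scheme \<Rightarrow> bool" where
  "FT_separable \<omega> H G \<longleftrightarrow>
     (\<forall>g \<in> carrier G - H. \<exists>(K :: 'a set powered_group) \<phi>.
        FT \<omega> K \<and> \<phi> \<in> powered_hom G K \<and> \<phi> ` carrier G = carrier K \<and> \<phi> g \<notin> \<phi> ` H)"

definition isolated :: "rat poly set \<Rightarrow> 'a set \<Rightarrow> ('a, 'b) powered_group_scheme \<Rightarrow> bool" where
  "isolated \<sigma> H G \<longleftrightarrow>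
     (\<forall>g\<in>carrier G. \<forall>\<alpha>. prime_member \<sigma> \<alpha> \<and> g \<up>\<^bsub>G\<^esub> \<alpha> \<in> H \<longrightarrow> g \<in> H)"

end

theory Submission
  imports Defs "HOL-Computational_Algebra.Polynomial_Factorial"
    "HOL-Computational_Algebra.Field_as_Ring"
begin

text \<open>Given \<open>g \<notin> N\<close>, Zorn's lemma yields a normal \<open>\<rat>[x]\<close>-subgroup \<open>M \<supseteq> N\<close> that is maximal among
  those containing no power \<open>g\<^sup>\<mu>\<close>, where \<open>\<mu>\<close> is 1 or an \<open>\<omega>'\<close>-member. In \<open>G/M\<close> every nontrivial normal
  \<open>\<rat>[x]\<close>-subgroup meets these powers, which forces the centre, viewed as a module over \<open>\<rat>[x]\<close>, to be
  \<open>\<pi>\<close>-primary for a single \<open>\<pi> \<in> \<omega>\<close>. Since \<open>G\<close> is \<open>\<omega>\<close>-restricted, the centre has bounded exponent \<open>\<pi>\<^sup>e\<close>,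
  which propagates along the upper central series. So \<open>G/M\<close> is \<open>\<pi>\<close>-torsion, and then the factors of
  its central series are their own \<open>\<pi>\<close>-primary parts, hence finitely generated.

  That \<open>G/M\<close> is again a \<open>\<rat>[x]\<close>-powered group rests on the theorem of Hall and Petresco that the
  \<open>i\<close>th Hall--Petresco word lies in the \<open>i\<close>th term of the lower central series. It is proved with
  the group of faces of a cube.\<close>

section \<open>Commutators and the lower central series\<close>

text \<open>Avoiding \<open>g\<close> alone would not do: a maximal \<open>M\<close> could then
  leave a centre that is primary for a prime outside \<omega>. Avoiding all the powers g^\<mu>
  excludes this, and that \<open>N\<close> itself avoids them is what isolation provides. A
  torsion-free centre is impossible because, for central z and \<pi> in \<omega>, the submodule
  generated by z^\<pi> has to contain some z^\<mu> with \<mu> prime to \<pi>; then \<mu> - \<pi>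
  \<beta> annihilates z for some \<beta>. Being \<pi>-primary does not bound the exponent. The bound
  comes from finitely many generators of the \<pi>-part of each factor, and these survive in G/M
  because a factor of the image series is a quotient of a factor of the given series, while the
  definition of restricted covers all quotients.\<close>

context group
begin

lemma inv_mult_cancel:
  assumes "x \<in> carrier G" "y \<in> carrier G"
  shows "inv x \<otimes> (x \<otimes> y) = y" "x \<otimes> (inv x \<otimes> y) = y"
  using assms by (simp_all flip: m_assoc)

lemmas word_simps = m_assoc inv_mult_group inv_mult_cancel

lemma commutator_closed [simp]:
  "a \<in> carrier G \<Longrightarrow> b \<in> carrier G \<Longrightarrow> commutator G a b \<in> carrier G"
  by (simp add: commutator_def)

lemma commutator_eq_one_iff:
  assumes "a \<in> carrier G" "b \<in> carrier G"
  shows "commutator G a b = \<one> \<longleftrightarrow> a \<otimes> b = b \<otimes> a"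
proof -
  have "commutator G a b = inv (b \<otimes> a) \<otimes> (a \<otimes> b)"
    using assms by (simp add: commutator_def word_simps)
  then show ?thesis
    using assms by (metis inv_equality inv_inv inv_closed l_inv m_closed)
qed

lemma commutator_in_swap:
  assumes "subgroup N G" "a \<in> carrier G" "b \<in> carrier G" "commutator G a b \<in> N"
  shows "commutator G b a \<in> N"
proof -
  have "commutator G b a = inv (commutator G a b)"
    using assms by (simp add: commutator_def word_simps)
  then show ?thesis using assms subgroup.m_inv_closed by metis
qed

lemma normal_commutator_in:
  assumes "N \<lhd> G" "a \<in> N" "b \<in> carrier G"
  shows "commutator G a b \<in> N" "commutator G b a \<in> N"
proof -
  interpret normal N G by fact
  have "inv a \<otimes> (inv b \<otimes> a \<otimes> b) \<in> N"
    using assms inv_op_closed1 by simp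
  then show "commutator G a b \<in> N"
    using assms by (simp add: commutator_def m_assoc)
  then show "commutator G b a \<in> N"
    using commutator_in_swap subgroup_axioms assms by auto
qed

lemma r_coset_eq_iff:
  assumes "subgroup N G" "a \<in> carrier G" "b \<in> carrier G"
  shows "N #> a = N #> b \<longleftrightarrow> a \<otimes> inv b \<in> N"
proof -
  have N: "N \<subseteq> carrier G" using assms(1) subgroup.subset by blast
  show ?thesis
  proof
    assume "N #> a = N #> b"
    then have "N #> (a \<otimes> inv b) = N"
      using coset_mult_inv1[OF _ assms(3,2) N] N assms
      by (metis coset_mult_assoc coset_mult_one inv_closed r_inv)
    then show "a \<otimes> inv b \<in> N" using coset_join1 assms by simp
  next
    assume *: "a \<otimes> inv b \<in> N"
    then have "N #> (a \<otimes> inv b) #> b = N #> b"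
      using coset_join2 assms by simp
    then show "N #> a = N #> b"
      using assms N by (simp add: coset_mult_assoc m_assoc)
  qed
qed

lemma r_coset_eq_self_iff:
  assumes "subgroup N G" "a \<in> carrier G"
  shows "N #> a = N \<longleftrightarrow> a \<in> N"
  using assms coset_join1 coset_join2 by metis

lemma lower_central_subset: "lower_central G n \<subseteq> carrier G"
proof (induction n)
  case (Suc n)
  then have "{commutator G a b |a b. a \<in> lower_central G n \<and> b \<in> carrier G} \<subseteq> carrier G"
    by auto
  then show ?case using generate_incl by simp
qed simp

lemma lower_central_normal: "lower_central G n \<lhd> G"
proof (induction n)
  case 0
  then show ?case using normal_self by simp
next
  case (Suc n)
  have sub: "{commutator G a b |a b. a \<in> lower_central G n \<and> b \<in> carrier G} \<subseteq> carrier G"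
    using lower_central_subset by fastforce
  show ?case unfolding lower_central.simps
  proof (rule normal_generateI[OF sub])
    fix h g assume h: "h \<in> {commutator G a b |a b. a \<in> lower_central G n \<and> b \<in> carrier G}"
      and g: "g \<in> carrier G"
    then obtain a b where ab: "h = commutator G a b" "a \<in> lower_central G n" "b \<in> carrier G"
      by blast
    have a: "a \<in> carrier G" using ab(2) lower_central_subset by blast
    have "g \<otimes> h \<otimes> inv g = commutator G (g \<otimes> a \<otimes> inv g) (g \<otimes> b \<otimes> inv g)"
      using a ab g by (simp add: commutator_def word_simps)
    moreover have "g \<otimes> a \<otimes> inv g \<in> lower_central G n"
      using normal.inv_op_closed2[OF Suc g ab(2)] .
    ultimately show
      "g \<otimes> h \<otimes> inv g \<in> {commutator G a b |a b. a \<in> lower_central G n \<and> b \<in> carrier G}"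
      using g ab(3) by blast
  qed
qed

lemma lower_central_subgroup: "subgroup (lower_central G n) G"
  using lower_central_normal normal_imp_subgroup by blast

lemma lower_central_antimono:
  assumes "m \<le> n"
  shows "lower_central G n \<subseteq> lower_central G m"
  using assms
proof (induction rule: dec_induct)
  case (step n)
  have "lower_central G (Suc n) \<subseteq> lower_central G n"
    unfolding lower_central.simps
    by (rule generate_subgroup_incl[OF _ lower_central_subgroup])
      (auto intro: normal_commutator_in[OF lower_central_normal])
  then show ?case using step by blast
qed simp

text \<open>With \<open>u = [a, c]\<close> and \<open>v = [a, x]\<close>, conjugation by \<open>x c\<close> and by \<open>c x\<close> both send \<open>a\<close> to
  \<open>a u v\<close>.\<close>

lemma commutator_commutator_commute:
  assumes carr: "a \<in> carrier G" "c \<in> carrier G" "x \<in> carrier G"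
    and ux: "commutator G a c \<otimes> x = x \<otimes> commutator G a c"
    and uv: "commutator G a c \<otimes> commutator G a x = commutator G a x \<otimes> commutator G a c"
    and vc: "commutator G a x \<otimes> c = c \<otimes> commutator G a x"
  shows "a \<otimes> (c \<otimes> x \<otimes> inv c \<otimes> inv x) = (c \<otimes> x \<otimes> inv c \<otimes> inv x) \<otimes> a"
proof -
  define u v where "u = commutator G a c" and "v = commutator G a x"
  have [simp]: "u \<in> carrier G" "v \<in> carrier G" using carr by (simp_all add: u_def v_def)
  have ac: "a \<otimes> c = c \<otimes> (a \<otimes> u)" and ax: "a \<otimes> x = x \<otimes> (a \<otimes> v)"
    using carr by (simp_all add: u_def v_def commutator_def word_simps)
  have "a \<otimes> (x \<otimes> c) = (a \<otimes> x) \<otimes> c" using carr by (simp add: m_assoc)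
  also have "\<dots> = x \<otimes> (a \<otimes> (v \<otimes> c))" using carr by (simp add: ax m_assoc)
  also have "\<dots> = x \<otimes> ((a \<otimes> c) \<otimes> v)" using carr vc by (simp add: v_def m_assoc)
  also have "\<dots> = (x \<otimes> c) \<otimes> (a \<otimes> (u \<otimes> v))" using carr by (simp add: ac m_assoc)
  finally have 1: "a \<otimes> (x \<otimes> c) = (x \<otimes> c) \<otimes> (a \<otimes> (u \<otimes> v))" .
  have "a \<otimes> (c \<otimes> x) = (a \<otimes> c) \<otimes> x" using carr by (simp add: m_assoc)
  also have "\<dots> = c \<otimes> (a \<otimes> (u \<otimes> x))" using carr by (simp add: ac m_assoc)
  also have "\<dots> = c \<otimes> ((a \<otimes> x) \<otimes> u)" using carr ux by (simp add: u_def m_assoc)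
  also have "\<dots> = (c \<otimes> x) \<otimes> (a \<otimes> (v \<otimes> u))" using carr by (simp add: ax m_assoc)
  also have "v \<otimes> u = u \<otimes> v" using uv by (simp add: u_def v_def)
  finally have 2: "a \<otimes> (c \<otimes> x) = (c \<otimes> x) \<otimes> (a \<otimes> (u \<otimes> v))" .
  have "(c \<otimes> x \<otimes> inv c \<otimes> inv x) \<otimes> a = (c \<otimes> x) \<otimes> inv (x \<otimes> c) \<otimes> (a \<otimes> (x \<otimes> c)) \<otimes> inv (x \<otimes> c)"
    using carr by (simp add: word_simps)
  also have "\<dots> = (c \<otimes> x) \<otimes> (a \<otimes> (u \<otimes> v)) \<otimes> inv (x \<otimes> c)"
    unfolding 1 using carr by (simp add: word_simps)
  also have "\<dots> = a \<otimes> (c \<otimes> x \<otimes> inv c \<otimes> inv x)"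
    unfolding 2[symmetric] using carr by (simp add: word_simps)
  finally show ?thesis ..
qed

end

lemma (in group_hom) hom_commutator:
  "a \<in> carrier G \<Longrightarrow> b \<in> carrier G \<Longrightarrow> h (commutator G a b) = commutator H (h a) (h b)"
  by (simp add: commutator_def)

lemma (in normal) group_hom_r_coset: "group_hom G (G Mod H) (\<lambda>a. H #> a)"
  by (simp add: group_hom_def group_hom_axioms_def is_group factorgroup_is_group r_coset_hom_Mod)

text \<open>Moves commutator conditions into the quotient, where commuting elements can be reordered
  freely.\<close>

lemma (in group) commutator_in_normal_iff:
  assumes "N \<lhd> G" "a \<in> carrier G" "b \<in> carrier G"
  shows "commutator G a b \<in> N \<longleftrightarrow>
    (N #> a) \<otimes>\<^bsub>G Mod N\<^esub> (N #> b) = (N #> b) \<otimes>\<^bsub>G Mod N\<^esub> (N #> a)"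
proof -
  interpret q: group_hom G "G Mod N" "\<lambda>a. N #> a"
    using assms(1) by (rule normal.group_hom_r_coset)
  have "commutator G a b \<in> N \<longleftrightarrow> N #> commutator G a b = N"
    using r_coset_eq_self_iff[OF normal_imp_subgroup[OF assms(1)], of "commutator G a b"] assms(2,3)
    by simp
  also have "\<dots> \<longleftrightarrow> commutator (G Mod N) (N #> a) (N #> b) = \<one>\<^bsub>G Mod N\<^esub>"
    by (simp only: q.hom_commutator[OF assms(2,3)] one_FactGroup)
  finally show ?thesis
    using q.H.commutator_eq_one_iff[OF q.hom_closed q.hom_closed, OF assms(2,3)] by simp
qed

text \<open>Induction on \<open>j\<close> in the manner of the three subgroups lemma: modulo the
  target term, \<open>a\<close> commutes with [c, x] because the commutators that arise from [a, c]
  with x and from [a, x] with c already vanish there.\<close>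

lemma (in group) commutator_lower_central:
  assumes "a \<in> lower_central G i" "b \<in> lower_central G j"
  shows "commutator G a b \<in> lower_central G (i + j + 1)"
  using assms
proof (induction j arbitrary: i a b)
  case 0
  then show ?case by (auto intro!: generate.incl)
next
  case (Suc j)
  define N where "N = lower_central G (i + Suc j + 1)"
  have N: "N \<lhd> G" by (simp add: N_def lower_central_normal del: lower_central.simps)
  interpret q: group_hom G "G Mod N" "\<lambda>a. N #> a"
    using N by (rule normal.group_hom_r_coset)
  \<comment> \<open>The preimage of the centralizer of the image of
    \<open>lower_central G i\<close>. Being a subgroup, it contains
    \<open>lower_central G (Suc j)\<close> once it contains the generating commutators.\<close>
  define B where "B = {b \<in> carrier G. \<forall>a\<in>lower_central G i.
    (N #> a) \<otimes>\<^bsub>G Mod N\<^esub> (N #> b) = (N #> b) \<otimes>\<^bsub>G Mod N\<^esub> (N #> a)}"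
  have sub: "\<And>i a. a \<in> lower_central G i \<Longrightarrow> a \<in> carrier G" using lower_central_subset by blast
  have qc: "\<And>a. a \<in> carrier G \<Longrightarrow> N #> a \<in> carrier (G Mod N)" using q.hom_closed .
  have "subgroup B G"
  proof (rule subgroup.intro)
    show "B \<subseteq> carrier G" by (auto simp: B_def)
    show "\<one> \<in> B"
      using q.hom_one qc sub by (simp add: B_def del: one_FactGroup mult_FactGroup)
    show "x \<otimes> y \<in> B" if "x \<in> B" "y \<in> B" for x y
    proof -
      have "(N #> a) \<otimes>\<^bsub>G Mod N\<^esub> (N #> (x \<otimes> y)) = (N #> (x \<otimes> y)) \<otimes>\<^bsub>G Mod N\<^esub> (N #> a)"
        if a: "a \<in> lower_central G i" for a
      proof -
        have *: "x \<in> carrier G" "y \<in> carrier G" "a \<in> carrier G"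
          using \<open>x \<in> B\<close> \<open>y \<in> B\<close> a sub by (auto simp: B_def)
        have xa: "(N #> a) \<otimes>\<^bsub>G Mod N\<^esub> (N #> x) = (N #> x) \<otimes>\<^bsub>G Mod N\<^esub> (N #> a)"
          and ya: "(N #> a) \<otimes>\<^bsub>G Mod N\<^esub> (N #> y) = (N #> y) \<otimes>\<^bsub>G Mod N\<^esub> (N #> a)"
          using \<open>x \<in> B\<close> \<open>y \<in> B\<close> a by (auto simp: B_def)
        show ?thesis
          unfolding q.hom_mult[OF *(1,2)]
          by (metis xa ya * qc q.H.m_assoc)
      qed
      with that show ?thesis by (simp add: B_def)
    qed
    show "inv x \<in> B" if "x \<in> B" for x
    proof -
      have "(N #> a) \<otimes>\<^bsub>G Mod N\<^esub> (N #> inv x) = (N #> inv x) \<otimes>\<^bsub>G Mod N\<^esub> (N #> a)"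
        if a: "a \<in> lower_central G i" for a
      proof -
        have *: "x \<in> carrier G" "a \<in> carrier G"
          using \<open>x \<in> B\<close> a sub by (auto simp: B_def)
        have xa: "(N #> a) \<otimes>\<^bsub>G Mod N\<^esub> (N #> x) = (N #> x) \<otimes>\<^bsub>G Mod N\<^esub> (N #> a)"
          using \<open>x \<in> B\<close> a by (auto simp: B_def)
        show ?thesis
          unfolding q.hom_inv[OF *(1)]
          by (metis xa * qc q.H.inv_solve_left q.H.inv_solve_right q.H.m_assoc q.H.m_closed q.H.inv_closed)
      qed
      with that show ?thesis by (simp add: B_def)
    qed
  qed
  moreover have "{commutator G a b |a b. a \<in> lower_central G j \<and> b \<in> carrier G} \<subseteq> B"
  proof clarify
    fix c x assume c: "c \<in> lower_central G j" and x: "x \<in> carrier G"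
    \<comment> \<open>\<open>commutator_commutator_commute\<close> speaks of c x c^-1 x^-1, whereas
      \<open>commutator G c x\<close> is c^-1 x^-1 c x; hence it is applied to the inverses of
      \<open>c\<close> and \<open>x\<close>.\<close>
    have c': "inv c \<in> lower_central G j"
      using c lower_central_subgroup subgroup.m_inv_closed by metis
    have "(N #> a) \<otimes>\<^bsub>G Mod N\<^esub> (N #> commutator G c x)
        = (N #> commutator G c x) \<otimes>\<^bsub>G Mod N\<^esub> (N #> a)"
      if a: "a \<in> lower_central G i" for a
    proof -
      note carr = sub[OF a] sub[OF c'] sub[OF c] x
      \<comment> \<open>Index count: [a, c^-1] has index i + j + 1 by induction, so one more
        commutator reaches \<open>N\<close>. And [a, x^-1] has index i + 1, from which induction
        gives (i + 1) + j + 1, again that of \<open>N\<close>.\<close>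
      have u: "commutator G a (inv c) \<in> lower_central G (i + j + 1)"
        using Suc.IH[OF a c'] .
      have un: "commutator G (commutator G a (inv c)) y \<in> N" if "y \<in> carrier G" for y
        using u that by (auto simp: N_def intro!: generate.incl)
      have v: "commutator G a (inv x) \<in> lower_central G (Suc i)"
        using a x by (auto intro!: generate.incl)
      have vn: "commutator G (commutator G a (inv x)) (inv c) \<in> N"
        using Suc.IH[OF v c'] by (simp add: N_def del: lower_central.simps)
      have 1: "(N #> a) \<otimes>\<^bsub>G Mod N\<^esub> ((N #> inv c) \<otimes>\<^bsub>G Mod N\<^esub> (N #> inv x) \<otimes>\<^bsub>G Mod N\<^esub>
            inv\<^bsub>G Mod N\<^esub> (N #> inv c) \<otimes>\<^bsub>G Mod N\<^esub> inv\<^bsub>G Mod N\<^esub> (N #> inv x))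
          = ((N #> inv c) \<otimes>\<^bsub>G Mod N\<^esub> (N #> inv x) \<otimes>\<^bsub>G Mod N\<^esub>
            inv\<^bsub>G Mod N\<^esub> (N #> inv c) \<otimes>\<^bsub>G Mod N\<^esub> inv\<^bsub>G Mod N\<^esub> (N #> inv x)) \<otimes>\<^bsub>G Mod N\<^esub> (N #> a)"
        using carr un[of "inv x"] un[of "commutator G a (inv x)"] vn
        by (intro q.H.commutator_commutator_commute qc)
          (simp_all add: commutator_in_normal_iff[OF N] q.hom_commutator[symmetric] del: mult_FactGroup q.hom_inv)
      have 2: "N #> commutator G c x = (N #> inv c) \<otimes>\<^bsub>G Mod N\<^esub> (N #> inv x) \<otimes>\<^bsub>G Mod N\<^esub>
            inv\<^bsub>G Mod N\<^esub> (N #> inv c) \<otimes>\<^bsub>G Mod N\<^esub> inv\<^bsub>G Mod N\<^esub> (N #> inv x)"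
        using carr by (simp add: commutator_def q.hom_inv[symmetric] q.hom_mult[symmetric] del: mult_FactGroup q.hom_inv q.hom_mult inv_mult_group)
      show ?thesis using 1 unfolding 2 .
    qed
    then show "commutator G c x \<in> B" using sub c x by (simp add: B_def)
  qed
  ultimately have "lower_central G (Suc j) \<subseteq> B"
    by (simp add: generate_subgroup_incl)
  then have "b \<in> B" using Suc.prems by blast
  then show ?case
    using Suc.prems sub commutator_in_normal_iff[OF N] unfolding B_def N_def[symmetric] by blast
qed

section \<open>Hall--Petresco words lie in the lower central series\<close>

text \<open>The vertices of a cube are encoded as sets of naturals. The commutator of the faces of \<open>a\<close>
  over \<open>A\<close> and of \<open>b\<close> over \<open>B\<close> is the face of \<open>[a, b]\<close> over \<open>A \<union> B\<close>, whence the indices of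
  the lower central series in \<open>faces\<close> (which start at 0).\<close>

definition cube_group :: "('a, 'b) monoid_scheme \<Rightarrow> (nat set \<Rightarrow> 'a) monoid" where
  "cube_group G = \<lparr>carrier = {f. \<forall>S. f S \<in> carrier G}, monoid.mult = (\<lambda>f g S. f S \<otimes>\<^bsub>G\<^esub> g S),
     one = (\<lambda>S. \<one>\<^bsub>G\<^esub>)\<rparr>"

definition face :: "('a, 'b) monoid_scheme \<Rightarrow> nat set \<Rightarrow> 'a \<Rightarrow> nat set \<Rightarrow> 'a" where
  "face G A a = (\<lambda>S. if A \<subseteq> S then a else \<one>\<^bsub>G\<^esub>)"

definition faces :: "('a, 'b) monoid_scheme \<Rightarrow> nat set set \<Rightarrow> (nat set \<Rightarrow> 'a) set" where
  "faces G R = {face G A a | A a. A \<in> R \<and> a \<in> lower_central G (card A - 1)}"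

lemma sorted_concat_replicate:
  "sorted ns \<Longrightarrow> sorted (concat (map (\<lambda>i. replicate (e i) i) ns))"
  by (induction ns) (auto simp: sorted_append)

lemma count_concat_replicate:
  "distinct ns \<Longrightarrow>
    count (mset (concat (map (\<lambda>i. replicate (e i) i) ns))) j = (if j \<in> set ns then e j else 0)"
  by (induction ns) auto

context group
begin

lemma cube_group: "group (cube_group G)"
proof (rule groupI)
  fix f assume "f \<in> carrier (cube_group G)"
  then show "\<exists>g\<in>carrier (cube_group G). g \<otimes>\<^bsub>cube_group G\<^esub> f = \<one>\<^bsub>cube_group G\<^esub>"
    by (intro bexI[of _ "\<lambda>S. inv (f S)"]) (auto simp: cube_group_def)
qed (auto simp: cube_group_def m_assoc)

lemma cube_inv:
  assumes "f \<in> carrier (cube_group G)"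
  shows "inv\<^bsub>cube_group G\<^esub> f = (\<lambda>S. inv (f S))"
  using assms by (intro group.inv_equality[OF cube_group]) (auto simp: cube_group_def)

lemma face_closed: "a \<in> carrier G \<Longrightarrow> face G A a \<in> carrier (cube_group G)"
  by (simp add: face_def cube_group_def)

lemma faces_subset: "faces G R \<subseteq> carrier (cube_group G)"
  unfolding faces_def using face_closed lower_central_subset by blast

lemma generate_faces_closed:
  "u \<in> generate (cube_group G) (faces G R) \<Longrightarrow> u S \<in> carrier G"
  using group.generate_incl[OF cube_group faces_subset] by (auto simp: cube_group_def)

text \<open>Evaluation at \<open>S\<close> is a homomorphism into the group that kills every face
  over a set not contained in \<open>S\<close>. It makes the factors not yet treated disappear at a
  vertex.\<close>

lemma generate_faces_eq_one:
  assumes "u \<in> generate (cube_group G) (faces G R)" "\<And>B. B \<in> R \<Longrightarrow> \<not> B \<subseteq> S"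
  shows "u S = \<one>"
proof -
  interpret C: group "cube_group G" by (rule cube_group)
  have "subgroup {u \<in> carrier (cube_group G). u S = \<one>} (cube_group G)"
  proof (rule C.subgroupI)
    have "\<one>\<^bsub>cube_group G\<^esub> S = \<one>" by (simp add: cube_group_def)
    then show "{u \<in> carrier (cube_group G). u S = \<one>} \<noteq> {}"
      using C.one_closed by blast
    show "inv\<^bsub>cube_group G\<^esub> a \<in> {u \<in> carrier (cube_group G). u S = \<one>}"
      if "a \<in> {u \<in> carrier (cube_group G). u S = \<one>}" for a
      using that C.inv_closed[of a] by (simp add: cube_inv)
  qed (auto simp: cube_group_def)
  moreover have "faces G R \<subseteq> {u \<in> carrier (cube_group G). u S = \<one>}"
  proof
    fix w assume w: "w \<in> faces G R"
    then have "w S = \<one>" using assms(2) by (auto simp: faces_def face_def)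
    then show "w \<in> {u \<in> carrier (cube_group G). u S = \<one>}" using w faces_subset[of R] by auto
  qed
  ultimately show ?thesis
    using C.generate_subgroup_incl assms(1) by blast
qed

lemma face_conjugate:
  assumes "a \<in> carrier G" "c \<in> carrier G"
  shows "inv\<^bsub>cube_group G\<^esub> (face G A a) \<otimes>\<^bsub>cube_group G\<^esub> face G B c \<otimes>\<^bsub>cube_group G\<^esub> face G A a =
    face G B c \<otimes>\<^bsub>cube_group G\<^esub> face G (A \<union> B) (commutator G c a)"
  using assms unfolding cube_inv[OF face_closed[OF assms(1)]]
  by (auto simp: cube_group_def face_def commutator_def fun_eq_iff word_simps)

text \<open>A collection step: conjugation by a face over \<open>A\<close> changes a face over
  \<open>B\<close> only by a face over \<open>A \<union> B\<close>, and \<open>R\<close> contains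
  that union. So faces over \<open>A\<close> normalize the subgroup generated by the others and can
  be moved to the front.\<close>

lemma generate_faces_insert:
  assumes A: "finite A" "A \<noteq> {}"
    and R: "\<And>B. B \<in> R \<Longrightarrow> finite B \<and> B \<noteq> {} \<and> A \<union> B \<in> R"
    and u: "u \<in> generate (cube_group G) (faces G (insert A R))"
  shows "\<exists>a\<in>lower_central G (card A - 1). \<exists>v\<in>generate (cube_group G) (faces G R).
    u = face G A a \<otimes>\<^bsub>cube_group G\<^esub> v"
proof -
  let ?C = "cube_group G" and ?L = "lower_central G (card A - 1)"
  let ?U = "generate ?C (faces G R)"
  interpret C: group ?C by (rule cube_group)
  have L: "subgroup ?L G" by (rule lower_central_subgroup)
  have Lc: "a \<in> carrier G" if "a \<in> ?L" for a using that lower_central_subset by blast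
  have U: "subgroup ?U ?C" by (rule C.generate_is_subgroup[OF faces_subset])
  have Uc: "v \<in> carrier ?C" if "v \<in> ?U" for v using subgroup.mem_carrier[OF U that] .
  have fc: "face G A a \<in> carrier ?C" if "a \<in> ?L" for a using that Lc face_closed by blast
  have conj: "inv\<^bsub>?C\<^esub> (face G A a) \<otimes>\<^bsub>?C\<^esub> v \<otimes>\<^bsub>?C\<^esub> face G A a \<in> ?U"
    if a: "a \<in> ?L" and v: "v \<in> ?U" for a v
  proof -
    let ?F = "face G A a"
    have F: "?F \<in> carrier ?C" using fc a .
    \<comment> \<open>Conjugation is multiplicative, so the elements conjugated into
      \<open>?U\<close> form a subgroup and only faces need to be checked.\<close>
    let ?V = "{v \<in> carrier ?C. inv\<^bsub>?C\<^esub> ?F \<otimes>\<^bsub>?C\<^esub> v \<otimes>\<^bsub>?C\<^esub> ?F \<in> ?U}"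
    have "subgroup ?V ?C"
    proof (rule C.subgroupI)
      show "?V \<noteq> {}"
        using F subgroup.one_closed[OF U] by (auto intro!: exI[of _ "\<one>\<^bsub>?C\<^esub>"])
      show "inv\<^bsub>?C\<^esub> x \<in> ?V" if x: "x \<in> ?V" for x
      proof -
        have "inv\<^bsub>?C\<^esub> ?F \<otimes>\<^bsub>?C\<^esub> inv\<^bsub>?C\<^esub> x \<otimes>\<^bsub>?C\<^esub> ?F = inv\<^bsub>?C\<^esub> (inv\<^bsub>?C\<^esub> ?F \<otimes>\<^bsub>?C\<^esub> x \<otimes>\<^bsub>?C\<^esub> ?F)"
          using x F by (simp add: C.word_simps)
        then show ?thesis using x subgroup.m_inv_closed[OF U] by simp
      qed
      show "x \<otimes>\<^bsub>?C\<^esub> y \<in> ?V" if x: "x \<in> ?V" "y \<in> ?V" for x y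
      proof -
        have "inv\<^bsub>?C\<^esub> ?F \<otimes>\<^bsub>?C\<^esub> (x \<otimes>\<^bsub>?C\<^esub> y) \<otimes>\<^bsub>?C\<^esub> ?F =
            (inv\<^bsub>?C\<^esub> ?F \<otimes>\<^bsub>?C\<^esub> x \<otimes>\<^bsub>?C\<^esub> ?F) \<otimes>\<^bsub>?C\<^esub> (inv\<^bsub>?C\<^esub> ?F \<otimes>\<^bsub>?C\<^esub> y \<otimes>\<^bsub>?C\<^esub> ?F)"
          using x F by (simp add: C.word_simps)
        then show ?thesis using x subgroup.m_closed[OF U] by simp
      qed
    qed blast
    moreover have "faces G R \<subseteq> ?V"
    proof
      fix w assume w: "w \<in> faces G R"
      then obtain B c where Bc: "w = face G B c" "B \<in> R" "c \<in> lower_central G (card B - 1)"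
        by (auto simp: faces_def)
      have fB: "finite B" "B \<noteq> {}" "A \<union> B \<in> R" using R Bc(2) by auto
      have cG: "c \<in> carrier G" using Bc(3) lower_central_subset by blast
      have "card B > 0" "card A > 0" using fB A by (simp_all add: card_gt_0_iff)
      \<comment> \<open>A commutator has index the sum of the two indices plus 1, here card A + card
        B - 1. An overlap of \<open>A\<close> and \<open>B\<close> only lowers the index that is
        wanted.\<close>
      then have "card (A \<union> B) - 1 \<le> (card B - 1) + (card A - 1) + 1"
        using card_Un_le[of A B] by linarith
      then have "commutator G c a \<in> lower_central G (card (A \<union> B) - 1)"
        using commutator_lower_central[OF Bc(3) a] lower_central_antimono by blast
      then have "face G (A \<union> B) (commutator G c a) \<in> faces G R"
        using fB(3) by (auto simp: faces_def)
      then have "w \<otimes>\<^bsub>?C\<^esub> face G (A \<union> B) (commutator G c a) \<in> ?U"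
        using w generate.incl subgroup.m_closed[OF U] by metis
      then show "w \<in> ?V"
        using face_conjugate[OF Lc[OF a] cG, of A B] w faces_subset Bc(1) by auto
    qed
    ultimately show ?thesis using C.generate_subgroup_incl v by blast
  qed
  have mult: "face G A (a \<otimes> b) = face G A a \<otimes>\<^bsub>?C\<^esub> face G A b" for a b
    by (simp add: face_def cube_group_def fun_eq_iff)
  let ?W = "{face G A a \<otimes>\<^bsub>?C\<^esub> v | a v. a \<in> ?L \<and> v \<in> ?U}"
  have "subgroup ?W ?C"
  proof (rule C.subgroupI)
    show "?W \<subseteq> carrier ?C" using fc Uc by auto
    show "?W \<noteq> {}" using subgroup.one_closed[OF L] subgroup.one_closed[OF U] by blast
  next
    fix w w' assume "w \<in> ?W" "w' \<in> ?W"
    then obtain a v b v' where w: "w = face G A a \<otimes>\<^bsub>?C\<^esub> v" "a \<in> ?L" "v \<in> ?U"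
        "w' = face G A b \<otimes>\<^bsub>?C\<^esub> v'" "b \<in> ?L" "v' \<in> ?U" by blast
    have "w \<otimes>\<^bsub>?C\<^esub> w' = face G A (a \<otimes> b) \<otimes>\<^bsub>?C\<^esub>
        (inv\<^bsub>?C\<^esub> (face G A b) \<otimes>\<^bsub>?C\<^esub> v \<otimes>\<^bsub>?C\<^esub> face G A b \<otimes>\<^bsub>?C\<^esub> v')"
      using w fc Uc by (simp add: mult C.word_simps)
    moreover have "inv\<^bsub>?C\<^esub> (face G A b) \<otimes>\<^bsub>?C\<^esub> v \<otimes>\<^bsub>?C\<^esub> face G A b \<otimes>\<^bsub>?C\<^esub> v' \<in> ?U"
      using conj w subgroup.m_closed[OF U] by blast
    moreover have "a \<otimes> b \<in> ?L" using w subgroup.m_closed[OF L] by blast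
    ultimately show "w \<otimes>\<^bsub>?C\<^esub> w' \<in> ?W" by blast
  next
    fix w assume "w \<in> ?W"
    then obtain a v where w: "w = face G A a \<otimes>\<^bsub>?C\<^esub> v" "a \<in> ?L" "v \<in> ?U" by blast
    have i: "inv a \<in> ?L" using w subgroup.m_inv_closed[OF L] by blast
    have "face G A (inv a) = inv\<^bsub>?C\<^esub> (face G A a)"
      using w fc Lc by (auto simp: cube_inv face_def fun_eq_iff)
    then have "inv\<^bsub>?C\<^esub> w = face G A (inv a) \<otimes>\<^bsub>?C\<^esub>
        (inv\<^bsub>?C\<^esub> (face G A (inv a)) \<otimes>\<^bsub>?C\<^esub> inv\<^bsub>?C\<^esub> v \<otimes>\<^bsub>?C\<^esub> face G A (inv a))"
      using w fc Uc by (simp add: C.word_simps)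
    moreover have "inv\<^bsub>?C\<^esub> v \<in> ?U" using w subgroup.m_inv_closed[OF U] by blast
    ultimately show "inv\<^bsub>?C\<^esub> w \<in> ?W" using conj[OF i] i by blast
  qed
  moreover have "faces G (insert A R) \<subseteq> ?W"
  proof
    fix w assume "w \<in> faces G (insert A R)"
    then consider a where "w = face G A a" "a \<in> ?L" | "w \<in> faces G R"
      by (auto simp: faces_def)
    then show "w \<in> ?W"
    proof cases
      case 1
      then have "w = face G A a \<otimes>\<^bsub>?C\<^esub> \<one>\<^bsub>?C\<^esub>" using fc by simp
      then show ?thesis using 1 subgroup.one_closed[OF U] by blast
    next
      case 2
      then have "w \<in> carrier ?C" using faces_subset by blast
      then have "w = face G A \<one> \<otimes>\<^bsub>?C\<^esub> w"
        by (simp add: cube_group_def face_def fun_eq_iff)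
      moreover have "w \<in> ?U" using 2 by (rule generate.incl)
      ultimately show ?thesis using subgroup.one_closed[OF L] by blast
    qed
  qed
  ultimately show ?thesis using C.generate_subgroup_incl u by blast
qed

section \<open>Ordered products over the vertices of a cube\<close>

lemma list_prod_Cons [simp]: "list_prod G (x # xs) = x \<otimes> list_prod G xs"
  by (simp add: list_prod_def)

lemma list_prod_Nil [simp]: "list_prod G [] = \<one>"
  by (simp add: list_prod_def)

lemma list_prod_replicate: "x \<in> carrier G \<Longrightarrow> list_prod G (replicate n x) = x [^] n"
  proof (induction n)
  case (Suc n)
  then show ?case using nat_pow_Suc2[of x n] by simp
qed simp

lemma list_prod_concat_replicate:
  "range t \<subseteq> carrier G \<Longrightarrow>
    list_prod G (map t (concat (map (\<lambda>i. replicate (e i) i) ns))) =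
    list_prod G (map (\<lambda>i. t i [^] (e i :: nat)) ns)"
proof (induction ns)
  case (Cons n ns)
  have set: "set (map t xs) \<subseteq> carrier G" for xs using Cons.prems by auto
  have "t n \<in> carrier G" using Cons.prems by auto
  then show ?case
    using Cons list_prod_append[OF set set, of "replicate (e n) n"] by (simp add: list_prod_replicate)
qed simp

lemma list_prod_filter:
  "t ` f ` set xs \<subseteq> carrier G \<Longrightarrow>
    list_prod G (map (\<lambda>x. if P x then t (f x) else \<one>) xs) = list_prod G (map t (map f (filter P xs)))"
proof (induction xs)
  case (Cons x xs)
  then have "list_prod G (map t (map f (filter P xs))) \<in> carrier G"
    by (intro list_prod_closed) auto
  then show ?case using Cons by auto
qed simp

text \<open>There are \<open>card A choose i\<close> subsets of size \<open>i\<close>, and listing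
  by size puts equal factors side by side. Formally, two sorted index lists with equal
  multiplicities coincide. The set \<open>A\<close> itself stays out, since its factor is the one to
  be identified later.\<close>

lemma list_prod_proper_subsets:
  assumes t: "range t \<subseteq> carrier G" and A: "finite A"
    and xs: "distinct xs" "sorted (map card xs)" "{B \<in> set xs. B \<subseteq> A} = {B. B \<noteq> {} \<and> B \<subset> A}"
  shows "list_prod G (map (\<lambda>B. if B \<subseteq> A then t (card B) else \<one>) xs) =
    list_prod G (map (\<lambda>i. t i [^] (card A choose i)) [1..<card A])"
proof -
  let ?ys = "map card (filter (\<lambda>B. B \<subseteq> A) xs)"
  let ?zs = "concat (map (\<lambda>i. replicate (card A choose i) i) [1..<card A])"
  have "count (mset ?ys) j = count (mset ?zs) j" for j
  proof -
    have "count (mset ?ys) j = length (filter (\<lambda>B. B \<subseteq> A \<and> card B = j) xs)"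
      by (induction xs) auto
    also have "\<dots> = card {B \<in> set xs. B \<subseteq> A \<and> card B = j}"
      using distinct_length_filter[OF xs(1)] by (simp add: Int_def conj_commute conj_left_commute)
    also have "{B \<in> set xs. B \<subseteq> A \<and> card B = j} = {B. B \<noteq> {} \<and> B \<subset> A \<and> card B = j}"
      using xs(3) by blast
    also have "card \<dots> = (if j \<in> set [1..<card A] then card A choose j else 0)"
    proof (cases "j \<in> set [1..<card A]")
      case True
      then have "{B. B \<noteq> {} \<and> B \<subset> A \<and> card B = j} = {B. B \<subseteq> A \<and> card B = j}" by auto
      then show ?thesis using n_subsets[OF A] True by simp
    next
      case False
      have eq: "{B. B \<noteq> {} \<and> B \<subset> A \<and> card B = j} = {}"
        using False A psubset_card_mono[OF A] finite_subset[of _ A]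
        by (auto simp: card_gt_0_iff Suc_le_eq)
      show ?thesis unfolding eq using False by (simp only: if_False card.empty)
    qed
    also have "\<dots> = count (mset ?zs) j"
      by (subst count_concat_replicate) auto
    finally show ?thesis .
  qed
  then have "mset ?ys = mset ?zs" by (rule multiset_eqI)
  moreover have "sorted ?ys"
    using sorted_filter[of card xs] xs(2) by simp
  moreover have "sorted ?zs" by (rule sorted_concat_replicate) simp
  ultimately have "?ys = ?zs"
    by (metis properties_for_sort)
  moreover have "t ` card ` set xs \<subseteq> carrier G" using t by auto
  ultimately show ?thesis
    using list_prod_filter[of t card xs "\<lambda>B. B \<subseteq> A"]
      list_prod_concat_replicate[OF t, of "\<lambda>i. card A choose i" "[1..<card A]"]
    by (simp only:)
qed

text \<open>When \<open>k\<close> grows by one, g^|S \<inter> {..<k}| gains a face over the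
  singleton {k}; such faces carry index 0, so every \<open>g\<close> is admissible. Vertices are
  arbitrary sets of naturals, hence the intersection with \<open>{..<m}\<close>.\<close>

lemma power_cube_in_generate_faces:
  assumes gs: "set gs \<subseteq> carrier G"
  shows "(\<lambda>S. list_prod G (map (\<lambda>g. g [^] card (S \<inter> {..<m})) gs))
    \<in> generate (cube_group G) (faces G (Pow {..<m} - {{}}))"
proof -
  let ?C = "cube_group G" and ?U = "generate (cube_group G) (faces G (Pow {..<m} - {{}}))"
  interpret C: group ?C by (rule cube_group)
  have U: "subgroup ?U ?C" by (rule C.generate_is_subgroup[OF faces_subset])
  have pow: "(\<lambda>S. g [^] card (S \<inter> {..<k})) \<in> ?U" if g: "g \<in> carrier G" and k: "k \<le> m" for g k
    using k
  proof (induction k)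
    case 0
    then show ?case using subgroup.one_closed[OF U] by (simp add: cube_group_def)
  next
    case (Suc k)
    have "face G {k} g \<in> faces G (Pow {..<m} - {{}})"
      using Suc.prems g unfolding faces_def by (auto intro!: exI[of _ "{k}"] exI[of _ g])
    then have "(\<lambda>S. g [^] card (S \<inter> {..<k})) \<otimes>\<^bsub>?C\<^esub> face G {k} g \<in> ?U"
      using Suc generate.incl subgroup.m_closed[OF U] by (metis Suc_leD)
    moreover have "(\<lambda>S. g [^] card (S \<inter> {..<k})) \<otimes>\<^bsub>?C\<^esub> face G {k} g =
        (\<lambda>S. g [^] card (S \<inter> {..<Suc k}))"
      using g by (auto simp: cube_group_def face_def fun_eq_iff lessThan_Suc Int_insert_right)
    ultimately show ?case by simp
  qed
  show ?thesis using gs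
  proof (induction gs)
    case Nil
    then show ?case using subgroup.one_closed[OF U] by (simp add: cube_group_def)
  next
    case (Cons g gs)
    then show ?case
      using subgroup.m_closed[OF U pow[of g m]] by (simp add: cube_group_def)
  qed
qed

text \<open>The family \<open>S \<mapsto> \<Prod>g. g\<^bsup>|S|\<^esup>\<close> is a product of faces over singletons, hence an ordered
  product of faces over all nonempty \<open>A\<close>, with entries in the corresponding terms of the lower
  central series. Evaluating at the sets \<open>A\<close> in turn identifies these entries with the
  Hall--Petresco words.\<close>

theorem hall_petresco_in_lower_central:
  assumes gs: "set gs \<subseteq> carrier G" and m: "m \<ge> 1"
  shows "eval_word G gs (hall_petresco (length gs) m) \<in> lower_central G (m - 1)"
proof -
  let ?C = "cube_group G"
  interpret C: group ?C by (rule cube_group)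
  define t where "t = (\<lambda>i. eval_word G gs (hall_petresco (length gs) i))"
  have t: "t i \<in> carrier G" for i
    using eval_word_closed[OF valid_hall_petresco[OF gs]] by (simp add: t_def)
  define f where "f = (\<lambda>S. list_prod G (map (\<lambda>g. g [^] card (S \<inter> {..<m})) gs))"
  obtain As0 where "set As0 = Pow {..<m} - {{}}" "distinct As0"
    using finite_distinct_list[of "Pow {..<m} - {{}}"] by auto
  then obtain As where As: "set As = Pow {..<m} - {{}}" "distinct As" "sorted (map card As)"
    using sorted_sort_key[of card As0] by (metis distinct_sort set_sort)
  \<comment> \<open>A strictly larger set stands strictly later. So the nonempty proper subsets of a
    vertex precede it and its proper supersets follow it.\<close>
  have order: "i < j" if "i < length As" "j < length As" "card (As ! i) < card (As ! j)" for i j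
    using As(3) that by (metis leD length_map nth_map sorted_nth_mono not_le_imp_less)
  \<comment> \<open>One vertex is peeled off at a time: the first \<open>n\<close> sets contribute
    faces whose entry depends on the size only, and \<open>u\<close> is made of the remaining faces.
    The second conjunct is the desired claim for the sizes met so far.\<close>
  have "(\<exists>u\<in>generate ?C (faces G (set (drop n As))).
      f = (\<lambda>S. list_prod G (map (\<lambda>B. if B \<subseteq> S then t (card B) else \<one>) (take n As)) \<otimes> u S))
    \<and> (\<forall>k<n. t (card (As ! k)) \<in> lower_central G (card (As ! k) - 1))"
    if "n \<le> length As" for n
    using that
  proof (induction n)
    case 0
    have "f = (\<lambda>S. \<one> \<otimes> f S)"
      using gs by (auto simp: f_def fun_eq_iff intro!: l_one[symmetric] list_prod_closed nat_pow_closed)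
    then show ?case
      using power_cube_in_generate_faces[OF gs, of m] As(1)
      by (auto simp flip: f_def)
  next
    case (Suc n)
    let ?A = "As ! n" and ?R = "set (drop (Suc n) As)"
    let ?P = "\<lambda>S. list_prod G (map (\<lambda>B. if B \<subseteq> S then t (card B) else \<one>) (take n As))"
    have Pc: "?P S \<in> carrier G" for S using t by (intro list_prod_closed) auto
    have n: "n < length As" using Suc.prems by simp
    then have A: "?A \<in> set As" by simp
    then have A': "finite ?A" "?A \<noteq> {}" "?A \<subseteq> {..<m}"
      using As(1) finite_subset[of ?A "{..<m}"] by auto
    have drop: "set (drop n As) = insert ?A ?R" using n by (simp flip: Cons_nth_drop_Suc)
    have R: "\<exists>j. B = As ! j \<and> n < j \<and> j < length As" if B: "B \<in> ?R" for B
    proof -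
      obtain j where j: "j < length (drop (Suc n) As)" "drop (Suc n) As ! j = B"
        using B unfolding in_set_conv_nth by blast
      then have "B = As ! (Suc n + j)" "n < Suc n + j" "Suc n + j < length As"
        using Suc.prems by (simp_all add: nth_drop)
      then show ?thesis by blast
    qed
    have R': "B \<in> ?R" if "B = As ! j" "n < j" "j < length As" for B j
    proof -
      have "drop (Suc n) As ! (j - Suc n) = B" "j - Suc n < length (drop (Suc n) As)"
        using that by simp_all
      then show ?thesis using nth_mem by blast
    qed
    have not_sub: "\<not> B \<subseteq> ?A" if B: "B \<in> ?R" for B
    proof
      assume BA: "B \<subseteq> ?A"
      obtain j where j: "B = As ! j" "n < j" "j < length As" using R[OF B] by blast
      then have "B \<noteq> ?A" using As(2) n nth_eq_iff_index_eq by fastforce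
      then have "card B < card ?A" using BA A'(1) psubset_card_mono by blast
      then show False using order[of j n] j n by auto
    qed
    have un: "finite B \<and> B \<noteq> {} \<and> ?A \<union> B \<in> ?R" if B: "B \<in> ?R" for B
    proof -
      obtain j where j: "B = As ! j" "n < j" "j < length As" using R[OF B] by blast
      then have B': "B \<noteq> {}" "B \<subseteq> {..<m}" using As(1) nth_mem[OF j(3)] by auto
      then have fB: "finite B" using finite_subset by blast
      have "?A \<union> B \<in> set As" using B' A' As(1) by auto
      then obtain k where k: "k < length As" "?A \<union> B = As ! k" by (metis in_set_conv_nth)
      have "?A \<subset> ?A \<union> B" using not_sub[OF B] by blast
      then have "card ?A < card (?A \<union> B)" using psubset_card_mono[of "?A \<union> B"] A'(1) fB by simp
      then have "n < k" using order[OF n k(1)] k(2) by simp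
      then show ?thesis using R' k B' fB by blast
    qed
    obtain u where u: "u \<in> generate ?C (faces G (insert ?A ?R))" and f: "f = (\<lambda>S. ?P S \<otimes> u S)"
      using Suc.IH[OF Suc_leD[OF Suc.prems]] unfolding drop by blast
    obtain a v where a: "a \<in> lower_central G (card ?A - 1)"
      and v: "v \<in> generate ?C (faces G ?R)" and uv: "u = face G ?A a \<otimes>\<^bsub>?C\<^esub> v"
      using generate_faces_insert[OF A'(1,2) un u] by blast
    have ac: "a \<in> carrier G" using a lower_central_subset by blast
    have vA: "v ?A = \<one>" using generate_faces_eq_one[OF v] not_sub by blast
    have proper: "{B \<in> set (take n As). B \<subseteq> ?A} = {B. B \<noteq> {} \<and> B \<subset> ?A}"
    proof (intro equalityI subsetI)
      fix B assume "B \<in> {B \<in> set (take n As). B \<subseteq> ?A}"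
      then have "B \<in> set (take n As)" and sub: "B \<subseteq> ?A" by simp_all
      then obtain i where "i < length (take n As)" "take n As ! i = B"
        unfolding in_set_conv_nth by blast
      then obtain j where j: "j < n" "B = As ! j" using n by auto
      then have "B \<noteq> ?A" using As(2) n nth_eq_iff_index_eq by fastforce
      moreover have "B \<in> set As" using j n by simp
      ultimately show "B \<in> {B. B \<noteq> {} \<and> B \<subset> ?A}" using sub As(1) by blast
    next
      fix B assume B: "B \<in> {B. B \<noteq> {} \<and> B \<subset> ?A}"
      then have "B \<in> set As" using A'(3) As(1) by auto
      then obtain j where j: "j < length As" "B = As ! j" by (metis in_set_conv_nth)
      have "card B < card ?A" using B A'(1) psubset_card_mono by blast
      then have "j < n" using order[OF j(1) n] j by simp
      then have "take n As ! j = B" "j < length (take n As)" using j by simp_all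
      then have "B \<in> set (take n As)" using nth_mem by blast
      then show "B \<in> {B \<in> set (take n As). B \<subseteq> ?A}" using B by blast
    qed
    have sorted: "sorted (map card (take n As))"
      using As(3) by (metis sorted_wrt_take take_map)
    have P: "?P ?A = list_prod G (map (\<lambda>i. t i [^] (card ?A choose i)) [1..<card ?A])"
      using list_prod_proper_subsets[OF _ A'(1) _ sorted proper, of t] t As(2) by auto
    have "card ?A \<ge> 1" using A' by (simp add: Suc_le_eq card_gt_0_iff)
    \<comment> \<open>At the vertex \<open>?A\<close> the exponent is \<open>card ?A\<close>. The
      defining relation of the words then expresses the value by the factors already known and one
      more, which must equal the entry \<open>a\<close>.\<close>
    then have "f ?A = list_prod G (map (\<lambda>i. t i [^] (card ?A choose i)) [1..<Suc (card ?A)])"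
      using hall_petresco_identity[OF gs, of "card ?A"] A'(3)
      by (simp add: f_def t_def Int_absorb2)
    also have "\<dots> = ?P ?A \<otimes> t (card ?A)"
      using \<open>card ?A \<ge> 1\<close> t unfolding P
      by (simp add: list_prod_append image_subset_iff del: map_map)
    finally have "?P ?A \<otimes> t (card ?A) = ?P ?A \<otimes> a"
      using ac Pc vA by (simp add: f uv cube_group_def face_def)
    then have at: "t (card ?A) = a" using ac Pc t by simp
    have "f = (\<lambda>S. list_prod G (map (\<lambda>B. if B \<subseteq> S then t (card B) else \<one>) (take (Suc n) As)) \<otimes> v S)"
    proof
      fix S
      have "f S = ?P S \<otimes> ((if ?A \<subseteq> S then a else \<one>) \<otimes> v S)"
        by (simp add: f uv cube_group_def face_def)
      also have "\<dots> = (?P S \<otimes> (if ?A \<subseteq> S then t (card ?A) else \<one>)) \<otimes> v S"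
        using Pc ac generate_faces_closed[OF v] by (simp add: at m_assoc)
      also have "?P S \<otimes> (if ?A \<subseteq> S then t (card ?A) else \<one>) =
          list_prod G (map (\<lambda>B. if B \<subseteq> S then t (card B) else \<one>) (take (Suc n) As))"
        using n t by (subst take_Suc_conv_app_nth) (auto simp: list_prod_append image_subset_iff)
      finally show "f S = list_prod G (map (\<lambda>B. if B \<subseteq> S then t (card B) else \<one>) (take (Suc n) As)) \<otimes> v S" .
    qed
    moreover have "\<forall>k<Suc n. t (card (As ! k)) \<in> lower_central G (card (As ! k) - 1)"
      using Suc n a at by (auto simp: less_Suc_eq)
    ultimately show ?case using v by blast
  qed
  then have all: "\<forall>k<length As. t (card (As ! k)) \<in> lower_central G (card (As ! k) - 1)"
    by blast
  have "{..<m} \<in> set As" using As(1) m by (auto simp: lessThan_empty_iff)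
  then obtain k where "k < length As" "As ! k = {..<m}" by (metis in_set_conv_nth)
  then show ?thesis using all by (metis card_lessThan t_def)
qed

end

section \<open>Powers and quotients\<close>

lemma (in group_hom) hom_list_prod:
  "set xs \<subseteq> carrier G \<Longrightarrow> h (list_prod G xs) = list_prod H (map h xs)"
  by (induction xs) auto

lemma (in group_hom) hom_eval_word:
  assumes "group.valid_word G gs w"
  shows "h (eval_word G gs w) = eval_word H (map h gs) w"
proof -
  have "h (if b then gs ! i else inv\<^bsub>G\<^esub> (gs ! i)) =
      (if b then map h gs ! i else inv\<^bsub>H\<^esub> (map h gs ! i))" if "(i, b) \<in> set w" for i b
  proof -
    have "i < length gs" using assms that by (force simp: G.valid_word_def)
    moreover from this have "gs ! i \<in> carrier G" using assms by (auto simp: G.valid_word_def)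
    ultimately show ?thesis by simp
  qed
  then have "map h (map (\<lambda>(i, b). if b then gs ! i else inv\<^bsub>G\<^esub> (gs ! i)) w) =
      map (\<lambda>(i, b). if b then map h gs ! i else inv\<^bsub>H\<^esub> (map h gs ! i)) w"
    by auto
  then show ?thesis
    unfolding eval_word_def hom_list_prod[OF G.eval_letters[OF assms]] by (simp only:)
qed

lemma (in group_hom) lower_central_img:
  assumes "h ` carrier G = carrier H"
  shows "lower_central H n = h ` lower_central G n"
proof (induction n)
  case (Suc n)
  have "{commutator H a b |a b. a \<in> lower_central H n \<and> b \<in> carrier H} =
      h ` {commutator G a b |a b. a \<in> lower_central G n \<and> b \<in> carrier G}" (is "?L = ?R")
  proof (intro equalityI subsetI)
    fix x assume "x \<in> ?L"
    then obtain a b where *: "x = commutator H (h a) (h b)" "a \<in> lower_central G n" "b \<in> carrier G"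
      unfolding Suc assms[symmetric] by blast
    then have "a \<in> carrier G" using G.lower_central_subset by blast
    then have "x = h (commutator G a b)" using * by (simp add: hom_commutator)
    then show "x \<in> ?R" using * by blast
  next
    fix x assume "x \<in> ?R"
    then obtain a b where *: "x = h (commutator G a b)" "a \<in> lower_central G n" "b \<in> carrier G"
      by blast
    then have "a \<in> carrier G" using G.lower_central_subset by blast
    then have "x = commutator H (h a) (h b)" using * by (simp add: hom_commutator)
    then show "x \<in> ?L" unfolding Suc using * hom_closed by blast
  qed
  moreover have "{commutator G a b |a b. a \<in> lower_central G n \<and> b \<in> carrier G} \<subseteq> carrier G"
    using G.lower_central_subset G.commutator_closed by blast
  ultimately show ?case using generate_img by simp
qed (simp add: assms)

section \<open>Lower central series of subgroups and vanishing of Hall-Petresco words\<close>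

context group
begin

lemma lower_central_eq_one_mono:
  assumes "lower_central G c = {\<one>}" "c \<le> d"
  shows "lower_central G d = {\<one>}"
  using lower_central_antimono[OF assms(2)] assms(1) lower_central_subgroup[of d] subgroup.one_closed
  by blast

lemma lower_central_subgroup_subset:
  assumes "subgroup K G"
  shows "lower_central (G\<lparr>carrier := K\<rparr>) n \<subseteq> lower_central G n"
proof (induction n)
  case 0
  then show ?case using subgroup.subset[OF assms] by simp
next
  case (Suc n)
  interpret K: group "G\<lparr>carrier := K\<rparr>" using subgroup_imp_group[OF assms] .
  have sub: "lower_central (G\<lparr>carrier := K\<rparr>) n \<subseteq> K" using K.lower_central_subset by simp
  have comm: "commutator (G\<lparr>carrier := K\<rparr>) a b = commutator G a b" if "a \<in> K" "b \<in> K" for a b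
    using that m_inv_consistent[OF assms] by (simp add: commutator_def)
  let ?X = "{commutator (G\<lparr>carrier := K\<rparr>) a b |a b. a \<in> lower_central (G\<lparr>carrier := K\<rparr>) n \<and> b \<in> K}"
  have "?X \<subseteq> K" using sub K.commutator_closed by (simp add: subset_iff) blast
  then have "lower_central (G\<lparr>carrier := K\<rparr>) (Suc n) = generate G ?X"
    using generate_consistent[OF _ assms] by simp
  also have "\<dots> \<subseteq> lower_central G (Suc n)"
    unfolding lower_central.simps
  proof (rule mono_generate, clarify)
    fix a b assume "a \<in> lower_central (G\<lparr>carrier := K\<rparr>) n" "b \<in> K"
    then show "\<exists>a' b'. commutator (G\<lparr>carrier := K\<rparr>) a b = commutator G a' b' \<and>
        a' \<in> lower_central G n \<and> b' \<in> carrier G"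
      using comm[of a b] Suc sub subgroup.subset[OF assms] by blast
  qed
  finally show ?case .
qed

lemma nilpotent_group_subgroup:
  assumes "nilpotent_group G" "subgroup K G"
  shows "nilpotent_group (G\<lparr>carrier := K\<rparr>)"
proof -
  interpret K: group "G\<lparr>carrier := K\<rparr>" using subgroup_imp_group[OF assms(2)] .
  obtain c where "lower_central G c = {\<one>}" using assms(1) by (auto simp: nilpotent_group_def)
  then have "lower_central (G\<lparr>carrier := K\<rparr>) c \<subseteq> {\<one>}"
    using lower_central_subgroup_subset[OF assms(2)] by blast
  moreover have "\<one> \<in> lower_central (G\<lparr>carrier := K\<rparr>) c"
    using subgroup.one_closed[OF K.lower_central_subgroup] by simp
  ultimately have "lower_central (G\<lparr>carrier := K\<rparr>) c = {\<one>}" by blast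
  then show ?thesis using K.group_axioms by (auto simp: nilpotent_group_def)
qed

lemma eval_word_subgroup:
  assumes "subgroup K G" "set gs \<subseteq> K" "valid_word gs w"
  shows "eval_word (G\<lparr>carrier := K\<rparr>) gs w = eval_word G gs w"
proof -
  interpret i: group_hom "G\<lparr>carrier := K\<rparr>" G id
    using canonical_inj_is_hom[OF assms(1)] .
  have "i.G.valid_word gs w" using assms by (simp add: i.G.valid_word_def valid_word_def)
  from i.hom_eval_word[OF this] show ?thesis by simp
qed

text \<open>Word \<open>i\<close> lies at index \<open>i - 1\<close>, so \<open>i\<close> above the
  class c means an index of at least c, where the series is trivial. The argument takes place in the
  generated subgroup, because axiom (3) is cut off at its class and not at that of
  \<open>G\<close>.\<close>

lemma hall_petresco_eq_one:
  assumes "nilpotent_group G" "set gs \<subseteq> carrier G"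
    and "nilpotency_class (G\<lparr>carrier := generate G (set gs)\<rparr>) < i"
  shows "eval_word G gs (hall_petresco (length gs) i) = \<one>"
proof -
  let ?K = "generate G (set gs)"
  have K: "subgroup ?K G" using assms(2) by (rule generate_is_subgroup)
  interpret K: group "G\<lparr>carrier := ?K\<rparr>" using subgroup_imp_group[OF K] .
  have gs: "set gs \<subseteq> ?K" using generate.incl by auto
  have one: "\<one>\<^bsub>G\<lparr>carrier := ?K\<rparr>\<^esub> = \<one>" by simp
  have "\<exists>c. lower_central (G\<lparr>carrier := ?K\<rparr>) c = {\<one>}"
    using nilpotent_group_subgroup[OF assms(1) K] unfolding nilpotent_group_def one by blast
  then have "lower_central (G\<lparr>carrier := ?K\<rparr>) (nilpotency_class (G\<lparr>carrier := ?K\<rparr>)) = {\<one>}"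
    unfolding nilpotency_class_def one by (rule LeastI_ex)
  then have "lower_central (G\<lparr>carrier := ?K\<rparr>) (i - 1) = {\<one>}"
    using K.lower_central_eq_one_mono[of _ "i - 1"] assms(3) by simp
  then have "eval_word (G\<lparr>carrier := ?K\<rparr>) gs (hall_petresco (length gs) i) = \<one>"
    using K.hall_petresco_in_lower_central[of gs i] gs assms(3) by simp
  then show ?thesis
    using eval_word_subgroup[OF K gs valid_hall_petresco[OF assms(2)]] by simp
qed

lemma list_prod_eq_one: "set xs \<subseteq> {\<one>} \<Longrightarrow> list_prod G xs = \<one>"
  by (induction xs) auto

lemma list_prod_truncate:
  assumes "c \<le> d" "\<And>i. f i \<in> carrier G" "\<And>i. c < i \<Longrightarrow> f i = \<one>"
  shows "list_prod G (map f [1..<Suc d]) = list_prod G (map f [1..<Suc c])"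
proof -
  have "list_prod G (map f [Suc c..<Suc d]) = \<one>"
    using assms(3) by (intro list_prod_eq_one) auto
  moreover have "[1..<Suc d] = [1..<Suc c] @ [Suc c..<Suc d]"
    using assms(1) upt_add_eq_append[of 1 "Suc c" "d - c"] by simp
  ultimately show ?thesis
    using assms(2) by (simp add: list_prod_append image_subset_iff del: upt_Suc)
qed

lemma list_prod_in_subgroup: "subgroup K G \<Longrightarrow> set xs \<subseteq> K \<Longrightarrow> list_prod G xs \<in> K"
  by (induction xs) (auto simp: subgroup.one_closed subgroup.m_closed)

lemma hall_petresco_pair:
  assumes "x \<in> carrier G" "y \<in> carrier G"
  shows "eval_word G [x, y] (hall_petresco 2 1) = x \<otimes> y"
proof -
  have "eval_word G [x, y] (hall_petresco (length [x, y]) 1) \<in> carrier G"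
    using assms by (intro eval_word_closed valid_hall_petresco) simp
  then show ?thesis
    using hall_petresco_identity[of "[x, y]" 1] assms by (simp add: numeral_2_eq_2)
qed

text \<open>For commuting elements x^i y^i = (x y)^i is already the first factor of the defining
  product; by induction nothing is left for the last word.\<close>

lemma hall_petresco_commuting_pair:
  assumes "x \<in> carrier G" "y \<in> carrier G" "x \<otimes> y = y \<otimes> x" "i \<ge> 2"
  shows "eval_word G [x, y] (hall_petresco 2 i) = \<one>"
  using assms(4)
proof (induction i rule: less_induct)
  case (less i)
  let ?t = "\<lambda>j. eval_word G [x, y] (hall_petresco 2 j)"
  have t: "?t j \<in> carrier G" for j
    using eval_word_closed[OF valid_hall_petresco, of "[x, y]"] assms(1,2)
    by (simp add: numeral_2_eq_2)
  have split: "[1..<Suc i] = 1 # [2..<i] @ [i]"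
    using less.prems by (simp add: upt_conv_Cons numeral_2_eq_2)
  have mid: "list_prod G (map (\<lambda>j. ?t j [^] (i choose j)) [2..<i]) = \<one>"
    using less.IH by (intro list_prod_eq_one) auto
  have "x [^] i \<otimes> y [^] i =
      list_prod G (map (\<lambda>j. ?t j [^] (i choose j)) [1..<Suc i])"
    using hall_petresco_identity[of "[x, y]" i] assms(1,2) less.prems by (simp add: numeral_2_eq_2)
  also have "\<dots> = (x \<otimes> y) [^] i \<otimes> ?t i"
    unfolding split using t assms(1,2) mid hall_petresco_pair[OF assms(1,2)]
    by (simp add: list_prod_append image_subset_iff)
  finally show ?case
    using pow_mult_distrib[OF assms(3,1,2), of i] t[of i] assms(1,2)
      l_cancel_one'[of "(x \<otimes> y) [^] i" "?t i"] by simp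
qed

end

lemma poly_choose_1 [simp]: "poly_choose \<alpha> 1 = \<alpha>" "poly_choose \<alpha> (Suc 0) = \<alpha>"
  by (simp_all add: poly_choose_def)

lemma powered_quotient_simps:
  "carrier (powered_quotient G N) = (\<lambda>a. N #>\<^bsub>G\<^esub> a) ` carrier G"
  "monoid.mult (powered_quotient G N) = monoid.mult (G Mod N)"
  "one (powered_quotient G N) = N"
  by (simp_all add: powered_quotient_def carrier_FactGroup)

lemma group_powered_quotient:
  assumes "N \<lhd> G"
  shows "group (powered_quotient G N)"
proof -
  interpret q: group "G Mod N" using assms by (rule normal.factorgroup_is_group)
  show ?thesis
    using q.l_inv_ex unfolding powered_quotient_def
    by (intro groupI) (auto simp: q.m_assoc q.m_closed[simplified] simp del: mult_FactGroup one_FactGroup)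
qed

lemma group_hom_powered_quotient:
  assumes "N \<lhd> G"
  shows "group_hom G (powered_quotient G N) (\<lambda>a. N #>\<^bsub>G\<^esub> a)"
proof -
  have "(\<lambda>a. N #>\<^bsub>G\<^esub> a) \<in> hom G (powered_quotient G N)"
    using normal.r_coset_hom_Mod[OF assms] by (simp add: hom_def powered_quotient_def)
  then show ?thesis
    using assms group_powered_quotient
    by (simp add: group_hom_def group_hom_axioms_def normal_def)
qed

section \<open>Power laws and products modulo a normal subgroup\<close>

context nilpotent_powered_group
begin

lemma qpow_zero: "g \<in> carrier G \<Longrightarrow> g \<up> 0 = \<one>"
  using qpow_add[of g 0 0] qpow_closed[of g 0] by simp

lemma one_qpow: "\<one> \<up> \<alpha> = \<one>"
  using qpow_mult[of \<one> 0 \<alpha>] qpow_zero by simp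

lemma qpow_uminus: "g \<in> carrier G \<Longrightarrow> g \<up> (- \<alpha>) = inv (g \<up> \<alpha>)"
  using qpow_add[of g "- \<alpha>" \<alpha>] qpow_zero qpow_closed by (intro inv_equality[symmetric]) simp_all

lemma qpow_minus_one: "g \<in> carrier G \<Longrightarrow> g \<up> (- 1) = inv g"
  using qpow_uminus[of g 1] qpow_one by simp

text \<open>Factors beyond the class are trivial. A cut-off that can be raised freely makes tuples
  in a group and in its quotient comparable although their generated subgroups may differ in
  class.\<close>

lemma hall_petresco_truncated:
  assumes gs: "set gs \<subseteq> carrier G"
    and d: "nilpotency_class (G\<lparr>carrier := generate G (set gs)\<rparr>) \<le> d"
  shows "list_prod G (map (\<lambda>g. g \<up> \<alpha>) gs) =
    list_prod G (map (\<lambda>i. eval_word G gs (hall_petresco (length gs) i) \<up> poly_choose \<alpha> i) [1..<Suc d])"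
proof -
  let ?c = "nilpotency_class (G\<lparr>carrier := generate G (set gs)\<rparr>)"
  let ?t = "\<lambda>i. eval_word G gs (hall_petresco (length gs) i) \<up> poly_choose \<alpha> i"
  have t: "?t i \<in> carrier G" for i
    using qpow_closed[OF eval_word_closed[OF valid_hall_petresco[OF gs]]] .
  have "?t i = \<one>" if "?c < i" for i
    using hall_petresco_eq_one[OF nilpotent gs that] one_qpow by simp
  then show ?thesis
    unfolding qpow_hall_petresco[OF gs] using list_prod_truncate[OF d, of ?t] t by metis
qed

text \<open>As \<open>a\<close> and \<open>c\<close> commute modulo \<open>N\<close>, all words from
  the second on fall into \<open>N\<close>, and axiom (3) for the pair reduces to its first factor.
  The words are evaluated in the plain quotient group, since powers of cosets are not yet known to
  be well defined.\<close>

lemma qpow_mult_cong: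
  assumes N: "normal_powered_subgroup N G" and ac: "a \<in> carrier G" "c \<in> carrier G"
    and comm: "commutator G a c \<in> N"
  shows "N #> (a \<otimes> c) \<up> \<alpha> = N #> (a \<up> \<alpha> \<otimes> c \<up> \<alpha>)"
proof -
  have nN: "N \<lhd> G" and pN: "\<And>h \<beta>. h \<in> N \<Longrightarrow> h \<up> \<beta> \<in> N"
    using N by (auto simp: normal_powered_subgroup_def powered_subgroup_def)
  have sN: "subgroup N G" using nN by (rule normal_imp_subgroup)
  interpret q: group_hom G "G Mod N" "\<lambda>a. N #> a" using nN by (rule normal.group_hom_r_coset)
  have gs: "set [a, c] \<subseteq> carrier G" using ac by simp
  let ?t = "\<lambda>i. eval_word G [a, c] (hall_petresco 2 i)"
  have t: "?t i \<in> carrier G" for i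
    using eval_word_closed[OF valid_hall_petresco[OF gs]] by (simp add: numeral_2_eq_2)
  have tN: "?t i \<in> N" if "i \<ge> 2" for i
  proof -
    have "N #> ?t i = eval_word (G Mod N) [N #> a, N #> c] (hall_petresco 2 i)"
      using q.hom_eval_word[OF valid_hall_petresco[OF gs]] by (simp add: numeral_2_eq_2)
    also have "\<dots> = N"
      using q.H.hall_petresco_commuting_pair[OF q.hom_closed[OF ac(1)] q.hom_closed[OF ac(2)] _ that]
        comm commutator_in_normal_iff[OF nN ac] by simp
    finally show ?thesis using r_coset_eq_self_iff[OF sN t] by blast
  qed
  \<comment> \<open>The successor ensures d \<ge> 1, so that the first word can be split off even
    when \<open>a\<close> and \<open>c\<close> are trivial and the class is 0.\<close>
  define d where "d = Suc (nilpotency_class (G\<lparr>carrier := generate G (set [a, c])\<rparr>))"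
  have split: "[1..<Suc d] = 1 # [2..<Suc d]"
    by (simp add: d_def upt_conv_Cons numeral_2_eq_2 del: upt_Suc)
  define r where "r = list_prod G (map (\<lambda>i. ?t i \<up> poly_choose \<alpha> i) [2..<Suc d])"
  have rN: "r \<in> N" unfolding r_def
    using tN pN by (intro list_prod_in_subgroup[OF sN]) auto
  have "a \<up> \<alpha> \<otimes> c \<up> \<alpha> = list_prod G (map (\<lambda>g. g \<up> \<alpha>) [a, c])"
    using ac qpow_closed by simp
  also have "\<dots> = list_prod G (map (\<lambda>i. ?t i \<up> poly_choose \<alpha> i) [1..<Suc d])"
    using hall_petresco_truncated[OF gs, of d \<alpha>] by (simp add: d_def numeral_2_eq_2 del: upt_Suc)
  also have "\<dots> = (a \<otimes> c) \<up> \<alpha> \<otimes> r"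
    unfolding split r_def using hall_petresco_pair[OF ac] by (simp del: upt_Suc)
  finally have eq: "a \<up> \<alpha> \<otimes> c \<up> \<alpha> = (a \<otimes> c) \<up> \<alpha> \<otimes> r" .
  have carr: "(a \<otimes> c) \<up> \<alpha> \<in> carrier G" "r \<in> carrier G"
    using ac qpow_closed rN subgroup.mem_carrier[OF sN] by auto
  have "(a \<otimes> c) \<up> \<alpha> \<otimes> r \<otimes> inv ((a \<otimes> c) \<up> \<alpha>) \<in> N"
    using normal.inv_op_closed2[OF nN carr(1) rN] .
  then show ?thesis
    unfolding eq using r_coset_eq_iff[OF sN, of "(a \<otimes> c) \<up> \<alpha> \<otimes> r" "(a \<otimes> c) \<up> \<alpha>"] carr by simp
qed

end

lemma powered_subgroupD:
  assumes "powered_subgroup H G"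
  shows "subgroup H G" "\<And>h \<alpha>. h \<in> H \<Longrightarrow> h \<up>\<^bsub>G\<^esub> \<alpha> \<in> H"
  using assms by (auto simp: powered_subgroup_def)

lemma normal_powered_subgroupD:
  assumes "normal_powered_subgroup N G"
  shows "powered_subgroup N G" "N \<lhd> G" "subgroup N G" "\<And>h \<alpha>. h \<in> N \<Longrightarrow> h \<up>\<^bsub>G\<^esub> \<alpha> \<in> N"
  using assms by (auto simp: normal_powered_subgroup_def powered_subgroup_def)

section \<open>Subgroups and quotients as powered groups\<close>

context nilpotent_powered_group
begin

lemma trivial_normal_powered_subgroup: "normal_powered_subgroup {\<one>} G"
  using one_is_normal one_qpow
  by (auto simp: normal_powered_subgroup_def powered_subgroup_def normal_imp_subgroup)

text \<open>Axiom (3) transfers because it involves only values of words and the class of the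
  generated subgroup, and both are the same when computed inside \<open>H\<close>.\<close>

lemma nilpotent_powered_group_powered_subgroup:
  assumes "powered_subgroup H G"
  shows "nilpotent_powered_group (G\<lparr>carrier := H\<rparr>)"
proof -
  note H = powered_subgroupD[OF assms]
  interpret H: group "G\<lparr>carrier := H\<rparr>" using subgroup_imp_group[OF H(1)] .
  have sub: "h \<in> carrier G" if "h \<in> H" for h using subgroup.mem_carrier[OF H(1) that] .
  have inv: "inv\<^bsub>G\<lparr>carrier := H\<rparr>\<^esub> h = inv h" if "h \<in> H" for h
    using m_inv_consistent[OF H(1) that] .
  have lp: "list_prod (G\<lparr>carrier := H\<rparr>) xs = list_prod G xs" for xs
    by (simp add: list_prod_def)
  show ?thesis
  proof (unfold_locales, goal_cases)
    case 1
    show ?case using nilpotent_group_subgroup[OF nilpotent H(1)] .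
  next
    case (7 gs \<alpha>)
    then have gs: "set gs \<subseteq> H" "set gs \<subseteq> carrier G" using sub by auto
    show ?case
      using qpow_hall_petresco[OF gs(2), of \<alpha>] generate_consistent[OF gs(1) H(1)]
        eval_word_subgroup[OF H(1) gs(1) valid_hall_petresco[OF gs(2)]]
      by (simp add: lp)
  qed (simp_all add: sub H(2) qpow_one qpow_add qpow_mult qpow_conj inv)
qed

context
  fixes N
  assumes N: "normal_powered_subgroup N G"
begin

text \<open>Write a = b c with c in \<open>N\<close>. Normality puts the commutator of b and c into
  \<open>N\<close>, so the power splits modulo \<open>N\<close> and the power of c is
  absorbed.\<close>

lemma qpow_coset_cong:
  assumes "a \<in> carrier G" "b \<in> carrier G" "N #> a = N #> b"
  shows "N #> a \<up> \<alpha> = N #> b \<up> \<alpha>"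
proof -
  note nN = normal_powered_subgroupD[OF N]
  let ?c = "inv b \<otimes> a"
  have "inv b \<otimes> (a \<otimes> inv b) \<otimes> b \<in> N"
    using normal.inv_op_closed1[OF nN(2)] assms r_coset_eq_iff[OF nN(3)] by blast
  then have c: "?c \<in> N" using assms by (simp add: m_assoc)
  have "N #> a \<up> \<alpha> = N #> (b \<otimes> ?c) \<up> \<alpha>" using assms by (simp add: inv_mult_cancel)
  also have "\<dots> = N #> (b \<up> \<alpha> \<otimes> ?c \<up> \<alpha>)"
    using qpow_mult_cong[OF N assms(2) _ normal_commutator_in(2)[OF nN(2) c assms(2)]] assms
    by simp
  also have "\<dots> = N #> b \<up> \<alpha>"
    using nN(4)[OF c] normal.inv_op_closed2[OF nN(2)] assms qpow_closed
    by (subst r_coset_eq_iff[OF nN(3)]) auto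
  finally show ?thesis .
qed

lemma qpow_powered_quotient:
  assumes "a \<in> carrier G"
  shows "(N #> a) \<up>\<^bsub>powered_quotient G N\<^esub> \<alpha> = N #> a \<up> \<alpha>"
proof -
  note sN = normal_powered_subgroupD(3)[OF N]
  have "N #> g \<up> \<alpha> = N #> a \<up> \<alpha>" if g: "g \<in> N #> a" for g
  proof -
    have "g \<in> carrier G" using g assms r_coset_subset_G subgroup.subset[OF sN] by blast
    then show ?thesis
      using qpow_coset_cong[OF _ assms repr_independence[OF g assms sN, symmetric]] by blast
  qed
  moreover have "a \<in> N #> a" using rcos_self[OF assms sN] .
  ultimately have "(\<Union>g\<in>N #> a. N #> g \<up> \<alpha>) = N #> a \<up> \<alpha>" by blast
  then show ?thesis by (simp add: powered_quotient_def)
qed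

text \<open>The nilpotency class may drop in the quotient; the superfluous factors vanish because the
  Hall--Petresco words lie in the lower central series.\<close>

lemma nilpotent_powered_group_powered_quotient:
  "nilpotent_powered_group (powered_quotient G N)"
proof -
  let ?K = "powered_quotient G N" and ?q = "\<lambda>a. N #> a"
  interpret q: group_hom G ?K ?q
    using group_hom_powered_quotient normal_powered_subgroupD(2)[OF N] .
  have K: "carrier ?K = ?q ` carrier G" by (simp add: powered_quotient_simps)
  note pow = qpow_powered_quotient
  obtain c where "lower_central G c = {\<one>}" using nilpotent by (auto simp: nilpotent_group_def)
  then have "lower_central ?K c = {\<one>\<^bsub>?K\<^esub>}"
    using q.lower_central_img[OF K[symmetric], of c] by simp
  then have nil: "nilpotent_group ?K"
    using q.H.group_axioms unfolding nilpotent_group_def by blast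
  have rep: "\<exists>a\<in>carrier G. x = ?q a" if "x \<in> carrier ?K" for x using that K by auto
  show ?thesis
  proof (unfold_locales, goal_cases)
    case 1
    show ?case using nil .
  next
    case (2 x \<alpha>)
    then show ?case using rep[OF 2] pow qpow_closed by (metis q.hom_closed)
  next
    case (3 x)
    then show ?case using rep[OF 3] pow qpow_one by metis
  next
    case (4 x \<alpha> \<beta>)
    obtain a where a: "a \<in> carrier G" "x = ?q a" using rep[OF 4] by blast
    then show ?case using pow qpow_closed qpow_add q.hom_mult by metis
  next
    case (5 x \<alpha> \<beta>)
    obtain a where a: "a \<in> carrier G" "x = ?q a" using rep[OF 5] by blast
    then show ?case using pow qpow_closed qpow_mult by metis
  next
    case (6 x y \<alpha>)
    obtain a where a: "a \<in> carrier G" "x = ?q a" using rep[OF 6(1)] by blast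
    obtain b where b: "b \<in> carrier G" "y = ?q b" using rep[OF 6(2)] by blast
    have eq: "inv\<^bsub>?K\<^esub> y \<otimes>\<^bsub>?K\<^esub> x \<otimes>\<^bsub>?K\<^esub> y = ?q (inv b \<otimes> a \<otimes> b)"
      using a b by (simp del: mult_FactGroup)
    have "(inv\<^bsub>?K\<^esub> y \<otimes>\<^bsub>?K\<^esub> x \<otimes>\<^bsub>?K\<^esub> y) \<up>\<^bsub>?K\<^esub> \<alpha> = ?q (inv b \<otimes> a \<up> \<alpha> \<otimes> b)"
      unfolding eq using a b qpow_conj[OF a(1) b(1), of \<alpha>] pow[of "inv b \<otimes> a \<otimes> b" \<alpha>] by simp
    also have "\<dots> = inv\<^bsub>?K\<^esub> y \<otimes>\<^bsub>?K\<^esub> x \<up>\<^bsub>?K\<^esub> \<alpha> \<otimes>\<^bsub>?K\<^esub> y"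
      using a b pow[OF a(1)] qpow_closed[OF a(1)] by simp
    finally show ?case .
  next
    case (7 xs \<alpha>)
    define gs where "gs = map (inv_into (carrier G) ?q) xs"
    have xs: "xs = map ?q gs"
      using 7 unfolding gs_def K map_map by (intro map_idI[symmetric]) (auto simp: f_inv_into_f)
    have gs: "set gs \<subseteq> carrier G"
      using 7 unfolding gs_def K by (auto intro!: inv_into_into)
    let ?t = "\<lambda>i. eval_word G gs (hall_petresco (length gs) i)"
    let ?s = "\<lambda>i. eval_word ?K xs (hall_petresco (length xs) i)"
    have t: "?t i \<in> carrier G" for i using eval_word_closed[OF valid_hall_petresco[OF gs]] .
    have s: "?s i = ?q (?t i)" for i
      using q.hom_eval_word[OF valid_hall_petresco[OF gs]] by (simp add: xs)
    let ?c = "nilpotency_class (?K\<lparr>carrier := generate ?K (set xs)\<rparr>)"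
    define d where "d = max ?c (nilpotency_class (G\<lparr>carrier := generate G (set gs)\<rparr>))"
    have one: "?s i \<up>\<^bsub>?K\<^esub> \<beta> = \<one>\<^bsub>?K\<^esub>" if "?c < i" for i \<beta>
      using q.H.hall_petresco_eq_one[OF nil 7 that] pow[of \<one> \<beta>] one_qpow q.hom_one by simp
    have "list_prod ?K (map (\<lambda>x. x \<up>\<^bsub>?K\<^esub> \<alpha>) xs) = list_prod ?K (map ?q (map (\<lambda>g. g \<up> \<alpha>) gs))"
      using gs pow by (intro arg_cong[where f = "list_prod ?K"]) (auto simp: xs)
    also have "\<dots> = ?q (list_prod G (map (\<lambda>g. g \<up> \<alpha>) gs))"
      using gs qpow_closed by (intro q.hom_list_prod[symmetric]) auto
    also have "\<dots> = ?q (list_prod G (map (\<lambda>i. ?t i \<up> poly_choose \<alpha> i) [1..<Suc d]))"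
      using hall_petresco_truncated[OF gs, of d \<alpha>] by (simp add: d_def del: upt_Suc)
    also have "\<dots> = list_prod ?K (map ?q (map (\<lambda>i. ?t i \<up> poly_choose \<alpha> i) [1..<Suc d]))"
      using t qpow_closed by (intro q.hom_list_prod) auto
    also have "\<dots> = list_prod ?K (map (\<lambda>i. ?s i \<up>\<^bsub>?K\<^esub> poly_choose \<alpha> i) [1..<Suc d])"
      using pow[OF t] s by (simp add: comp_def)
    also have "\<dots> = list_prod ?K (map (\<lambda>i. ?s i \<up>\<^bsub>?K\<^esub> poly_choose \<alpha> i) [1..<Suc ?c])"
    proof (rule q.H.list_prod_truncate)
      show "?s i \<up>\<^bsub>?K\<^esub> poly_choose \<alpha> i \<in> carrier ?K" for i
        unfolding s pow[OF t] using qpow_closed[OF t] by (rule q.hom_closed)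
    qed (use one in \<open>simp_all add: d_def\<close>)
    finally show ?case .
  qed
qed

end

end

section \<open>The upper central series\<close>

locale powered_group_hom = group_hom G H h
  for G :: "('a, 'c) powered_group_scheme" (structure)
    and H :: "('b, 'd) powered_group_scheme" (structure) and h +
  assumes hom_qpow: "g \<in> carrier G \<Longrightarrow> h (g \<up> \<alpha>) = h g \<up>\<^bsub>H\<^esub> \<alpha>"
    and G_qpow_closed: "g \<in> carrier G \<Longrightarrow> g \<up> \<alpha> \<in> carrier G"
begin

lemma powered_subgroup_vimage:
  assumes "powered_subgroup P H"
  shows "powered_subgroup {a \<in> carrier G. h a \<in> P} G"
proof -
  note P = powered_subgroupD[OF assms]
  have "subgroup {a \<in> carrier G. h a \<in> P} G"
  proof (rule G.subgroupI)
    show "{a \<in> carrier G. h a \<in> P} \<noteq> {}"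
      using subgroup.one_closed[OF P(1)] hom_one by force
  qed (simp_all add: subgroup.m_closed[OF P(1)] subgroup.m_inv_closed[OF P(1)] subset_iff)
  then show ?thesis
    by (simp add: powered_subgroup_def P(2) hom_qpow G_qpow_closed)
qed

lemma normal_powered_subgroup_vimage:
  assumes "normal_powered_subgroup P H"
  shows "normal_powered_subgroup {a \<in> carrier G. h a \<in> P} G"
proof -
  note P = normal_powered_subgroupD[OF assms]
  have V: "powered_subgroup {a \<in> carrier G. h a \<in> P} G"
    using powered_subgroup_vimage[OF P(1)] .
  moreover have "{a \<in> carrier G. h a \<in> P} \<lhd> G"
    using powered_subgroupD(1)[OF V] normal.inv_op_closed2[OF P(2)]
    by (intro G.normal_invI) simp_all
  ultimately show ?thesis by (simp add: normal_powered_subgroup_def)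
qed

lemma powered_subgroup_image:
  assumes "powered_subgroup P G"
  shows "powered_subgroup (h ` P) H"
proof -
  note P = powered_subgroupD[OF assms]
  have "h a \<up>\<^bsub>H\<^esub> \<alpha> \<in> h ` P" if "a \<in> P" for a \<alpha>
    using hom_qpow[OF subgroup.mem_carrier[OF P(1) that], of \<alpha>] P(2)[OF that] by (metis imageI)
  then show ?thesis
    using subgroup_img_is_subgroup[OF P(1)] by (auto simp: powered_subgroup_def)
qed

lemma normal_powered_subgroup_image:
  assumes "normal_powered_subgroup P G" "h ` carrier G = carrier H"
  shows "normal_powered_subgroup (h ` P) H"
proof -
  note P = normal_powered_subgroupD[OF assms(1)]
  have I: "powered_subgroup (h ` P) H" using powered_subgroup_image[OF P(1)] .
  moreover have "h ` P \<lhd> H"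
  proof (rule H.normal_invI[OF powered_subgroupD(1)[OF I]])
    fix x y assume "x \<in> carrier H" "y \<in> h ` P"
    then obtain a b where ab: "x = h a" "a \<in> carrier G" "y = h b" "b \<in> P"
      using assms(2) by blast
    have "x \<otimes>\<^bsub>H\<^esub> y \<otimes>\<^bsub>H\<^esub> inv\<^bsub>H\<^esub> x = h (a \<otimes> b \<otimes> inv a)"
      using ab subgroup.mem_carrier[OF P(3) ab(4)] by simp
    then show "x \<otimes>\<^bsub>H\<^esub> y \<otimes>\<^bsub>H\<^esub> inv\<^bsub>H\<^esub> x \<in> h ` P"
      using normal.inv_op_closed2[OF P(2) ab(2,4)] by blast
  qed
  ultimately show ?thesis by (simp add: normal_powered_subgroup_def)
qed

end

section \<open>The centre and commutators of powers\<close>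

context nilpotent_powered_group
begin

lemma powered_group_hom_quotient:
  assumes "normal_powered_subgroup N G"
  shows "powered_group_hom G (powered_quotient G N) (\<lambda>a. N #> a)"
  using group_hom_powered_quotient[OF normal_powered_subgroupD(2)[OF assms]]
    qpow_powered_quotient[OF assms] qpow_closed
  by (simp add: powered_group_hom_def powered_group_hom_axioms_def)

lemma commutator_in_iff_quotient:
  assumes "normal_powered_subgroup N G" "a \<in> carrier G" "b \<in> carrier G"
  shows "commutator G a b \<in> N \<longleftrightarrow> (N #> a) \<otimes>\<^bsub>powered_quotient G N\<^esub> (N #> b) =
    (N #> b) \<otimes>\<^bsub>powered_quotient G N\<^esub> (N #> a)"
  using commutator_in_normal_iff[OF normal_powered_subgroupD(2)[OF assms(1)] assms(2,3)]
  by (simp add: powered_quotient_simps)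

text \<open>Axiom (2): if conjugation by \<open>h\<close> fixes \<open>a\<close>, it fixes every
  power of \<open>a\<close>.\<close>

lemma qpow_commute:
  assumes "a \<in> carrier G" "h \<in> carrier G" "a \<otimes> h = h \<otimes> a"
  shows "a \<up> \<alpha> \<otimes> h = h \<otimes> a \<up> \<alpha>"
proof -
  have "inv h \<otimes> a \<otimes> h = a" using assms by (simp add: m_assoc inv_mult_cancel)
  then have "a \<up> \<alpha> = inv h \<otimes> a \<up> \<alpha> \<otimes> h" using qpow_conj[OF assms(1,2), of \<alpha>] by simp
  then have "h \<otimes> a \<up> \<alpha> = h \<otimes> (inv h \<otimes> a \<up> \<alpha> \<otimes> h)" by simp
  then show ?thesis using assms qpow_closed by (simp add: m_assoc inv_mult_cancel)
qed

lemma qpow_mult_commute: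
  assumes "a \<in> carrier G" "c \<in> carrier G" "a \<otimes> c = c \<otimes> a"
  shows "(a \<otimes> c) \<up> \<alpha> = a \<up> \<alpha> \<otimes> c \<up> \<alpha>"
proof -
  have "commutator G a c \<in> {\<one>}" using commutator_eq_one_iff assms by simp
  from qpow_mult_cong[OF trivial_normal_powered_subgroup assms(1,2) this, of \<alpha>]
  show ?thesis using assms qpow_closed by (simp add: r_coset_def)
qed

text \<open>Conjugating \<open>a\<close> by \<open>h\<close> gives a [a, h], a product of commuting
  factors, whose power splits. Comparison with axiom (2) isolates the power of [a, h].\<close>

lemma commutator_qpow:
  assumes "a \<in> carrier G" "h \<in> carrier G"
    and "a \<otimes> commutator G a h = commutator G a h \<otimes> a"
  shows "commutator G (a \<up> \<alpha>) h = commutator G a h \<up> \<alpha>"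
proof -
  have "inv h \<otimes> a \<otimes> h = a \<otimes> commutator G a h"
    using assms by (simp add: commutator_def word_simps)
  then have "inv h \<otimes> a \<up> \<alpha> \<otimes> h = a \<up> \<alpha> \<otimes> commutator G a h \<up> \<alpha>"
    using qpow_conj[OF assms(1,2), of \<alpha>] qpow_mult_commute[OF assms(1) _ assms(3), of \<alpha>] assms
    by simp
  moreover have "commutator G (a \<up> \<alpha>) h = inv (a \<up> \<alpha>) \<otimes> (inv h \<otimes> a \<up> \<alpha> \<otimes> h)"
    using assms qpow_closed by (simp add: commutator_def m_assoc)
  ultimately show ?thesis using assms qpow_closed by (simp add: inv_mult_cancel)
qed

lemma center_normal_powered_subgroup:
  "normal_powered_subgroup {a \<in> carrier G. \<forall>h\<in>carrier G. a \<otimes> h = h \<otimes> a} G"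
    (is "normal_powered_subgroup ?Z G")
proof -
  have Z: "subgroup ?Z G"
  proof (rule subgroupI)
    show "?Z \<noteq> {}" using one_closed by force
    show "inv a \<in> ?Z" if "a \<in> ?Z" for a
    proof -
      have "a \<up> (- 1) \<otimes> h = h \<otimes> a \<up> (- 1)" if "h \<in> carrier G" for h
        using qpow_commute[of a h "- 1"] that \<open>a \<in> ?Z\<close> by blast
      then show ?thesis using that by (simp add: qpow_minus_one)
    qed
    show "a \<otimes> b \<in> ?Z" if "a \<in> ?Z" "b \<in> ?Z" for a b
    proof -
      have "a \<otimes> b \<otimes> h = h \<otimes> (a \<otimes> b)" if h: "h \<in> carrier G" for h
      proof -
        have carr: "a \<in> carrier G" "b \<in> carrier G" and "a \<otimes> h = h \<otimes> a" "b \<otimes> h = h \<otimes> b"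
          using \<open>a \<in> ?Z\<close> \<open>b \<in> ?Z\<close> h by blast+
        then show ?thesis using h by (metis m_assoc)
      qed
      then show ?thesis using that m_closed by blast
    qed
  qed blast
  moreover have "?Z \<lhd> G"
  proof (rule normal_invI[OF Z])
    fix x h assume x: "x \<in> carrier G" and h: "h \<in> ?Z"
    then have hG: "h \<in> carrier G" and comm: "h \<otimes> x = x \<otimes> h" by blast+
    then have "x \<otimes> h \<otimes> inv x = h" using x unfolding comm[symmetric] by (simp add: m_assoc)
    then show "x \<otimes> h \<otimes> inv x \<in> ?Z" using h by metis
  qed
  moreover have "a \<up> \<alpha> \<in> ?Z" if "a \<in> ?Z" for a \<alpha>
    using qpow_commute that qpow_closed by blast
  ultimately show ?thesis by (simp add: normal_powered_subgroup_def powered_subgroup_def)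
qed

text \<open>Preimage of the centre of the quotient by \<open>N\<close>; this is what makes the terms
  of the upper central series closed under powers.\<close>

lemma commutator_in_normal_powered_subgroup:
  assumes N: "normal_powered_subgroup N G"
  shows "normal_powered_subgroup {a \<in> carrier G. \<forall>h\<in>carrier G. commutator G a h \<in> N} G"
proof -
  let ?K = "powered_quotient G N"
  interpret q: powered_group_hom G ?K "\<lambda>a. N #> a" using powered_group_hom_quotient[OF N] .
  have "{a \<in> carrier G. \<forall>h\<in>carrier G. commutator G a h \<in> N} =
      {a \<in> carrier G. N #> a \<in> {x \<in> carrier ?K. \<forall>y\<in>carrier ?K. x \<otimes>\<^bsub>?K\<^esub> y = y \<otimes>\<^bsub>?K\<^esub> x}}"
    using commutator_in_iff_quotient[OF N] q.hom_closed
    by (auto simp: powered_quotient_simps(1))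
  then show ?thesis
    using q.normal_powered_subgroup_vimage[OF nilpotent_powered_group.center_normal_powered_subgroup[
          OF nilpotent_powered_group_powered_quotient[OF N]]]
    by simp
qed

end

lemma central_powered_seriesD:
  assumes "central_powered_series G H r"
  shows "H 0 = {\<one>\<^bsub>G\<^esub>}" "H r = carrier G" "\<And>i. i \<le> r \<Longrightarrow> normal_powered_subgroup (H i) G"
    "\<And>i. i < r \<Longrightarrow> H i \<subseteq> H (Suc i)"
    "\<And>i a g. i < r \<Longrightarrow> a \<in> H (Suc i) \<Longrightarrow> g \<in> carrier G \<Longrightarrow> commutator G a g \<in> H i"
  using assms unfolding central_powered_series_def by blast+

primrec upper_central :: "('a, 'b) monoid_scheme \<Rightarrow> nat \<Rightarrow> 'a set" where
  "upper_central G 0 = {\<one>\<^bsub>G\<^esub>}"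
| "upper_central G (Suc n) =
     {a \<in> carrier G. \<forall>h\<in>carrier G. commutator G a h \<in> upper_central G n}"

context nilpotent_powered_group
begin

lemma upper_central_normal_powered_subgroup: "normal_powered_subgroup (upper_central G n) G"
  by (induction n)
    (simp_all add: trivial_normal_powered_subgroup commutator_in_normal_powered_subgroup)

lemma upper_central_1:
  "upper_central G (Suc 0) = {a \<in> carrier G. \<forall>h\<in>carrier G. a \<otimes> h = h \<otimes> a}"
  using commutator_eq_one_iff by auto

text \<open>Modulo \<open>upper_central G n\<close>, the commutator [a, h] of an \<open>a\<close>
  two terms further up is central, so [a^\<epsilon>, h] = [a, h]^\<epsilon>, which vanishes by
  induction. Thus an exponent of the centre is one for each upper central factor.\<close>

lemma upper_central_exponent:
  assumes E: "\<And>a. a \<in> upper_central G (Suc 0) \<Longrightarrow> a \<up> \<epsilon> = \<one>"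
  shows "a \<in> upper_central G (Suc n) \<Longrightarrow> a \<up> \<epsilon> \<in> upper_central G n"
proof (induction n arbitrary: a)
  case 0
  then show ?case using E by simp
next
  case (Suc n)
  define N where "N = upper_central G n"
  have N: "normal_powered_subgroup N G"
    by (simp add: N_def upper_central_normal_powered_subgroup)
  let ?K = "powered_quotient G N"
  interpret q: powered_group_hom G ?K "\<lambda>a. N #> a" using powered_group_hom_quotient[OF N] .
  interpret K: nilpotent_powered_group ?K using nilpotent_powered_group_powered_quotient[OF N] .
  have a: "a \<in> carrier G" using Suc.prems by simp
  have "commutator G (a \<up> \<epsilon>) h \<in> N" if h: "h \<in> carrier G" for h
  proof -
    let ?c = "commutator G a h"
    have c: "?c \<in> upper_central G (Suc n)" using Suc.prems h by simp
    have cG: "?c \<in> carrier G" using a h by simp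
    have "commutator G ?c a \<in> N" using c a by (simp add: N_def)
    then have "(N #> a) \<otimes>\<^bsub>?K\<^esub> (N #> ?c) = (N #> ?c) \<otimes>\<^bsub>?K\<^esub> (N #> a)"
      using commutator_in_iff_quotient[OF N cG a] by simp
    then have "commutator ?K ((N #> a) \<up>\<^bsub>?K\<^esub> \<epsilon>) (N #> h) = commutator ?K (N #> a) (N #> h) \<up>\<^bsub>?K\<^esub> \<epsilon>"
      using K.commutator_qpow[OF q.hom_closed[OF a] q.hom_closed[OF h]] q.hom_commutator[OF a h]
      by simp
    then have "N #> commutator G (a \<up> \<epsilon>) h = N #> ?c \<up> \<epsilon>"
      using q.hom_commutator[OF a h] q.hom_commutator[OF qpow_closed[OF a] h]
        q.hom_qpow[OF a] q.hom_qpow[OF cG]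
      by metis
    also have "\<dots> = N"
      using Suc.IH[OF c] r_coset_eq_self_iff[OF normal_powered_subgroupD(3)[OF N] qpow_closed[OF cG]]
      by (simp add: N_def)
    finally show ?thesis
      using r_coset_eq_self_iff[OF normal_powered_subgroupD(3)[OF N]
          commutator_closed[OF qpow_closed[OF a] h], of \<epsilon>] by blast
  qed
  then show ?case using a qpow_closed by (simp add: N_def)
qed

lemma central_series_upper_central:
  assumes "central_powered_series G H r" "i \<le> r"
  shows "H i \<subseteq> upper_central G i"
  using assms(2)
proof (induction i)
  case 0
  then show ?case using central_powered_seriesD(1)[OF assms(1)] by simp
next
  case (Suc i)
  have "H (Suc i) \<subseteq> carrier G"
    using subgroup.subset[OF normal_powered_subgroupD(3)] central_powered_seriesD(3)[OF assms(1)]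
      Suc.prems by blast
  moreover have "commutator G a g \<in> upper_central G i" if "a \<in> H (Suc i)" "g \<in> carrier G" for a g
    using central_powered_seriesD(5)[OF assms(1)] Suc that by auto
  ultimately show ?case by auto
qed

text \<open>Supplies the cyclic submodules of the centre as normal test subgroups; centrality gives
  normality.\<close>

lemma range_qpow_normal_powered_subgroup:
  assumes "a \<in> upper_central G (Suc 0)"
  shows "normal_powered_subgroup (range (\<lambda>\<beta>. a \<up> \<beta>)) G"
proof -
  have a: "a \<in> carrier G" using assms by simp
  have S: "subgroup (range (\<lambda>\<beta>. a \<up> \<beta>)) G"
  proof (rule subgroupI)
    show "range (\<lambda>\<beta>. a \<up> \<beta>) \<subseteq> carrier G" using qpow_closed[OF a] by blast
    show "inv x \<in> range (\<lambda>\<beta>. a \<up> \<beta>)" if "x \<in> range (\<lambda>\<beta>. a \<up> \<beta>)" for x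
      using that qpow_uminus[OF a, symmetric] by auto
    show "x \<otimes> y \<in> range (\<lambda>\<beta>. a \<up> \<beta>)" if "x \<in> range (\<lambda>\<beta>. a \<up> \<beta>)" "y \<in> range (\<lambda>\<beta>. a \<up> \<beta>)" for x y
      using that qpow_add[OF a] by auto
  qed blast
  moreover have "range (\<lambda>\<beta>. a \<up> \<beta>) \<lhd> G"
  proof (rule normal_invI[OF S])
    fix x h assume x: "x \<in> carrier G" and "h \<in> range (\<lambda>\<beta>. a \<up> \<beta>)"
    then obtain \<beta> where h: "h = a \<up> \<beta>" by blast
    have "a \<up> \<beta> \<otimes> x = x \<otimes> a \<up> \<beta>"
      using qpow_commute[OF a x] assms x unfolding upper_central_1 by blast
    then have "x \<otimes> h \<otimes> inv x = h"
      using m_assoc[of "a \<up> \<beta>" x "inv x"] x qpow_closed[OF a] by (simp add: h)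
    then show "x \<otimes> h \<otimes> inv x \<in> range (\<lambda>\<beta>. a \<up> \<beta>)" using h by blast
  qed
  moreover have "\<forall>h\<in>range (\<lambda>\<beta>. a \<up> \<beta>). \<forall>\<alpha>. h \<up> \<alpha> \<in> range (\<lambda>\<beta>. a \<up> \<beta>)"
    using qpow_mult[OF a] by auto
  ultimately show ?thesis by (simp add: normal_powered_subgroup_def powered_subgroup_def)
qed

end

section \<open>Polynomials with prescribed prime divisors\<close>

text \<open>Unlike \<open>prime_member\<close>, this includes the constant 1.\<close>

definition smooth :: "rat poly set \<Rightarrow> rat poly \<Rightarrow> bool" where
  "smooth \<sigma> \<alpha> \<longleftrightarrow> lead_coeff \<alpha> = 1 \<and> (\<forall>\<pi>\<in>monic_irreducibles. \<pi> dvd \<alpha> \<longrightarrow> \<pi> \<in> \<sigma>)"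

lemma monic_irreducibleD:
  assumes "\<pi> \<in> monic_irreducibles"
  shows "lead_coeff \<pi> = 1" "irreducible \<pi>" "prime_elem \<pi>" "\<not> is_unit \<pi>" "\<pi> \<noteq> 0" "degree \<pi> > 0"
proof -
  show *: "lead_coeff \<pi> = 1" "irreducible \<pi>" using assms by (auto simp: monic_irreducibles_def)
  then show "prime_elem \<pi>" "\<not> is_unit \<pi>" "\<pi> \<noteq> 0"
    using irreducible_imp_prime_elem by (auto simp: irreducible_def)
  then show "degree \<pi> > 0" using is_unit_iff_degree[of \<pi>] by auto
qed

lemma prime_member_iff: "prime_member \<sigma> \<alpha> \<longleftrightarrow> smooth \<sigma> \<alpha> \<and> degree \<alpha> > 0"
  by (auto simp: prime_member_def smooth_def)

lemma smooth_degree_0: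
  assumes "smooth \<sigma> \<alpha>" "degree \<alpha> = 0"
  shows "\<alpha> = 1"
proof -
  obtain c where "\<alpha> = [:c:]" using assms(2) by (rule degree_eq_zeroE)
  then show ?thesis using assms(1) by (simp add: smooth_def one_pCons)
qed

lemma smooth_1: "smooth \<sigma> 1"
  using monic_irreducibleD(4) by (auto simp: smooth_def)

lemma smooth_mult: "smooth \<sigma> \<alpha> \<Longrightarrow> smooth \<sigma> \<beta> \<Longrightarrow> smooth \<sigma> (\<alpha> * \<beta>)"
  using monic_irreducibleD(3) by (auto simp: smooth_def lead_coeff_mult prime_elem_dvd_mult_iff)

lemma smooth_power: "smooth \<sigma> \<alpha> \<Longrightarrow> smooth \<sigma> (\<alpha> ^ n)"
  by (induction n) (auto intro: smooth_1 smooth_mult)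

text \<open>Associated monic polynomials are equal, so a monic irreducible polynomial has no monic
  irreducible divisor but itself.\<close>

lemma smooth_prime:
  assumes "\<pi> \<in> monic_irreducibles" "\<pi> \<in> \<sigma>"
  shows "smooth \<sigma> \<pi>"
proof -
  have "\<rho> = \<pi>" if \<rho>: "\<rho> \<in> monic_irreducibles" "\<rho> dvd \<pi>" for \<rho>
  proof -
    obtain \<delta> where \<delta>: "\<pi> = \<rho> * \<delta>" using \<rho>(2) by blast
    have "is_unit \<delta>"
      using irreducibleD[OF monic_irreducibleD(2)[OF assms(1)] \<delta>] monic_irreducibleD(4)[OF \<rho>(1)]
      by blast
    then obtain c where c: "\<delta> = [:c:]" using is_unit_poly_iff by blast
    then have "c = 1"
      using arg_cong[OF \<delta>, of lead_coeff] monic_irreducibleD(1)[OF assms(1)] monic_irreducibleD(1)[OF \<rho>(1)]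
      by (simp add: lead_coeff_mult split: if_splits)
    then show ?thesis using \<delta> c by simp
  qed
  then show ?thesis using assms monic_irreducibleD(1) by (auto simp: smooth_def)
qed

lemma monic_irreducible_bezout:
  assumes "\<pi> \<in> monic_irreducibles" "\<not> \<pi> dvd \<alpha>"
  obtains u v where "\<alpha> * u + \<pi> * v = 1"
proof -
  have "coprime \<pi> \<alpha>" using prime_elem_imp_coprime[OF monic_irreducibleD(3)] assms by blast
  then have "gcd \<alpha> \<pi> = 1" by (simp add: coprime_iff_gcd_eq_1 gcd.commute)
  then have "\<alpha> * fst (bezout_coefficients \<alpha> \<pi>) + \<pi> * snd (bezout_coefficients \<alpha> \<pi>) = 1"
    using bezout_coefficients_fst_snd[of \<alpha> \<pi>] by (simp add: mult.commute)
  then show thesis using that by blast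
qed

lemma monic_irreducible_divisor_exists:
  assumes "\<gamma> \<noteq> 0" "\<not> is_unit (\<gamma> :: rat poly)"
  obtains \<pi> where "\<pi> \<in> monic_irreducibles" "\<pi> dvd \<gamma>"
proof -
  obtain \<rho> where \<rho>: "\<rho> dvd \<gamma>" "prime_elem \<rho>"
    using prime_divisor_exists[OF assms] by auto
  define \<pi> where "\<pi> = smult (inverse (lead_coeff \<rho>)) \<rho>"
  have nz: "lead_coeff \<rho> \<noteq> 0" using \<rho>(2) by auto
  have dvd: "\<pi> dvd \<rho>" "\<rho> dvd \<pi>" using nz by (simp_all add: \<pi>_def smult_dvd_iff dvd_smult_iff)
  have "irreducible \<rho>" using \<rho>(2) by (rule prime_elem_imp_irreducible)
  then have "irreducible \<pi>"
    using irreducible_mult_unit_left[of "[:inverse (lead_coeff \<rho>):]" \<rho>] nz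
    by (simp add: \<pi>_def is_unit_poly_iff dvd_field_iff)
  moreover have "lead_coeff \<pi> = 1" using nz by (simp add: \<pi>_def)
  ultimately show thesis
    using that[of \<pi>] dvd(1) \<rho>(1) dvd_trans by (auto simp: monic_irreducibles_def)
qed

section \<open>Monolithic quotients\<close>

context nilpotent_powered_group
begin

lemma powered_generate_powered_subgroup:
  assumes "S \<subseteq> carrier G"
  shows "powered_subgroup (powered_generate G S) G"
proof -
  have "powered_subgroup (carrier G) G"
    using subgroup_self qpow_closed by (simp add: powered_subgroup_def)
  then have ne: "carrier G \<in> {H. powered_subgroup H G \<and> S \<subseteq> H}" using assms by simp
  have "subgroup (powered_generate G S) G"
    unfolding powered_generate_def
    by (rule subgroups_Inter) (use ne powered_subgroupD(1) in auto)
  then show ?thesis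
    by (auto simp: powered_subgroup_def powered_generate_def)
qed

lemma powered_generate_incl: "S \<subseteq> powered_generate G S"
  by (auto simp: powered_generate_def)

text \<open>Modulo \<open>N\<close> the group \<open>L\<close> is abelian, so raising to the power
  \<epsilon> is a homomorphism there and this set is its kernel. It serves to pass an exponent from
  generators to all that they generate.\<close>

lemma qpow_vimage_powered_subgroup:
  assumes L: "powered_subgroup L G" and N: "normal_powered_subgroup N G"
    and comm: "\<And>a b. a \<in> L \<Longrightarrow> b \<in> L \<Longrightarrow> commutator G a b \<in> N"
  shows "powered_subgroup {x \<in> L. x \<up> \<epsilon> \<in> N} G"
proof -
  note L' = powered_subgroupD[OF L] and N' = normal_powered_subgroupD[OF N]
  have Lc: "x \<in> carrier G" if "x \<in> L" for x using subgroup.mem_carrier[OF L'(1) that] .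
  have "subgroup {x \<in> L. x \<up> \<epsilon> \<in> N} G"
  proof (rule subgroupI)
    show "{x \<in> L. x \<up> \<epsilon> \<in> N} \<noteq> {}"
      using subgroup.one_closed[OF L'(1)] subgroup.one_closed[OF N'(3)] one_qpow by force
    show "inv x \<in> {x \<in> L. x \<up> \<epsilon> \<in> N}" if "x \<in> {x \<in> L. x \<up> \<epsilon> \<in> N}" for x
    proof -
      have x: "x \<in> carrier G" "x \<in> L" "x \<up> \<epsilon> \<in> N" using that Lc by auto
      have "inv x \<up> \<epsilon> = (x \<up> \<epsilon>) \<up> (- 1)"
        using x qpow_mult[OF x(1), of "- 1" \<epsilon>] qpow_mult[OF x(1), of \<epsilon> "- 1"] qpow_minus_one by simp
      then show ?thesis using x N'(4) subgroup.m_inv_closed[OF L'(1)] by simp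
    qed
    show "x \<otimes> y \<in> {x \<in> L. x \<up> \<epsilon> \<in> N}" if "x \<in> {x \<in> L. x \<up> \<epsilon> \<in> N}" "y \<in> {x \<in> L. x \<up> \<epsilon> \<in> N}" for x y
    proof -
      have x: "x \<in> carrier G" "x \<in> L" "x \<up> \<epsilon> \<in> N" and y: "y \<in> carrier G" "y \<in> L" "y \<up> \<epsilon> \<in> N"
        using that Lc by auto
      have "N #> (x \<otimes> y) \<up> \<epsilon> = N #> (x \<up> \<epsilon> \<otimes> y \<up> \<epsilon>)"
        using qpow_mult_cong[OF N x(1) y(1) comm[OF x(2) y(2)]] .
      also have "\<dots> = N"
        using x y subgroup.m_closed[OF N'(3)] r_coset_eq_self_iff[OF N'(3)] qpow_closed by simp
      finally have "(x \<otimes> y) \<up> \<epsilon> \<in> N"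
        using r_coset_eq_self_iff[OF N'(3) qpow_closed] x(1) y(1) by simp
      then show ?thesis using x y subgroup.m_closed[OF L'(1)] by simp
    qed
  qed (use Lc in blast)
  moreover have "h \<up> \<alpha> \<in> {x \<in> L. x \<up> \<epsilon> \<in> N}" if "h \<in> {x \<in> L. x \<up> \<epsilon> \<in> N}" for h \<alpha>
  proof -
    have h: "h \<in> carrier G" "h \<in> L" "h \<up> \<epsilon> \<in> N" using that Lc by auto
    have "(h \<up> \<alpha>) \<up> \<epsilon> = (h \<up> \<epsilon>) \<up> \<alpha>" using h qpow_mult by (simp add: mult.commute)
    then show ?thesis using h L'(2) N'(4) by simp
  qed
  ultimately show ?thesis by (simp add: powered_subgroup_def)
qed

text \<open>Choose \<open>\<gamma> \<noteq> 0\<close> of least degree with \<open>z\<^bsup>\<gamma>\<mu>\<^esup> = \<one>\<close> for some \<open>\<mu>\<close> without divisors in \<open>\<omega>\<close>. An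
  irreducible divisor of \<open>\<gamma>\<close> outside \<open>\<omega>\<close> could be moved into \<open>\<mu>\<close>, and one inside \<open>\<omega>\<close>
  could be cancelled unless it kills \<open>z\<^sup>\<mu>\<close>.\<close>

lemma central_socle:
  assumes \<omega>: "set_of_primes \<omega>"
    and z: "z \<in> upper_central G (Suc 0)"
    and avoid: "\<And>\<mu>. smooth (monic_irreducibles - \<omega>) \<mu> \<Longrightarrow> z \<up> \<mu> \<noteq> \<one>"
    and meet: "\<And>a. a \<in> upper_central G (Suc 0) \<Longrightarrow> a \<noteq> \<one> \<Longrightarrow>
      \<exists>\<mu> \<beta>. smooth (monic_irreducibles - \<omega>) \<mu> \<and> z \<up> \<mu> = a \<up> \<beta>"
  shows "\<exists>\<pi>\<in>\<omega>. \<exists>\<mu>. smooth (monic_irreducibles - \<omega>) \<mu> \<and> z \<up> (\<mu> * \<pi>) = \<one>"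
proof (rule ccontr)
  let ?\<Lambda> = "smooth (monic_irreducibles - \<omega>)" and ?Z = "upper_central G (Suc 0)"
  assume contra: "\<not> ?thesis"
  have zG: "z \<in> carrier G" using z by simp
  have Z: "a \<up> \<alpha> \<in> ?Z" if "a \<in> ?Z" for a \<alpha>
    using normal_powered_subgroupD(4)[OF upper_central_normal_powered_subgroup that] .
  \<comment> \<open>By the assumption for contradiction z^(\<mu> \<pi>) is nontrivial, so its cyclic
    submodule must again contain some z^\<mu>' with \<mu>' free of divisors in \<omega>.\<close>
  have step: "\<exists>\<mu>' \<beta>. ?\<Lambda> \<mu>' \<and> z \<up> \<mu>' = z \<up> (\<mu> * \<pi> * \<beta>)" if "?\<Lambda> \<mu>" "\<pi> \<in> \<omega>" for \<mu> \<pi>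
  proof -
    have "z \<up> (\<mu> * \<pi>) \<noteq> \<one>" using contra that by blast
    from meet[OF Z[OF z] this] show ?thesis using qpow_mult[OF zG] by simp
  qed
  let ?P = "\<lambda>\<gamma>. \<gamma> \<noteq> 0 \<and> (\<exists>\<mu>. ?\<Lambda> \<mu> \<and> z \<up> (\<gamma> * \<mu>) = \<one>)"
  obtain \<pi>0 where \<pi>0: "\<pi>0 \<in> \<omega>" "\<pi>0 \<in> monic_irreducibles"
    using \<omega> by (auto simp: set_of_primes_def)
  obtain \<mu>0 \<beta>0 where \<mu>0: "?\<Lambda> \<mu>0" "z \<up> \<mu>0 = z \<up> (\<pi>0 * \<beta>0)"
    using step[OF smooth_1 \<pi>0(1)] by auto
  \<comment> \<open>The two expressions for z^\<mu>0 yield an annihilator \<mu>0 - \<pi>0 \<beta>0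
    of \<open>z\<close>, nonzero because \<pi>0 divides the second term but not the first. So there
    is a candidate for \<gamma>.\<close>
  have "\<not> \<pi>0 dvd \<mu>0" using \<mu>0(1) \<pi>0 by (auto simp: smooth_def)
  then have "\<mu>0 - \<pi>0 * \<beta>0 \<noteq> 0" by auto
  moreover have "z \<up> ((\<mu>0 - \<pi>0 * \<beta>0) * 1) = \<one>"
    using qpow_add[OF zG, of \<mu>0 "- (\<pi>0 * \<beta>0)"] qpow_uminus[OF zG, of "\<pi>0 * \<beta>0"] \<mu>0(2) qpow_closed[OF zG]
    by simp
  ultimately have "?P (\<mu>0 - \<pi>0 * \<beta>0)" using smooth_1 by blast
  then obtain \<gamma> where \<gamma>: "?P \<gamma>" and min: "\<And>\<delta>. ?P \<delta> \<Longrightarrow> degree \<gamma> \<le> degree \<delta>"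
    using ex_has_least_nat[of ?P _ degree] by blast
  then obtain \<mu> where \<mu>: "?\<Lambda> \<mu>" "z \<up> (\<gamma> * \<mu>) = \<one>" and "\<gamma> \<noteq> 0" by blast
  have "\<not> is_unit \<gamma>"
  proof
    assume "is_unit \<gamma>"
    then obtain \<delta> where "1 = \<gamma> * \<delta>" by blast
    then have "z \<up> \<mu> = (z \<up> (\<gamma> * \<mu>)) \<up> \<delta>"
      using qpow_mult[OF zG, of "\<gamma> * \<mu>" \<delta>] by (simp add: ac_simps flip: mult.assoc)
    then show False using avoid[OF \<mu>(1)] \<mu>(2) one_qpow by simp
  qed
  then obtain \<pi> where \<pi>: "\<pi> \<in> monic_irreducibles" "\<pi> dvd \<gamma>"
    using monic_irreducible_divisor_exists \<open>\<gamma> \<noteq> 0\<close> by blast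
  then obtain \<delta> where \<delta>: "\<gamma> = \<pi> * \<delta>" by blast
  have "\<delta> \<noteq> 0" and deg: "degree \<delta> < degree \<gamma>"
    using \<open>\<gamma> \<noteq> 0\<close> \<delta> monic_irreducibleD(5,6)[OF \<pi>(1)] by (auto simp: degree_mult_eq)
  have "\<exists>\<mu>'. ?\<Lambda> \<mu>' \<and> z \<up> (\<delta> * \<mu>') = \<one>"
  proof (cases "\<pi> \<in> \<omega>")
    case True
    obtain \<mu>' \<beta> where \<mu>': "?\<Lambda> \<mu>'" "z \<up> \<mu>' = z \<up> (\<mu> * \<pi> * \<beta>)" using step[OF \<mu>(1) True] by blast
    have "z \<up> (\<delta> * \<mu>') = (z \<up> \<mu>') \<up> \<delta>" using qpow_mult[OF zG] by (simp add: mult.commute)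
    also have "\<dots> = (z \<up> (\<gamma> * \<mu>)) \<up> \<beta>"
      using qpow_mult[OF zG] by (simp add: \<mu>'(2) \<delta> ac_simps)
    also have "\<dots> = \<one>" using \<mu>(2) one_qpow by simp
    finally show ?thesis using \<mu>'(1) by blast
  next
    case False
    then have "?\<Lambda> (\<pi> * \<mu>)" using smooth_mult[OF smooth_prime \<mu>(1)] \<pi>(1) by blast
    moreover have "z \<up> (\<delta> * (\<pi> * \<mu>)) = \<one>" using \<mu>(2) \<delta> by (simp add: ac_simps)
    ultimately show ?thesis by blast
  qed
  then have "degree \<gamma> \<le> degree \<delta>" using min \<open>\<delta> \<noteq> 0\<close> by blast
  then show False using deg by simp
qed

text \<open>Let \<pi>^k \<delta> annihilate \<open>a\<close> with \<delta> prime to \<pi>. If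
  a^(\<pi>^k) were nontrivial, \<open>z\<close> would be among its powers and hence killed by
  \<delta> as well as by \<pi>, so trivial.\<close>

lemma central_primary:
  assumes \<pi>: "\<pi> \<in> monic_irreducibles"
    and z: "z \<in> carrier G" "z \<noteq> \<one>" "z \<up> \<pi> = \<one>"
    and a: "a \<in> upper_central G (Suc 0)"
    and socle: "\<And>a. a \<in> upper_central G (Suc 0) \<Longrightarrow> a \<noteq> \<one> \<Longrightarrow> \<exists>\<beta>. z = a \<up> \<beta>"
  shows "\<exists>k\<ge>1. a \<up> (\<pi> ^ k) = \<one>"
proof (cases "a = \<one>")
  case True
  then show ?thesis using one_qpow by blast
next
  case False
  have aG: "a \<in> carrier G" using a by simp
  obtain \<beta> where \<beta>: "z = a \<up> \<beta>" using socle[OF a False] by blast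
  have "\<beta> \<noteq> 0" using z(2) \<beta> qpow_zero[OF aG] by auto
  then have "\<beta> * \<pi> \<noteq> 0" using monic_irreducibleD(5)[OF \<pi>] by simp
  \<comment> \<open>Since a^(\<beta> \<pi>) = z^\<pi> is trivial, \<beta> \<pi> is an annihilator of
    \<open>a\<close>; it is split into its \<pi>-part and the cofactor.\<close>
  then obtain k \<delta> where \<delta>: "\<beta> * \<pi> = \<pi> ^ k * \<delta>" "\<not> \<pi> dvd \<delta>"
    using multiplicity_decompose'[of "\<beta> * \<pi>" \<pi>] monic_irreducibleD(4)[OF \<pi>] by metis
  have kill: "a \<up> (\<pi> ^ k * \<delta>) = \<one>"
    using z(3) qpow_mult[OF aG, of \<beta> \<pi>] by (simp add: \<beta> \<delta>(1))
  have "a \<up> (\<pi> ^ k) = \<one>"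
  proof (rule ccontr)
    assume "a \<up> (\<pi> ^ k) \<noteq> \<one>"
    then obtain \<beta>' where "z = (a \<up> (\<pi> ^ k)) \<up> \<beta>'"
      using socle normal_powered_subgroupD(4)[OF upper_central_normal_powered_subgroup a] by blast
    then have "z \<up> \<delta> = (a \<up> (\<pi> ^ k * \<delta>)) \<up> \<beta>'"
      using qpow_mult[OF aG] by (simp add: ac_simps)
    then have z\<delta>: "z \<up> \<delta> = \<one>" using kill one_qpow by simp
    obtain u v where uv: "\<delta> * u + \<pi> * v = 1" using monic_irreducible_bezout[OF \<pi> \<delta>(2)] .
    have "z = z \<up> (\<delta> * u + \<pi> * v)" using uv qpow_one[OF z(1)] by simp
    also have "\<dots> = (z \<up> \<delta>) \<up> u \<otimes> (z \<up> \<pi>) \<up> v" using qpow_add[OF z(1)] qpow_mult[OF z(1)] by simp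
    also have "\<dots> = \<one>" using z\<delta> z(3) one_qpow by simp
    finally show False using z(2) by simp
  qed
  \<comment> \<open>The extra factor makes the exponent of \<pi> positive without a look at
    \<open>k\<close>.\<close>
  then have "a \<up> (\<pi> ^ Suc k) = \<one>"
    using qpow_mult[OF aG, of "\<pi> ^ k" \<pi>] one_qpow by (simp add: mult.commute)
  then show ?thesis by (metis le_add1 plus_1_eq_Suc)
qed

text \<open>The quotient G/M in axiomatic form: \<open>avoid\<close> and \<open>meet\<close> express
  the maximality of \<open>M\<close>. In \<open>fin\<close>, finite generation of the \<pi>-part of
  a factor is phrased inside the group, through subgroups that contain \<open>H i\<close>, so that
  no further quotient has to be formed.\<close>

lemma smooth_monolithic_FT:
  assumes \<omega>: "set_of_primes \<omega>" and g: "g \<in> carrier G"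
    and avoid: "\<And>\<mu>. smooth (monic_irreducibles - \<omega>) \<mu> \<Longrightarrow> g \<up> \<mu> \<noteq> \<one>"
    and meet: "\<And>P. normal_powered_subgroup P G \<Longrightarrow> P \<noteq> {\<one>} \<Longrightarrow>
      \<exists>\<mu>. smooth (monic_irreducibles - \<omega>) \<mu> \<and> g \<up> \<mu> \<in> P"
    and series: "central_powered_series G H r"
    and fin: "\<And>i \<pi>. i < r \<Longrightarrow> \<pi> \<in> \<omega> \<Longrightarrow>
      \<exists>S. finite S \<and> S \<subseteq> {x \<in> H (Suc i). \<exists>k\<ge>1. x \<up> (\<pi> ^ k) \<in> H i} \<and>
        (\<forall>Q. powered_subgroup Q G \<longrightarrow> H i \<union> S \<subseteq> Q \<longrightarrow>
          {x \<in> H (Suc i). \<exists>k\<ge>1. x \<up> (\<pi> ^ k) \<in> H i} \<subseteq> Q)"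
  shows "FT \<omega> G"
proof -
  let ?\<Lambda> = "smooth (monic_irreducibles - \<omega>)" and ?Z = "upper_central G (Suc 0)"
  note ser = central_powered_seriesD[OF series]
  have Hs: "powered_subgroup (H i) G" "normal_powered_subgroup (H i) G" "H i \<subseteq> carrier G" if "i \<le> r" for i
    using normal_powered_subgroupD(1,3)[OF ser(3)[OF that]] ser(3)[OF that] subgroup.subset by blast+
  have Z: "normal_powered_subgroup ?Z G" by (rule upper_central_normal_powered_subgroup)
  have ZG: "a \<in> carrier G" if "a \<in> ?Z" for a using that by simp
  have Zpow: "a \<up> \<alpha> \<in> ?Z" if "a \<in> ?Z" for a \<alpha> using normal_powered_subgroupD(4)[OF Z that] .
  have "g \<noteq> \<one>" using avoid[OF smooth_1] qpow_one[OF g] by simp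
  \<comment> \<open>With a trivial centre the central series could never leave the trivial
    subgroup.\<close>
  have "?Z \<noteq> {\<one>}"
  proof
    assume triv: "?Z = {\<one>}"
    have "H i = {\<one>}" if "i \<le> r" for i
      using that
    proof (induction i)
      case 0
      then show ?case using ser(1) by simp
    next
      case (Suc i)
      then have "H i = {\<one>}" by simp
      then have "H (Suc i) \<subseteq> ?Z"
        using ser(5)[of i] Hs(3)[OF Suc.prems] Suc.prems by auto
      then show ?case
        using triv subgroup.one_closed[OF normal_powered_subgroupD(3)[OF ser(3)[OF Suc.prems]]] by auto
    qed
    then show False using ser(2) g \<open>g \<noteq> \<one>\<close> by auto
  qed
  then obtain \<mu>0 where \<mu>0: "?\<Lambda> \<mu>0" "g \<up> \<mu>0 \<in> ?Z" using meet[OF Z] by blast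
  \<comment> \<open>A central power of \<open>g\<close>. Polynomials without divisors in \<omega>
    are closed under products, so \<open>z0\<close> inherits both the avoidance and the meeting
    property.\<close>
  define z0 where "z0 = g \<up> \<mu>0"
  have z0: "z0 \<in> ?Z" "z0 \<in> carrier G" using \<mu>0 ZG by (simp_all only: z0_def)
  have avoid0: "z0 \<up> \<mu> \<noteq> \<one>" if "?\<Lambda> \<mu>" for \<mu>
    using avoid[OF smooth_mult[OF \<mu>0(1) that]] qpow_mult[OF g] by (simp add: z0_def)
  have meet0: "\<exists>\<mu> \<beta>. ?\<Lambda> \<mu> \<and> z0 \<up> \<mu> = a \<up> \<beta>" if a: "a \<in> ?Z" "a \<noteq> \<one>" for a
  proof -
    have aG: "a \<in> carrier G" using ZG[OF a(1)] .
    have "a \<up> 1 \<in> range (\<lambda>\<beta>. a \<up> \<beta>)" by blast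
    then have "range (\<lambda>\<beta>. a \<up> \<beta>) \<noteq> {\<one>}" using a(2) qpow_one[OF aG] by auto
    then obtain \<mu> \<beta> where \<mu>: "?\<Lambda> \<mu>" "g \<up> \<mu> = a \<up> \<beta>"
      using meet[OF range_qpow_normal_powered_subgroup[OF a(1)]] by blast
    have "z0 \<up> \<mu> = (g \<up> \<mu>) \<up> \<mu>0" using qpow_mult[OF g] by (simp add: z0_def mult.commute)
    also have "\<dots> = a \<up> (\<beta> * \<mu>0)" using \<mu>(2) qpow_mult[OF aG] by simp
    finally show ?thesis using \<mu>(1) by blast
  qed
  obtain \<pi> \<mu>1 where \<pi>\<omega>: "\<pi> \<in> \<omega>" and \<mu>1: "?\<Lambda> \<mu>1" "z0 \<up> (\<mu>1 * \<pi>) = \<one>"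
    using central_socle[OF \<omega> z0(1) avoid0 meet0] by blast
  have \<pi>: "\<pi> \<in> monic_irreducibles" using \<omega> \<pi>\<omega> by (auto simp: set_of_primes_def)
  \<comment> \<open>Nontrivial and killed by \<pi>: the candidate for an element lying in every
    nontrivial cyclic submodule of the centre.\<close>
  define z where "z = z0 \<up> \<mu>1"
  have zG: "z \<in> carrier G" and z1: "z \<noteq> \<one>" and z\<pi>: "z \<up> \<pi> = \<one>"
    using qpow_closed[OF z0(2)] avoid0[OF \<mu>1(1)] \<mu>1(2) qpow_mult[OF z0(2)] by (simp_all add: z_def)
  have socle: "\<exists>\<beta>. z = a \<up> \<beta>" if a: "a \<in> ?Z" "a \<noteq> \<one>" for a
  proof -
    have aG: "a \<in> carrier G" using ZG[OF a(1)] .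
    obtain \<mu> \<beta> where \<mu>: "?\<Lambda> \<mu>" "z0 \<up> \<mu> = a \<up> \<beta>" using meet0[OF a] by blast
    \<comment> \<open>Some z^\<mu> is a power of \<open>a\<close>. As \<mu> is invertible modulo
      \<pi> and z^\<pi> is trivial, \<open>z\<close> itself is a power of \<open>a\<close>.\<close>
    have "\<not> \<pi> dvd \<mu>" using \<mu>(1) \<pi> \<pi>\<omega> by (auto simp: smooth_def)
    then obtain u v where uv: "\<mu> * u + \<pi> * v = 1" using monic_irreducible_bezout[OF \<pi>] by blast
    have "z = z \<up> (\<mu> * u + \<pi> * v)" using uv qpow_one[OF zG] by simp
    also have "\<dots> = (z \<up> \<mu>) \<up> u \<otimes> (z \<up> \<pi>) \<up> v" using qpow_add[OF zG] qpow_mult[OF zG] by simp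
    also have "\<dots> = (z \<up> \<mu>) \<up> u" using z\<pi> one_qpow qpow_closed[OF qpow_closed[OF zG]] by simp
    also have "z \<up> \<mu> = (z0 \<up> \<mu>) \<up> \<mu>1" using qpow_mult[OF z0(2)] by (simp add: z_def mult.commute)
    also have "((z0 \<up> \<mu>) \<up> \<mu>1) \<up> u = a \<up> (\<beta> * \<mu>1 * u)" using \<mu>(2) qpow_mult[OF aG] by simp
    finally show ?thesis by blast
  qed
  have primary: "\<exists>k\<ge>1. a \<up> (\<pi> ^ k) = \<one>" if "a \<in> ?Z" for a
    using central_primary[OF \<pi> zG z1 z\<pi> that socle] .
  \<comment> \<open>The exponent in \<open>primary\<close> depends on the element. Climbing the
    series, each factor adds a uniform exponent read off from finitely many generators of its
    \<pi>-part.\<close>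
  have bounded: "\<exists>e. \<forall>a\<in>?Z \<inter> H i. a \<up> (\<pi> ^ e) = \<one>" if "i \<le> r" for i
    using that
  proof (induction i)
    case 0
    then show ?case using ser(1) one_qpow by simp
  next
    case (Suc i)
    then have i: "i < r" "i \<le> r" by simp_all
    obtain e where e: "\<forall>a\<in>?Z \<inter> H i. a \<up> (\<pi> ^ e) = \<one>" using Suc by auto
    obtain S where S: "finite S" "S \<subseteq> {x \<in> H (Suc i). \<exists>k\<ge>1. x \<up> (\<pi> ^ k) \<in> H i}"
      and gen: "\<And>Q. powered_subgroup Q G \<Longrightarrow> H i \<union> S \<subseteq> Q \<Longrightarrow>
        {x \<in> H (Suc i). \<exists>k\<ge>1. x \<up> (\<pi> ^ k) \<in> H i} \<subseteq> Q"
      using fin[OF i(1) \<pi>\<omega>] by blast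
    have "\<forall>s\<in>S. \<exists>k. s \<up> (\<pi> ^ k) \<in> H i" using S(2) by blast
    then obtain k where k: "\<And>s. s \<in> S \<Longrightarrow> s \<up> (\<pi> ^ k s) \<in> H i" by metis
    \<comment> \<open>Large enough for every generator; the inserted 0 covers an empty
      \<open>S\<close>.\<close>
    define m where "m = Max (insert 0 (k ` S))"
    \<comment> \<open>A subgroup, because the factor is abelian. It contains \<open>H i\<close> and
      the generators, hence the whole \<pi>-part.\<close>
    let ?Q = "{x \<in> H (Suc i). x \<up> (\<pi> ^ m) \<in> H i}"
    have "powered_subgroup ?Q G"
      using Hs(3)[OF Suc.prems] ser(5)[OF i(1)]
      by (intro qpow_vimage_powered_subgroup Hs Suc.prems i(2)) blast
    moreover have "H i \<union> S \<subseteq> ?Q"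
    proof
      fix x assume "x \<in> H i \<union> S"
      then consider "x \<in> H i" | "x \<in> S" by blast
      then show "x \<in> ?Q"
      proof cases
        case 1
        then show ?thesis using ser(4)[OF i(1)] powered_subgroupD(2)[OF Hs(1)[OF i(2)]] by blast
      next
        case 2
        then have xG: "x \<in> carrier G" and xH: "x \<in> H (Suc i)" using S(2) Hs(3)[OF Suc.prems] by auto
        have "k x \<le> m" unfolding m_def using S(1) 2 by (intro Max_ge) auto
        then have "\<pi> ^ m = \<pi> ^ k x * \<pi> ^ (m - k x)" by (simp flip: power_add)
        then have "x \<up> (\<pi> ^ m) = (x \<up> (\<pi> ^ k x)) \<up> (\<pi> ^ (m - k x))"
          using qpow_mult[OF xG] by simp
        then show ?thesis using powered_subgroupD(2)[OF Hs(1)[OF i(2)] k[OF 2]] xH by simp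
      qed
    qed
    ultimately have sub: "{x \<in> H (Suc i). \<exists>k\<ge>1. x \<up> (\<pi> ^ k) \<in> H i} \<subseteq> ?Q" by (rule gen)
    have "a \<up> (\<pi> ^ (m + e)) = \<one>" if a: "a \<in> ?Z \<inter> H (Suc i)" for a
    proof -
      have aG: "a \<in> carrier G" using a ZG by blast
      have "\<one> \<in> H i" using subgroup.one_closed[OF powered_subgroupD(1)[OF Hs(1)[OF i(2)]]] .
      moreover obtain k where "k \<ge> 1" "a \<up> (\<pi> ^ k) = \<one>" using primary[of a] a by blast
      ultimately have "a \<in> {x \<in> H (Suc i). \<exists>k\<ge>1. x \<up> (\<pi> ^ k) \<in> H i}" using a by force
      then have "a \<in> ?Q" using sub by (rule set_rev_mp)
      then have "a \<up> (\<pi> ^ m) \<in> ?Z \<inter> H i" using a Zpow by blast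
      then show ?thesis using e qpow_mult[OF aG, of "\<pi> ^ m" "\<pi> ^ e"] by (simp add: power_add)
    qed
    then show ?case by blast
  qed
  obtain e where e: "\<forall>a\<in>?Z \<inter> H r. a \<up> (\<pi> ^ e) = \<one>" using bounded[OF order_refl] by blast
  have e': "a \<up> (\<pi> ^ e) = \<one>" if "a \<in> ?Z" for a using e that ser(2) ZG by blast
  \<comment> \<open>Each step down the upper central series costs one factor \<pi>^e.\<close>
  have kill: "a \<up> (\<pi> ^ (e * n)) = \<one>" if "a \<in> upper_central G n" for a n
    using that
  proof (induction n arbitrary: a)
    case 0
    then show ?case using one_qpow by simp
  next
    case (Suc n)
    have aG: "a \<in> carrier G" using Suc.prems by simp
    have "(a \<up> (\<pi> ^ e)) \<up> (\<pi> ^ (e * n)) = \<one>"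
      using Suc.IH[OF upper_central_exponent[OF e' Suc.prems]] .
    then show ?case using qpow_mult[OF aG] by (simp add: power_add)
  qed
  \<comment> \<open>\<open>Suc\<close> keeps the polynomial nonconstant when e * r = 0, as
    \<open>prime_member\<close> and the condition k \<ge> 1 in \<open>fin\<close> demand.\<close>
  have tors: "a \<up> (\<pi> ^ Suc (e * r)) = \<one>" if a: "a \<in> carrier G" for a
  proof -
    have "a \<up> (\<pi> ^ (e * r)) = \<one>"
      using kill central_series_upper_central[OF series order_refl] ser(2) a by blast
    then show ?thesis using qpow_mult[OF a, of "\<pi> ^ (e * r)" \<pi>] one_qpow by (simp add: mult.commute)
  qed
  have "prime_member \<omega> (\<pi> ^ Suc (e * r))"
    using smooth_power[OF smooth_prime[OF \<pi> \<pi>\<omega>], of "Suc (e * r)"] monic_irreducibleD(5,6)[OF \<pi>]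
    by (simp add: prime_member_iff degree_power_eq degree_mult_eq)
  then have "torsion_group \<omega> G" using tors by (auto simp: torsion_group_def simp del: power_Suc)
  moreover have "finitely_powered_generated G"
  proof -
    have "\<forall>i. \<exists>S. i < r \<longrightarrow> finite S \<and> S \<subseteq> H (Suc i) \<and>
        (\<forall>Q. powered_subgroup Q G \<longrightarrow> H i \<union> S \<subseteq> Q \<longrightarrow> H (Suc i) \<subseteq> Q)"
    proof
      fix i
      show "\<exists>S. i < r \<longrightarrow> finite S \<and> S \<subseteq> H (Suc i) \<and>
        (\<forall>Q. powered_subgroup Q G \<longrightarrow> H i \<union> S \<subseteq> Q \<longrightarrow> H (Suc i) \<subseteq> Q)"
      proof (cases "i < r")
        case True
        then have "\<one> \<in> H i" "H (Suc i) \<subseteq> carrier G"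
          using subgroup.one_closed[OF powered_subgroupD(1)[OF Hs(1)]] Hs(3)[of "Suc i"] by auto
        then have "x \<up> (\<pi> ^ Suc (e * r)) \<in> H i" if "x \<in> H (Suc i)" for x
          using tors that by (metis subsetD)
        moreover have "Suc (e * r) \<ge> 1" by simp
        ultimately have "{x \<in> H (Suc i). \<exists>k\<ge>1. x \<up> (\<pi> ^ k) \<in> H i} = H (Suc i)" by blast
        then show ?thesis using fin[OF True \<pi>\<omega>] by metis
      qed simp
    qed
    then obtain S where S: "\<And>i. i < r \<Longrightarrow> finite (S i)" "\<And>i. i < r \<Longrightarrow> S i \<subseteq> H (Suc i)"
      "\<And>i Q. i < r \<Longrightarrow> powered_subgroup Q G \<Longrightarrow> H i \<union> S i \<subseteq> Q \<Longrightarrow> H (Suc i) \<subseteq> Q"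
      by metis
    let ?S = "\<Union>i<r. S i"
    let ?P = "powered_generate G ?S"
    have "S i \<subseteq> carrier G" if "i < r" for i
      using S(2)[OF that] Hs(3)[of "Suc i"] that by simp
    then have SG: "?S \<subseteq> carrier G" by blast
    have P: "powered_subgroup ?P G" using powered_generate_powered_subgroup[OF SG] .
    have "H i \<subseteq> ?P" if "i \<le> r" for i
      using that
    proof (induction i)
      case 0
      then show ?case using ser(1) subgroup.one_closed[OF powered_subgroupD(1)[OF P]] by simp
    next
      case (Suc i)
      then have i: "i < r" and "H i \<subseteq> ?P" by simp_all
      moreover have "S i \<subseteq> ?S" using i by blast
      then have "S i \<subseteq> ?P" using powered_generate_incl by blast
      ultimately show ?case using S(3)[OF i P] by blast
    qed
    then have "?P = carrier G"
      using ser(2) subgroup.subset[OF powered_subgroupD(1)[OF P]] by auto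
    moreover have "finite ?S" using S(1) by blast
    ultimately show ?thesis using SG unfolding finitely_powered_generated_def by blast
  qed
  ultimately show ?thesis using nilpotent_powered_group_axioms by (simp add: FT_def)
qed

end

section \<open>Separability\<close>

lemma powered_group_hom_restrict:
  assumes "powered_group_hom G K \<phi>" "powered_subgroup L G"
  shows "powered_group_hom (G\<lparr>carrier := L\<rparr>) K \<phi>"
proof -
  interpret \<phi>: powered_group_hom G K \<phi> by fact
  note L = powered_subgroupD[OF assms(2)]
  have sub: "x \<in> carrier G" if "x \<in> L" for x using subgroup.mem_carrier[OF L(1) that] .
  show ?thesis
    using \<phi>.G.subgroup_imp_group[OF L(1)] \<phi>.H.group_axioms L(2) \<phi>.hom_qpow sub
    by (auto simp: powered_group_hom_def powered_group_hom_axioms_def group_hom_def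
        group_hom_axioms_def hom_def)
qed

lemma powered_group_hom_comp:
  assumes "powered_group_hom G H f" "powered_group_hom H K g"
  shows "powered_group_hom G K (\<lambda>x. g (f x))"
proof -
  interpret f: powered_group_hom G H f by fact
  interpret g: powered_group_hom H K g by fact
  show ?thesis
    by unfold_locales (auto simp: hom_def f.hom_qpow g.hom_qpow f.G_qpow_closed)
qed

lemma (in nilpotent_powered_group) primary_part_powered_subgroup:
  assumes "comm_group G"
  shows "powered_subgroup (primary_part \<pi> G) G"
proof -
  interpret comm_group G by fact
  have kill: "a \<up> (\<alpha> * \<beta>) = \<one>" if "a \<in> carrier G" "a \<up> \<alpha> = \<one>" for a \<alpha> \<beta>
    using qpow_mult[OF that(1), of \<alpha> \<beta>] that(2) one_qpow by simp
  have kill': "a \<up> (\<beta> * \<alpha>) = \<one>" if "a \<in> carrier G" "a \<up> \<alpha> = \<one>" for a \<alpha> \<beta>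
    using kill[OF that, of \<beta>] by (simp only: mult.commute[of \<alpha> \<beta>])
  have pow: "a \<up> \<alpha> \<in> primary_part \<pi> G" if prim: "a \<in> primary_part \<pi> G" for a \<alpha>
  proof -
    obtain k where a: "a \<in> carrier G" "k \<ge> 1" "a \<up> (\<pi> ^ k) = \<one>"
      using prim unfolding primary_part_def by blast
    then have "(a \<up> \<alpha>) \<up> (\<pi> ^ k) = \<one>" using kill' qpow_mult by simp
    then show ?thesis using a qpow_closed by (auto simp: primary_part_def)
  qed
  have "subgroup (primary_part \<pi> G) G"
  proof (rule subgroupI)
    show "primary_part \<pi> G \<noteq> {}" using one_qpow by (auto simp: primary_part_def)
    show "inv a \<in> primary_part \<pi> G" if "a \<in> primary_part \<pi> G" for a
      using pow[OF that, of "- 1"] that qpow_minus_one by (simp add: primary_part_def)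
    show "a \<otimes> b \<in> primary_part \<pi> G" if ab: "a \<in> primary_part \<pi> G" "b \<in> primary_part \<pi> G" for a b
    proof -
      obtain k l where a: "a \<in> carrier G" "k \<ge> 1" "a \<up> (\<pi> ^ k) = \<one>"
        and b: "b \<in> carrier G" "l \<ge> 1" "b \<up> (\<pi> ^ l) = \<one>"
        using ab unfolding primary_part_def by blast
      have "(a \<otimes> b) \<up> (\<pi> ^ (k + l)) = a \<up> (\<pi> ^ (k + l)) \<otimes> b \<up> (\<pi> ^ (k + l))"
        using qpow_mult_commute[OF a(1) b(1) m_comm[OF a(1) b(1)]] .
      also have "\<dots> = \<one>" using kill[OF a(1,3)] kill'[OF b(1,3)] by (simp add: power_add)
      finally have "(a \<otimes> b) \<up> (\<pi> ^ (k + l)) = \<one>" .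
      moreover have "k + l \<ge> 1" using a(2) by simp
      ultimately show ?thesis using a(1) b(1) unfolding primary_part_def by blast
    qed
  qed (auto simp: primary_part_def)
  then show ?thesis using pow by (simp add: powered_subgroup_def)
qed

text \<open>By \<open>ker\<close>, the group \<open>B\<close> plays the role of \<phi>(L)/\<phi>(N).
  Instead of building an isomorphism, generators and elements of the primary part are lifted to
  \<open>L\<close> along \<psi> and sent on to \<open>K\<close> by \<phi>.\<close>

lemma primary_part_transfer:
  assumes \<psi>: "powered_group_hom L B \<psi>" and \<phi>: "powered_group_hom L K \<phi>"
    and B: "nilpotent_powered_group B" and comm: "comm_group B"
    and onto: "carrier B = \<psi> ` carrier L"
    and ker: "\<And>x. x \<in> carrier L \<Longrightarrow> \<psi> x = \<one>\<^bsub>B\<^esub> \<longleftrightarrow> \<phi> x \<in> \<phi> ` N"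
    and fin: "finitely_powered_generated (B\<lparr>carrier := primary_part \<pi> B\<rparr>)"
  shows "\<exists>S. finite S \<and> S \<subseteq> {x \<in> \<phi> ` carrier L. \<exists>k\<ge>1. x \<up>\<^bsub>K\<^esub> (\<pi> ^ k) \<in> \<phi> ` N} \<and>
    (\<forall>Q. powered_subgroup Q K \<longrightarrow> \<phi> ` N \<union> S \<subseteq> Q \<longrightarrow>
      {x \<in> \<phi> ` carrier L. \<exists>k\<ge>1. x \<up>\<^bsub>K\<^esub> (\<pi> ^ k) \<in> \<phi> ` N} \<subseteq> Q)"
proof -
  interpret B: nilpotent_powered_group B by fact
  interpret \<psi>: powered_group_hom L B \<psi> by fact
  interpret \<phi>: powered_group_hom L K \<phi> by fact
  let ?P = "primary_part \<pi> B"
  have P: "powered_subgroup ?P B" using B.primary_part_powered_subgroup[OF comm] .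
  have P_iff: "\<psi> x \<in> ?P \<longleftrightarrow> (\<exists>k\<ge>1. \<phi> x \<up>\<^bsub>K\<^esub> (\<pi> ^ k) \<in> \<phi> ` N)" if xL: "x \<in> carrier L" for x
  proof -
    have "\<psi> x \<up>\<^bsub>B\<^esub> (\<pi> ^ k) = \<one>\<^bsub>B\<^esub> \<longleftrightarrow> \<phi> x \<up>\<^bsub>K\<^esub> (\<pi> ^ k) \<in> \<phi> ` N" for k
    proof -
      have "\<psi> x \<up>\<^bsub>B\<^esub> (\<pi> ^ k) = \<one>\<^bsub>B\<^esub> \<longleftrightarrow> \<psi> (x \<up>\<^bsub>L\<^esub> (\<pi> ^ k)) = \<one>\<^bsub>B\<^esub>"
        by (simp only: \<psi>.hom_qpow[OF xL])
      also have "\<dots> \<longleftrightarrow> \<phi> (x \<up>\<^bsub>L\<^esub> (\<pi> ^ k)) \<in> \<phi> ` N"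
        using ker \<phi>.G_qpow_closed[OF xL] by blast
      finally show ?thesis by (simp only: \<phi>.hom_qpow[OF xL])
    qed
    then show ?thesis using \<psi>.hom_closed[OF xL] by (simp add: primary_part_def)
  qed
  obtain S' where S': "finite S'" "S' \<subseteq> ?P" "powered_generate (B\<lparr>carrier := ?P\<rparr>) S' = ?P"
    using fin unfolding finitely_powered_generated_def by auto
  have sub: "S' \<subseteq> \<psi> ` carrier L" using S'(2) subgroup.subset[OF powered_subgroupD(1)[OF P]] onto by blast
  obtain S where S: "finite S" "S \<subseteq> carrier L" "S' = \<psi> ` S"
    using finite_subset_image[OF S'(1) sub] by metis
  have "\<phi> ` S \<subseteq> {x \<in> \<phi> ` carrier L. \<exists>k\<ge>1. x \<up>\<^bsub>K\<^esub> (\<pi> ^ k) \<in> \<phi> ` N}"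
  proof (rule image_subsetI)
    fix s assume s: "s \<in> S"
    then have sL: "s \<in> carrier L" using S(2) by (rule rev_subsetD)
    have "\<psi> s \<in> ?P" using s S(3) S'(2) by (metis imageI subsetD)
    then have "\<exists>k\<ge>1. \<phi> s \<up>\<^bsub>K\<^esub> (\<pi> ^ k) \<in> \<phi> ` N" unfolding P_iff[OF sL] .
    then show "\<phi> s \<in> {x \<in> \<phi> ` carrier L. \<exists>k\<ge>1. x \<up>\<^bsub>K\<^esub> (\<pi> ^ k) \<in> \<phi> ` N}" using sL by (metis (mono_tags, lifting) imageI mem_Collect_eq)
  qed
  moreover have "{x \<in> \<phi> ` carrier L. \<exists>k\<ge>1. x \<up>\<^bsub>K\<^esub> (\<pi> ^ k) \<in> \<phi> ` N} \<subseteq> Q"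
    if Q: "powered_subgroup Q K" "\<phi> ` N \<union> \<phi> ` S \<subseteq> Q" for Q
  proof
    fix x assume "x \<in> {x \<in> \<phi> ` carrier L. \<exists>k\<ge>1. x \<up>\<^bsub>K\<^esub> (\<pi> ^ k) \<in> \<phi> ` N}"
    then obtain y where y: "y \<in> carrier L" "x = \<phi> y" "\<exists>k\<ge>1. \<phi> y \<up>\<^bsub>K\<^esub> (\<pi> ^ k) \<in> \<phi> ` N" by blast
    from y(3) have y\<psi>: "\<psi> y \<in> ?P" unfolding P_iff[OF y(1)] .
    let ?T = "{t \<in> carrier L. \<phi> t \<in> Q}"
    have T: "powered_subgroup (\<psi> ` ?T) B"
      using \<psi>.powered_subgroup_image[OF \<phi>.powered_subgroup_vimage[OF Q(1)]] .
    \<comment> \<open>This intersection contains the generators of the primary part, hence all of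
      it: every primary element is the \<psi>-image of some t whose \<phi>-image lies in
      \<open>Q\<close>.\<close>
    have "subgroup (?P \<inter> \<psi> ` ?T) (B\<lparr>carrier := ?P\<rparr>)"
      using B.subgroup_incl[OF B.subgroups_Inter_pair] powered_subgroupD(1) P T by blast
    moreover have "h \<up>\<^bsub>B\<lparr>carrier := ?P\<rparr>\<^esub> \<alpha> \<in> ?P \<inter> \<psi> ` ?T" if "h \<in> ?P \<inter> \<psi> ` ?T" for h \<alpha>
      using powered_subgroupD(2)[OF P] powered_subgroupD(2)[OF T] that by simp
    ultimately have "powered_subgroup (?P \<inter> \<psi> ` ?T) (B\<lparr>carrier := ?P\<rparr>)"
      unfolding powered_subgroup_def by blast
    moreover have "S' \<subseteq> ?P \<inter> \<psi> ` ?T"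
    proof
      fix s assume s: "s \<in> S'"
      then obtain t where t: "t \<in> S" "s = \<psi> t" unfolding S(3) by (rule imageE)
      then have "t \<in> ?T" using S(2) Q(2) by auto
      then show "s \<in> ?P \<inter> \<psi> ` ?T" using s S'(2) t(2) by blast
    qed
    ultimately have "powered_generate (B\<lparr>carrier := ?P\<rparr>) S' \<subseteq> ?P \<inter> \<psi> ` ?T"
      unfolding powered_generate_def by blast
    then have "\<psi> y \<in> \<psi> ` ?T" using y\<psi> S'(3) by blast
    then obtain t where t: "t \<in> carrier L" "\<phi> t \<in> Q" "\<psi> y = \<psi> t" by blast
    note yL = y(1)
    \<comment> \<open>Elements with equal \<psi>-image differ by an element of the kernel, which
      \<phi> sends into \<phi>(N) and thus into \<open>Q\<close>.\<close>
    let ?d = "y \<otimes>\<^bsub>L\<^esub> inv\<^bsub>L\<^esub> t"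
    have dL: "?d \<in> carrier L" using \<psi>.G.m_closed[OF yL \<psi>.G.inv_closed[OF t(1)]] .
    have "\<psi> ?d = \<psi> y \<otimes>\<^bsub>B\<^esub> inv\<^bsub>B\<^esub> (\<psi> t)"
      by (simp only: \<psi>.hom_mult[OF yL \<psi>.G.inv_closed[OF t(1)]] \<psi>.hom_inv[OF t(1)])
    also have "\<dots> = \<one>\<^bsub>B\<^esub>"
      unfolding t(3) using B.r_inv[OF \<psi>.hom_closed[OF t(1)]] .
    finally have d: "\<phi> ?d \<in> Q" using ker[OF dL] Q(2) by blast
    have "\<phi> ?d = \<phi> y \<otimes>\<^bsub>K\<^esub> inv\<^bsub>K\<^esub> (\<phi> t)"
      by (simp only: \<phi>.hom_mult[OF yL \<psi>.G.inv_closed[OF t(1)]] \<phi>.hom_inv[OF t(1)])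
    then have "\<phi> y = \<phi> ?d \<otimes>\<^bsub>K\<^esub> \<phi> t"
      using \<phi>.H.inv_solve_right[OF \<phi>.hom_closed[OF dL] \<phi>.hom_closed[OF yL] \<phi>.hom_closed[OF t(1)]]
      by blast
    then show "x \<in> Q" using subgroup.m_closed[OF powered_subgroupD(1)[OF Q(1)] d t(2)] y(2) by simp
  qed
  ultimately show ?thesis using S(1) by (intro exI[of _ "\<phi> ` S"]) blast
qed

text \<open>With \<open>V\<close> the elements of \<open>L\<close> whose image lies in \<open>\<phi>(N)\<close>, the image \<open>\<phi>(L)/\<phi>(N)\<close> is
  isomorphic to \<open>L/V\<close>, a quotient of the restricted group \<open>L/N\<close>.\<close>

lemma (in nilpotent_powered_group) restricted_factor_image:
  assumes L: "powered_subgroup L G" and N: "normal_powered_subgroup N G" "N \<subseteq> L"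
    and restr: "restricted_abelian \<omega> (powered_quotient (G\<lparr>carrier := L\<rparr>) N)" and \<pi>: "\<pi> \<in> \<omega>"
    and hom: "powered_group_hom G K \<phi>"
  shows "\<exists>S. finite S \<and> S \<subseteq> {x \<in> \<phi> ` L. \<exists>k\<ge>1. x \<up>\<^bsub>K\<^esub> (\<pi> ^ k) \<in> \<phi> ` N} \<and>
    (\<forall>Q. powered_subgroup Q K \<longrightarrow> \<phi> ` N \<union> S \<subseteq> Q \<longrightarrow>
      {x \<in> \<phi> ` L. \<exists>k\<ge>1. x \<up>\<^bsub>K\<^esub> (\<pi> ^ k) \<in> \<phi> ` N} \<subseteq> Q)"
proof -
  let ?L = "G\<lparr>carrier := L\<rparr>"
  let ?A = "powered_quotient ?L N"
  let ?p = "\<lambda>x. N #>\<^bsub>?L\<^esub> x"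
  interpret L: nilpotent_powered_group ?L using nilpotent_powered_group_powered_subgroup[OF L] .
  interpret \<phi>: powered_group_hom ?L K \<phi> using powered_group_hom_restrict[OF hom L] .
  interpret A: nilpotent_powered_group ?A
    using restr by (simp add: restricted_abelian_def abelian_powered_group_def)
  interpret A': comm_group ?A
    using restr by (simp add: restricted_abelian_def abelian_powered_group_def)
  note N' = normal_powered_subgroupD[OF N(1)] and L' = powered_subgroupD[OF L]
  have NL: "normal_powered_subgroup N ?L"
  proof -
    have sN: "subgroup N ?L" using subgroup_incl[OF N'(3) L'(1) N(2)] .
    moreover have "N \<lhd> ?L"
    proof (rule L.normal_invI[OF sN])
      fix x h assume x: "x \<in> carrier ?L" and h: "h \<in> N"
      have "inv\<^bsub>?L\<^esub> x = inv x" using m_inv_consistent[OF L'(1)] x by simp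
      then show "x \<otimes>\<^bsub>?L\<^esub> h \<otimes>\<^bsub>?L\<^esub> inv\<^bsub>?L\<^esub> x \<in> N"
        using normal.inv_op_closed2[OF N'(2) _ h, of x] subgroup.mem_carrier[OF L'(1), of x] x
        by simp
    qed
    ultimately show ?thesis using N'(4) by (simp add: normal_powered_subgroup_def powered_subgroup_def)
  qed
  interpret p: powered_group_hom ?L ?A ?p using L.powered_group_hom_quotient[OF NL] .
  define V where "V = {x \<in> carrier ?L. \<phi> x \<in> \<phi> ` N}"
  have \<phi>N: "powered_subgroup (\<phi> ` N) K"
    using \<phi>.powered_subgroup_image[OF normal_powered_subgroupD(1)[OF NL]] .
  have V: "powered_subgroup V ?L" unfolding V_def using \<phi>.powered_subgroup_vimage[OF \<phi>N] .
  note V' = powered_subgroupD[OF V]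
  have NV: "N \<subseteq> V" using N(2) by (auto simp: V_def)
  have pV: "normal_powered_subgroup (?p ` V) ?A"
    using p.powered_subgroup_image[OF V] A'.normal_iff_subgroup
    by (simp add: normal_powered_subgroup_def powered_subgroup_def)
  let ?B = "powered_quotient ?A (?p ` V)"
  let ?r = "\<lambda>a. ?p ` V #>\<^bsub>?A\<^esub> a"
  interpret B: nilpotent_powered_group ?B using A.nilpotent_powered_group_powered_quotient[OF pV] .
  interpret r: powered_group_hom ?A ?B ?r using A.powered_group_hom_quotient[OF pV] .
  let ?\<psi> = "\<lambda>x. ?r (?p x)"
  interpret \<psi>: powered_group_hom ?L ?B ?\<psi>
    using powered_group_hom_comp[OF p.powered_group_hom_axioms r.powered_group_hom_axioms] .
  have B_carrier: "carrier ?B = ?\<psi> ` L"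
    unfolding powered_quotient_simps(1)[of ?A] powered_quotient_simps(1)[of ?L] image_image by simp
  have B_comm: "comm_group ?B"
  proof (rule B.group_comm_groupI)
    fix x y assume "x \<in> carrier ?B" "y \<in> carrier ?B"
    then obtain a b where ab: "x = ?r a" "y = ?r b" "a \<in> carrier ?A" "b \<in> carrier ?A"
      unfolding powered_quotient_simps(1)[of ?A] by blast
    then show "x \<otimes>\<^bsub>?B\<^esub> y = y \<otimes>\<^bsub>?B\<^esub> x"
      using r.hom_mult[of a b] r.hom_mult[of b a] A'.m_comm[of a b] by simp
  qed
  have B_one: "\<one>\<^bsub>?B\<^esub> = ?p ` V" by (simp only: powered_quotient_simps(3))
  have ker: "?\<psi> x = \<one>\<^bsub>?B\<^esub> \<longleftrightarrow> x \<in> V" if x: "x \<in> L" for x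
  proof -
    have xL: "x \<in> carrier ?L" using x by simp
    have "?\<psi> x = \<one>\<^bsub>?B\<^esub> \<longleftrightarrow> ?p x \<in> ?p ` V"
      unfolding B_one
      using A.r_coset_eq_self_iff[OF normal_powered_subgroupD(3)[OF pV] p.hom_closed[OF xL]] .
    also have "\<dots> \<longleftrightarrow> x \<in> V"
    proof
      assume "?p x \<in> ?p ` V"
      then obtain y where y: "y \<in> V" "?p x = ?p y" by blast
      have yL: "y \<in> carrier ?L" using subgroup.mem_carrier[OF V'(1) y(1)] .
      have "x \<otimes>\<^bsub>?L\<^esub> inv\<^bsub>?L\<^esub> y \<in> V"
        using L.r_coset_eq_iff[OF normal_powered_subgroupD(3)[OF NL] xL yL] y(2) NV by blast
      then have "x \<otimes>\<^bsub>?L\<^esub> inv\<^bsub>?L\<^esub> y \<otimes>\<^bsub>?L\<^esub> y \<in> V" using subgroup.m_closed[OF V'(1)] y(1) by blast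
      moreover have "x \<otimes>\<^bsub>?L\<^esub> inv\<^bsub>?L\<^esub> y \<otimes>\<^bsub>?L\<^esub> y = x"
        by (metis xL yL L.m_assoc L.inv_closed L.l_inv L.r_one)
      ultimately show "x \<in> V" by metis
    qed blast
    finally show ?thesis .
  qed
  \<comment> \<open>Here it matters that \<open>restricted_abelian\<close> quantifies over all
    quotients: it is applied to L/N modulo the image of \<open>V\<close>.\<close>
  have "finitely_powered_generated (?B\<lparr>carrier := primary_part \<pi> ?B\<rparr>)"
    using restr pV \<pi> unfolding restricted_abelian_def by blast
  moreover have "?\<psi> x = \<one>\<^bsub>?B\<^esub> \<longleftrightarrow> \<phi> x \<in> \<phi> ` N" if "x \<in> carrier ?L" for x
    using ker[of x] that by (simp add: V_def)
  ultimately show ?thesis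
    using primary_part_transfer[OF \<psi>.powered_group_hom_axioms \<phi>.powered_group_hom_axioms
        B.nilpotent_powered_group_axioms B_comm, of N \<pi>] B_carrier by simp
qed

section \<open>Maximal normal subgroups avoiding powers of an element\<close>

lemma (in nilpotent_powered_group) normal_powered_subgroup_Union_chain:
  assumes C: "C \<noteq> {}" "\<And>M. M \<in> C \<Longrightarrow> normal_powered_subgroup M G"
    and chain: "\<And>X Y. X \<in> C \<Longrightarrow> Y \<in> C \<Longrightarrow> X \<subseteq> Y \<or> Y \<subseteq> X"
  shows "normal_powered_subgroup (\<Union>C) G"
proof -
  note M = normal_powered_subgroupD[OF C(2)]
  have S: "subgroup (\<Union>C) G"
  proof (rule subgroupI)
    show "\<Union>C \<subseteq> carrier G" using subgroup.subset[OF M(3)] by blast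
    show "\<Union>C \<noteq> {}" using C(1) subgroup.one_closed[OF M(3)] by blast
    show "inv a \<in> \<Union>C" if "a \<in> \<Union>C" for a using that subgroup.m_inv_closed[OF M(3)] by blast
    show "a \<otimes> b \<in> \<Union>C" if ab: "a \<in> \<Union>C" "b \<in> \<Union>C" for a b
    proof -
      obtain X Y where X: "X \<in> C" "a \<in> X" and Y: "Y \<in> C" "b \<in> Y" using ab by blast
      then have "\<exists>Z\<in>C. a \<in> Z \<and> b \<in> Z" using chain[OF X(1) Y(1)] by blast
      then show ?thesis using subgroup.m_closed[OF M(3)] by blast
    qed
  qed
  moreover have "\<Union>C \<lhd> G"
    using normal.inv_op_closed2[OF M(2)] by (intro normal_invI[OF S]) blast
  ultimately show ?thesis
    using M(4) by (auto simp: normal_powered_subgroup_def powered_subgroup_def)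
qed

theorem theorem3p15:
  fixes G :: "'a powered_group" and \<omega> :: "rat poly set"
  assumes "set_of_primes \<omega>" and "prime_restricted \<omega> G"
  shows "\<forall>N. normal_powered_subgroup N G \<and> isolated (monic_irreducibles - \<omega>) N G
           \<longrightarrow> FT_separable \<omega> N G"
proof (intro allI impI, elim conjE)
  fix N assume N: "normal_powered_subgroup N G" and iso: "isolated (monic_irreducibles - \<omega>) N G"
  interpret G: nilpotent_powered_group G using assms(2) by (simp add: prime_restricted_def)
  obtain H r where series: "central_powered_series G H r"
    and restr: "\<And>i. i < r \<Longrightarrow> restricted_abelian \<omega> (powered_quotient (G\<lparr>carrier := H (Suc i)\<rparr>) (H i))"
    using assms(2) by (auto simp: prime_restricted_def)
  note ser = central_powered_seriesD[OF series]
  let ?\<Lambda> = "smooth (monic_irreducibles - \<omega>)"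
  show "FT_separable \<omega> N G"
    unfolding FT_separable_def
  proof
    fix g assume g: "g \<in> carrier G - N"
    then have gG: "g \<in> carrier G" by simp
    define \<A> where "\<A> = {M. normal_powered_subgroup M G \<and> N \<subseteq> M \<and> (\<forall>\<mu>. ?\<Lambda> \<mu> \<longrightarrow> g \<up>\<^bsub>G\<^esub> \<mu> \<notin> M)}"
    \<comment> \<open>Isolation speaks of nonconstant \<mu> only; the remaining case is \<mu> = 1,
      which is the choice of \<open>g\<close> outside \<open>N\<close>.\<close>
    have "g \<up>\<^bsub>G\<^esub> \<mu> \<notin> N" if "?\<Lambda> \<mu>" for \<mu>
    proof
      assume *: "g \<up>\<^bsub>G\<^esub> \<mu> \<in> N"
      show False
      proof (cases "degree \<mu> = 0")
        case True
        then show False using smooth_degree_0[OF that] * g G.qpow_one by simp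
      next
        case False
        then have "prime_member (monic_irreducibles - \<omega>) \<mu>" using that by (simp add: prime_member_iff)
        then show False using iso * g unfolding isolated_def by blast
      qed
    qed
    then have "N \<in> \<A>" using N by (simp add: \<A>_def)
    \<comment> \<open>A power g^\<mu> in the union of a chain would already lie in one of its
      members, so avoidance survives.\<close>
    have "\<exists>M\<in>\<A>. \<forall>X\<in>\<A>. M \<subseteq> X \<longrightarrow> X = M"
    proof (rule subset_Zorn_nonempty)
      show "\<A> \<noteq> {}" using \<open>N \<in> \<A>\<close> by blast
      fix C assume C: "C \<noteq> {}" "subset.chain \<A> C"
      then have sub: "C \<subseteq> \<A>" and chain: "\<And>X Y. X \<in> C \<Longrightarrow> Y \<in> C \<Longrightarrow> X \<subseteq> Y \<or> Y \<subseteq> X"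
        by (auto simp: subset_chain_def)
      have "normal_powered_subgroup (\<Union>C) G"
        using G.normal_powered_subgroup_Union_chain[OF C(1) _ chain] sub by (auto simp: \<A>_def)
      then show "\<Union>C \<in> \<A>" using sub C(1) by (auto simp: \<A>_def)
    qed
    then obtain M where "M \<in> \<A>" and max: "\<And>X. X \<in> \<A> \<Longrightarrow> M \<subseteq> X \<Longrightarrow> X = M" by blast
    then have M: "normal_powered_subgroup M G" "N \<subseteq> M" "\<And>\<mu>. ?\<Lambda> \<mu> \<Longrightarrow> g \<up>\<^bsub>G\<^esub> \<mu> \<notin> M"
      by (auto simp: \<A>_def)
    note M' = normal_powered_subgroupD[OF M(1)]
    let ?K = "powered_quotient G M" and ?q = "\<lambda>a. M #>\<^bsub>G\<^esub> a"
    interpret K: nilpotent_powered_group ?K using G.nilpotent_powered_group_powered_quotient[OF M(1)] .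
    interpret q: powered_group_hom G ?K ?q using G.powered_group_hom_quotient[OF M(1)] .
    have K: "?q ` carrier G = carrier ?K" by (simp add: powered_quotient_simps)
    have one: "?q a = \<one>\<^bsub>?K\<^esub> \<longleftrightarrow> a \<in> M" if "a \<in> carrier G" for a
      using G.r_coset_eq_self_iff[OF M'(3) that] by (simp only: powered_quotient_simps(3))
    have series_K: "central_powered_series ?K (\<lambda>i. ?q ` H i) r"
    proof -
      have "?q ` H 0 = {\<one>\<^bsub>?K\<^esub>}" using ser(1) q.hom_one by simp
      moreover have "normal_powered_subgroup (?q ` H i) ?K" if "i \<le> r" for i
        using q.normal_powered_subgroup_image[OF ser(3)[OF that] K] .
      moreover have "commutator ?K x y \<in> ?q ` H i"
        if i: "i < r" and x: "x \<in> ?q ` H (Suc i)" and y: "y \<in> carrier ?K" for i x y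
      proof -
        obtain a b where ab: "x = ?q a" "a \<in> H (Suc i)" "y = ?q b" "b \<in> carrier G"
          using x y K by blast
        have "a \<in> carrier G"
          using subgroup.mem_carrier[OF normal_powered_subgroupD(3)[OF ser(3)] ab(2)] i by simp
        then show ?thesis
          using q.hom_commutator[of a b] ab ser(5)[OF i ab(2,4)] by (metis imageI)
      qed
      moreover have "?q ` H r = carrier ?K" using ser(2) K by simp
      moreover have "?q ` H i \<subseteq> ?q ` H (Suc i)" if "i < r" for i
        using image_mono[OF ser(4)[OF that]] .
      ultimately show ?thesis
        unfolding central_powered_series_def by (intro conjI allI impI ballI)
    qed
    have "FT \<omega> ?K"
    proof (rule K.smooth_monolithic_FT[OF assms(1) q.hom_closed[OF gG] _ _ series_K])
      show "?q g \<up>\<^bsub>?K\<^esub> \<mu> \<noteq> \<one>\<^bsub>?K\<^esub>" if "?\<Lambda> \<mu>" for \<mu>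
        using one[OF G.qpow_closed[OF gG]] M(3)[OF that] q.hom_qpow[OF gG] by metis
    next
      fix P assume P: "normal_powered_subgroup P ?K" "P \<noteq> {\<one>\<^bsub>?K\<^esub>}"
      let ?V = "{a \<in> carrier G. ?q a \<in> P}"
      have oneP: "\<one>\<^bsub>?K\<^esub> \<in> P" using subgroup.one_closed[OF normal_powered_subgroupD(3)[OF P(1)]] .
      then obtain x where x: "x \<in> P" "x \<noteq> \<one>\<^bsub>?K\<^esub>" using P(2) by blast
      then obtain a where a: "a \<in> carrier G" "x = ?q a"
        using subgroup.mem_carrier[OF normal_powered_subgroupD(3)[OF P(1)]] K by blast
      have "a \<in> ?V" "a \<notin> M" using a x one by auto
      have MV: "M \<subseteq> ?V"
      proof
        fix b assume b: "b \<in> M"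
        then have bG: "b \<in> carrier G" using subgroup.mem_carrier[OF M'(3)] by blast
        then show "b \<in> ?V" using one[OF bG] b oneP by simp
      qed
      \<comment> \<open>The preimage of \<open>P\<close> is normal, contains \<open>N\<close> and
        lies properly above \<open>M\<close>; the only way for it to fail membership in the family
        is to contain some g^\<mu>.\<close>
      then have "?V \<notin> \<A>" using max \<open>a \<in> ?V\<close> \<open>a \<notin> M\<close> by blast
      then obtain \<mu> where "?\<Lambda> \<mu>" "g \<up>\<^bsub>G\<^esub> \<mu> \<in> ?V"
        using q.normal_powered_subgroup_vimage[OF P(1)] M(2) MV unfolding \<A>_def by blast
      then show "\<exists>\<mu>. ?\<Lambda> \<mu> \<and> ?q g \<up>\<^bsub>?K\<^esub> \<mu> \<in> P" using q.hom_qpow[OF gG] by auto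
    next
      fix i \<pi> assume i: "i < r" and \<pi>: "\<pi> \<in> \<omega>"
      show "\<exists>S. finite S \<and> S \<subseteq> {x \<in> ?q ` H (Suc i). \<exists>k\<ge>1. x \<up>\<^bsub>?K\<^esub> (\<pi> ^ k) \<in> ?q ` H i} \<and>
        (\<forall>Q. powered_subgroup Q ?K \<longrightarrow> ?q ` H i \<union> S \<subseteq> Q \<longrightarrow>
          {x \<in> ?q ` H (Suc i). \<exists>k\<ge>1. x \<up>\<^bsub>?K\<^esub> (\<pi> ^ k) \<in> ?q ` H i} \<subseteq> Q)"
        using G.restricted_factor_image[OF normal_powered_subgroupD(1)[OF ser(3)] ser(3) ser(4)[OF i]
            restr[OF i] \<pi> q.powered_group_hom_axioms] i by simp
    qed
    moreover have "?q \<in> powered_hom G ?K"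
      using q.homh q.hom_qpow by (simp add: powered_hom_def)
    \<comment> \<open>\<open>M\<close> contains \<open>N\<close> but, by the case \<mu> = 1, not
      \<open>g\<close>.\<close>
    moreover have "?q g \<notin> ?q ` N"
    proof
      assume "?q g \<in> ?q ` N"
      then obtain n where n: "n \<in> N" "?q g = ?q n" by blast
      have "n \<in> M" "n \<in> carrier G" using n(1) M(2) subgroup.mem_carrier[OF M'(3)] by blast+
      then have "g \<in> M" using one[OF gG] one[of n] n(2) by simp
      then show False using M(3)[OF smooth_1] G.qpow_one[OF gG] by simp
    qed
    ultimately show "\<exists>(K :: 'a set powered_group) \<phi>. FT \<omega> K \<and> \<phi> \<in> powered_hom G K \<and>
        \<phi> ` carrier G = carrier K \<and> \<phi> g \<notin> \<phi> ` N"
      using K by blast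
  qed
qed

end
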